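(* Let $\mathcal{R}$ be a 2-ring, let $(\mathcal{A}_\cdot,L_\cdot,\alpha_\cdot)$ and $(\mathcal{B}_\cdot,M_\cdot,\beta_\cdot)$ be 2-cochain complexes of $\mathcal{R}$-2-modules, and let $(F_\cdot,\lambda_\cdot),(G_\cdot,\mu_\cdot):(\mathcal{A}_\cdot,L_\cdot,\alpha_\cdot)\to(\mathcal{B}_\cdot,M_\cdot,\beta_\cdot)$ be two morphisms of 2-cochain complexes. If $(F_\cdot,\lambda_\cdot)$ and $(G_\cdot,\mu_\cdot)$ are 2-cochain homotopic, then for each $n$ the induced morphisms $\mathcal{H}^n(F_\cdot),\mathcal{H}^n(G_\cdot):\mathcal{H}^n(\mathcal{A}_\cdot)\to\mathcal{H}^n(\mathcal{B}_\cdot)$ of cohomology $\mathcal{R}$-2-modules are equivalent, i.e. there is a (necessarily invertible) 2-morphism $\mathcal{H}^n(F_\cdot)\Rightarrow\mathcal{H}^n(G_\cdot)$ in ($\mathcal{R}$-2-Mod).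
   Context: **2-modules.** A symmetric 2-group is a symmetric monoidal groupoid $(\mathcal{A},+,0)$ in which every object has an inverse up to isomorphism. A 2-ring $\mathcal{R}$ is a symmetric 2-group with a second, monoidal, structure (multiplication, with unit object $I$) which distributes over $+$ up to coherent natural isomorphisms. An $\mathcal{R}$-2-module is a symmetric 2-group $\mathcal{A}$ with a bifunctor $\cdot:\mathcal{R}\times\mathcal{A}\to\mathcal{A}$ and coherent natural isomorphisms $r\cdot(x+y)\cong r\cdot x+r\cdot y$, $(r+s)\cdot x\cong r\cdot x+s\cdot x$, $(rs)\cdot x\cong r\cdot(s\cdot x)$, $I\cdot x\cong x$, $r\cdot 0\cong 0$ (equivalently, a homomorphism of 2-rings $\mathcal{R}\to\mathrm{End}(\mathcal{A})$). ($\mathcal{R}$-2-Mod) is the 2-category whose objects are $\mathcal{R}$-2-modules, whose 1-morphisms are $\mathcal{R}$-homomorphisms (symmetric monoidal functors $F$ with a coherent natural isomorphism $F(r\cdot x)\cong r\cdot F(x)$), and whose 2-morphisms are monoidal natural transformations compatible with these isomorphisms; all 2-morphisms are invertible. Both the one-object-one-morphism $\mathcal{R}$-2-module and the constant 1-morphisms at the unit object are written $0$. Sums of 1-morphisms are taken pointwise. Equalities of 2-morphisms and of composites are understood modulo the canonical structural isomorphisms (e.g. $F(0)\cong0$, $F(x+y)\cong F(x)+F(y)$, associativity, symmetry and unit isomorphisms). **Complexes.** A 2-cochain complex $(\mathcal{A}_\cdot,L_\cdot,\alpha_\cdot)$ consists of $\mathcal{R}$-2-modules $\mathcal{A}_n$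 ($n\ge 0$), 1-morphisms $L_n:\mathcal{A}_n\to\mathcal{A}_{n+1}$ and 2-morphisms $\alpha_n:L_{n+1}\circ L_n\Rightarrow 0$ such that $L_{n+2}\alpha_n=\alpha_{n+1}L_n$ as 2-morphisms $L_{n+2}L_{n+1}L_n\Rightarrow0$. It is completed on the left by zero $\mathcal{R}$-2-modules, zero 1-morphisms and canonical 2-morphisms. **Cohomology.** $\mathcal{H}^n(\mathcal{A}_\cdot)$ is the following $\mathcal{R}$-2-module. Objects: pairs $(A_n\in\mathcal{A}_n,\ a_n:L_n(A_n)\to0)$ with $L_{n+1}(a_n)=(\alpha_n)_{A_n}$. Morphisms $(A_n,a_n)\to(A_n',a_n')$: equivalence classes $[X_{n-1},x_{n-1}]$ of pairs $X_{n-1}\in\mathcal{A}_{n-1}$, $x_{n-1}:A_n\to L_{n-1}(X_{n-1})+A_n'$ such that $((\alpha_{n-1})_{X_{n-1}}+a_n')\circ L_n(x_{n-1})=a_n$. Two pairs $(X_{n-1},x_{n-1})$, $(X_{n-1}',x_{n-1}')$ are equivalent if there are $X_{n-2}\in\mathcal{A}_{n-2}$ and $x_{n-2}:X_{n-1}\to L_{n-2}(X_{n-2})+X_{n-1}'$ with $x_{n-1}'=((\alpha_{n-2})_{X_{n-2}}+1)\circ(L_{n-1}(x_{n-2})+1)\circ x_{n-1}$. Composition is $[X',x']\circ[X,x]=[X+X',(1+x')\circ x]$, and the sum and $\mathcal{R}$-action are induced from $\mathcal{A}_\cdot$. **Morphisms.** A morphism $(F_\cdot,\lambda_\cdot):(\mathcal{A}_\cdot,L_\cdot,\alpha_\cdot)\to(\mathcal{B}_\cdot,M_\cdot,\beta_\cdot)$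 consists of 1-morphisms $F_n:\mathcal{A}_n\to\mathcal{B}_n$ and 2-morphisms $\lambda_n:F_{n+1}L_n\Rightarrow M_nF_n$ such that $F_{n+2}\alpha_n$ equals the composite $F_{n+2}L_{n+1}L_n\xrightarrow{\lambda_{n+1}L_n}M_{n+1}F_{n+1}L_n\xrightarrow{M_{n+1}\lambda_n}M_{n+1}M_nF_n\xrightarrow{\beta_nF_n}0$. The induced $\mathcal{H}^n(F_\cdot)$ sends $(A_n,a_n)$ to $(F_n(A_n),F_{n+1}(a_n)\circ(\lambda_n)_{A_n}^{-1})$ and $[X_{n-1},x_{n-1}]$ to $[F_{n-1}(X_{n-1}),((\lambda_{n-1})_{X_{n-1}}+1)\circ F_n(x_{n-1})]$. **Homotopy.** $(F_\cdot,\lambda_\cdot)$ and $(G_\cdot,\mu_\cdot)$ are 2-cochain homotopic if there are 1-morphisms $H_{n-1}:\mathcal{A}_n\to\mathcal{B}_{n-1}$ and 2-morphisms $\tau_n:F_n\Rightarrow M_{n-1}H_{n-1}+H_nL_n+G_n$ for all $n$ such that the following two 2-morphisms $F_{n+1}L_n\Rightarrow M_nH_nL_n+M_nG_n$ coincide: (i) $\tau_{n+1}L_n$ followed by $H_{n+1}\alpha_n:H_{n+1}L_{n+1}L_n\Rightarrow0$ and $\mu_n:G_{n+1}L_n\Rightarrow M_nG_n$ on the corresponding summands; (ii) $\lambda_n$ followed by $M_n\tau_n$ and then $\beta_{n-1}H_{n-1}:M_nM_{n-1}H_{n-1}\Rightarrow0$ on the corresponding summand. *)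

theory Defs
  imports Main
begin

text \<open>
  Categories are given by a carrier of objects and a carrier of arrows inside two types; every
  arrow knows its source and target. Values outside the carriers are irrelevant.
  Composition \<open>g \<cdot> f\<close> is written in the usual order (\<open>f\<close> first). The operation \<open>\<oplus>\<close> is the sum of
  objects and \<open>\<boxplus>\<close> the sum of arrows; similarly \<open>\<otimes>\<close>, \<open>\<boxtimes>\<close> for the multiplication of a 2-ring and
  \<open>\<odot>\<close>, \<open>\<boxdot>\<close> for the action on a 2-module.
\<close>

section \<open>Symmetric 2-groups\<close>

record ('o, 'm) sm_data =
  Obj   :: "'o set"
  Arr   :: "'m set"
  Src   :: "'m \<Rightarrow> 'o"
  Tgt   :: "'m \<Rightarrow> 'o"
  Ide   :: "'o \<Rightarrow> 'm"                     ("\<iota>\<index>")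
  Comp  :: "'m \<Rightarrow> 'm \<Rightarrow> 'm"               (infixr "\<cdot>\<index>" 55)
  AddO  :: "'o \<Rightarrow> 'o \<Rightarrow> 'o"               (infixl "\<oplus>\<index>" 65)
  AddA  :: "'m \<Rightarrow> 'm \<Rightarrow> 'm"               (infixl "\<boxplus>\<index>" 65)
  Zero  :: "'o"                           ("\<zero>\<index>")
  Assoc :: "'o \<Rightarrow> 'o \<Rightarrow> 'o \<Rightarrow> 'm"
  LUnit :: "'o \<Rightarrow> 'm"
  RUnit :: "'o \<Rightarrow> 'm"
  Symm  :: "'o \<Rightarrow> 'o \<Rightarrow> 'm"

definition in_hom :: "('o, 'm, 'z) sm_data_scheme \<Rightarrow> 'm \<Rightarrow> 'o \<Rightarrow> 'o \<Rightarrow> bool"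
    ("(\<guillemotleft>_ : _ \<rightarrow>\<index> _\<guillemotright>)")
  where "\<guillemotleft>f : x \<rightarrow>\<^bsub>A\<^esub> y\<guillemotright> \<longleftrightarrow> f \<in> Arr A \<and> Src A f = x \<and> Tgt A f = y"

definition inverse_arrows :: "('o, 'm, 'z) sm_data_scheme \<Rightarrow> 'm \<Rightarrow> 'm \<Rightarrow> bool"
  where "inverse_arrows A f g \<longleftrightarrow>
    f \<in> Arr A \<and> \<guillemotleft>g : Tgt A f \<rightarrow>\<^bsub>A\<^esub> Src A f\<guillemotright> \<and>
    g \<cdot>\<^bsub>A\<^esub> f = \<iota>\<^bsub>A\<^esub> (Src A f) \<and> f \<cdot>\<^bsub>A\<^esub> g = \<iota>\<^bsub>A\<^esub> (Tgt A f)"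

definition Inv :: "('o, 'm, 'z) sm_data_scheme \<Rightarrow> 'm \<Rightarrow> 'm"
  where "Inv A f = (THE g. inverse_arrows A f g)"

locale groupoid =
  fixes A :: "('o, 'm, 'z) sm_data_scheme" (structure)
  assumes Src_Obj: "f \<in> Arr A \<Longrightarrow> Src A f \<in> Obj A"
    and Tgt_Obj: "f \<in> Arr A \<Longrightarrow> Tgt A f \<in> Obj A"
    and Ide_in_hom: "x \<in> Obj A \<Longrightarrow> \<guillemotleft>\<iota> x : x \<rightarrow> x\<guillemotright>"
    and Comp_in_hom: "\<guillemotleft>f : x \<rightarrow> y\<guillemotright> \<Longrightarrow> \<guillemotleft>g : y \<rightarrow> z\<guillemotright> \<Longrightarrow> \<guillemotleft>g \<cdot> f : x \<rightarrow> z\<guillemotright>"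
    and Comp_Ide: "\<guillemotleft>f : x \<rightarrow> y\<guillemotright> \<Longrightarrow> f \<cdot> \<iota> x = f"
    and Ide_Comp: "\<guillemotleft>f : x \<rightarrow> y\<guillemotright> \<Longrightarrow> \<iota> y \<cdot> f = f"
    and Comp_assoc: "\<guillemotleft>f : w \<rightarrow> x\<guillemotright> \<Longrightarrow> \<guillemotleft>g : x \<rightarrow> y\<guillemotright> \<Longrightarrow> \<guillemotleft>h : y \<rightarrow> z\<guillemotright> \<Longrightarrow>
      (h \<cdot> g) \<cdot> f = h \<cdot> (g \<cdot> f)"
    and ex_inverse: "f \<in> Arr A \<Longrightarrow> \<exists>g. inverse_arrows A f g"

locale symmetric_2group = groupoid +
  assumes Zero_Obj: "\<zero> \<in> Obj A"
    and AddO_Obj: "x \<in> Obj A \<Longrightarrow> y \<in> Obj A \<Longrightarrow> x \<oplus> y \<in> Obj A"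
    and AddA_in_hom: "\<guillemotleft>f : x \<rightarrow> x'\<guillemotright> \<Longrightarrow> \<guillemotleft>g : y \<rightarrow> y'\<guillemotright> \<Longrightarrow> \<guillemotleft>f \<boxplus> g : x \<oplus> y \<rightarrow> x' \<oplus> y'\<guillemotright>"
    and AddA_Ide: "x \<in> Obj A \<Longrightarrow> y \<in> Obj A \<Longrightarrow> \<iota> x \<boxplus> \<iota> y = \<iota> (x \<oplus> y)"
    and AddA_Comp: "\<guillemotleft>f : x \<rightarrow> y\<guillemotright> \<Longrightarrow> \<guillemotleft>g : y \<rightarrow> z\<guillemotright> \<Longrightarrow> \<guillemotleft>f' : x' \<rightarrow> y'\<guillemotright> \<Longrightarrow> \<guillemotleft>g' : y' \<rightarrow> z'\<guillemotright> \<Longrightarrow>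
      (g \<cdot> f) \<boxplus> (g' \<cdot> f') = (g \<boxplus> g') \<cdot> (f \<boxplus> f')"
    and Assoc_in_hom: "x \<in> Obj A \<Longrightarrow> y \<in> Obj A \<Longrightarrow> z \<in> Obj A \<Longrightarrow>
      \<guillemotleft>Assoc A x y z : (x \<oplus> y) \<oplus> z \<rightarrow> x \<oplus> (y \<oplus> z)\<guillemotright>"
    and LUnit_in_hom: "x \<in> Obj A \<Longrightarrow> \<guillemotleft>LUnit A x : \<zero> \<oplus> x \<rightarrow> x\<guillemotright>"
    and RUnit_in_hom: "x \<in> Obj A \<Longrightarrow> \<guillemotleft>RUnit A x : x \<oplus> \<zero> \<rightarrow> x\<guillemotright>"
    and Symm_in_hom: "x \<in> Obj A \<Longrightarrow> y \<in> Obj A \<Longrightarrow> \<guillemotleft>Symm A x y : x \<oplus> y \<rightarrow> y \<oplus> x\<guillemotright>"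
    and Assoc_natural: "\<guillemotleft>f : x \<rightarrow> x'\<guillemotright> \<Longrightarrow> \<guillemotleft>g : y \<rightarrow> y'\<guillemotright> \<Longrightarrow> \<guillemotleft>h : z \<rightarrow> z'\<guillemotright> \<Longrightarrow>
      Assoc A x' y' z' \<cdot> ((f \<boxplus> g) \<boxplus> h) = (f \<boxplus> (g \<boxplus> h)) \<cdot> Assoc A x y z"
    and LUnit_natural: "\<guillemotleft>f : x \<rightarrow> x'\<guillemotright> \<Longrightarrow> LUnit A x' \<cdot> (\<iota> \<zero> \<boxplus> f) = f \<cdot> LUnit A x"
    and RUnit_natural: "\<guillemotleft>f : x \<rightarrow> x'\<guillemotright> \<Longrightarrow> RUnit A x' \<cdot> (f \<boxplus> \<iota> \<zero>) = f \<cdot> RUnit A x"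
    and Symm_natural: "\<guillemotleft>f : x \<rightarrow> x'\<guillemotright> \<Longrightarrow> \<guillemotleft>g : y \<rightarrow> y'\<guillemotright> \<Longrightarrow>
      Symm A x' y' \<cdot> (f \<boxplus> g) = (g \<boxplus> f) \<cdot> Symm A x y"
    and pentagon: "w \<in> Obj A \<Longrightarrow> x \<in> Obj A \<Longrightarrow> y \<in> Obj A \<Longrightarrow> z \<in> Obj A \<Longrightarrow>
      Assoc A w x (y \<oplus> z) \<cdot> Assoc A (w \<oplus> x) y z
      = (\<iota> w \<boxplus> Assoc A x y z) \<cdot> Assoc A w (x \<oplus> y) z \<cdot> (Assoc A w x y \<boxplus> \<iota> z)"
    and triangle: "x \<in> Obj A \<Longrightarrow> y \<in> Obj A \<Longrightarrow>
      (\<iota> x \<boxplus> LUnit A y) \<cdot> Assoc A x \<zero> y = RUnit A x \<boxplus> \<iota> y"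
    and hexagon: "x \<in> Obj A \<Longrightarrow> y \<in> Obj A \<Longrightarrow> z \<in> Obj A \<Longrightarrow>
      Assoc A y z x \<cdot> Symm A x (y \<oplus> z) \<cdot> Assoc A x y z
      = (\<iota> y \<boxplus> Symm A x z) \<cdot> Assoc A y x z \<cdot> (Symm A x y \<boxplus> \<iota> z)"
    and Symm_Symm: "x \<in> Obj A \<Longrightarrow> y \<in> Obj A \<Longrightarrow> Symm A y x \<cdot> Symm A x y = \<iota> (x \<oplus> y)"
    and ex_opposite: "x \<in> Obj A \<Longrightarrow> \<exists>y\<in>Obj A. \<exists>f. \<guillemotleft>f : x \<oplus> y \<rightarrow> \<zero>\<guillemotright>"

text \<open>The canonical arrow from \<open>(w \<oplus> x) \<oplus> (y \<oplus> z)\<close> to \<open>(w \<oplus> y) \<oplus> (x \<oplus> z)\<close>.\<close>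

definition Interchange :: "('o, 'm, 'z) sm_data_scheme \<Rightarrow> 'o \<Rightarrow> 'o \<Rightarrow> 'o \<Rightarrow> 'o \<Rightarrow> 'm"
  where "Interchange A w x y z =
    Inv A (Assoc A w y (x \<oplus>\<^bsub>A\<^esub> z))
    \<cdot>\<^bsub>A\<^esub> (\<iota>\<^bsub>A\<^esub> w \<boxplus>\<^bsub>A\<^esub> Assoc A y x z)
    \<cdot>\<^bsub>A\<^esub> (\<iota>\<^bsub>A\<^esub> w \<boxplus>\<^bsub>A\<^esub> (Symm A x y \<boxplus>\<^bsub>A\<^esub> \<iota>\<^bsub>A\<^esub> z))
    \<cdot>\<^bsub>A\<^esub> (\<iota>\<^bsub>A\<^esub> w \<boxplus>\<^bsub>A\<^esub> Inv A (Assoc A x y z))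
    \<cdot>\<^bsub>A\<^esub> Assoc A w x (y \<oplus>\<^bsub>A\<^esub> z)"


section \<open>2-rings\<close>

record ('r, 's) ring_data = "('r, 's) sm_data" +
  MulO   :: "'r \<Rightarrow> 'r \<Rightarrow> 'r"               (infixl "\<otimes>\<index>" 70)
  MulA   :: "'s \<Rightarrow> 's \<Rightarrow> 's"               (infixl "\<boxtimes>\<index>" 70)
  One    :: "'r"                           ("\<one>\<index>")
  MAssoc :: "'r \<Rightarrow> 'r \<Rightarrow> 'r \<Rightarrow> 's"
  MLUnit :: "'r \<Rightarrow> 's"
  MRUnit :: "'r \<Rightarrow> 's"
  LDist  :: "'r \<Rightarrow> 'r \<Rightarrow> 'r \<Rightarrow> 's"
  RDist  :: "'r \<Rightarrow> 'r \<Rightarrow> 'r \<Rightarrow> 's"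

text \<open>
  The coherence conditions say that multiplication is a monoidal structure, that \<open>r \<otimes> -\<close> and
  \<open>- \<otimes> s\<close> are symmetric monoidal functors for \<open>\<oplus>\<close>, that the two expansions of
  \<open>(r \<oplus> s) \<otimes> (t \<oplus> u)\<close> agree, and that the multiplicative associativity and unit constraints are
  additive in each variable.
\<close>

locale two_ring = symmetric_2group R for R :: "('r, 's) ring_data" (structure) +
  assumes One_Obj: "\<one> \<in> Obj R"
    and MulO_Obj: "r \<in> Obj R \<Longrightarrow> s \<in> Obj R \<Longrightarrow> r \<otimes> s \<in> Obj R"
    and MulA_in_hom: "\<guillemotleft>f : r \<rightarrow> r'\<guillemotright> \<Longrightarrow> \<guillemotleft>g : s \<rightarrow> s'\<guillemotright> \<Longrightarrow> \<guillemotleft>f \<boxtimes> g : r \<otimes> s \<rightarrow> r' \<otimes> s'\<guillemotright>"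
    and MulA_Ide: "r \<in> Obj R \<Longrightarrow> s \<in> Obj R \<Longrightarrow> \<iota> r \<boxtimes> \<iota> s = \<iota> (r \<otimes> s)"
    and MulA_Comp: "\<guillemotleft>f : r \<rightarrow> s\<guillemotright> \<Longrightarrow> \<guillemotleft>g : s \<rightarrow> t\<guillemotright> \<Longrightarrow> \<guillemotleft>f' : r' \<rightarrow> s'\<guillemotright> \<Longrightarrow> \<guillemotleft>g' : s' \<rightarrow> t'\<guillemotright> \<Longrightarrow>
      (g \<cdot> f) \<boxtimes> (g' \<cdot> f') = (g \<boxtimes> g') \<cdot> (f \<boxtimes> f')"
    and MAssoc_in_hom: "r \<in> Obj R \<Longrightarrow> s \<in> Obj R \<Longrightarrow> t \<in> Obj R \<Longrightarrow>
      \<guillemotleft>MAssoc R r s t : (r \<otimes> s) \<otimes> t \<rightarrow> r \<otimes> (s \<otimes> t)\<guillemotright>"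
    and MLUnit_in_hom: "r \<in> Obj R \<Longrightarrow> \<guillemotleft>MLUnit R r : \<one> \<otimes> r \<rightarrow> r\<guillemotright>"
    and MRUnit_in_hom: "r \<in> Obj R \<Longrightarrow> \<guillemotleft>MRUnit R r : r \<otimes> \<one> \<rightarrow> r\<guillemotright>"
    and LDist_in_hom: "r \<in> Obj R \<Longrightarrow> s \<in> Obj R \<Longrightarrow> t \<in> Obj R \<Longrightarrow>
      \<guillemotleft>LDist R r s t : r \<otimes> (s \<oplus> t) \<rightarrow> r \<otimes> s \<oplus> r \<otimes> t\<guillemotright>"
    and RDist_in_hom: "r \<in> Obj R \<Longrightarrow> s \<in> Obj R \<Longrightarrow> t \<in> Obj R \<Longrightarrow>
      \<guillemotleft>RDist R r s t : (r \<oplus> s) \<otimes> t \<rightarrow> r \<otimes> t \<oplus> s \<otimes> t\<guillemotright>"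
    and MAssoc_natural: "\<guillemotleft>f : r \<rightarrow> r'\<guillemotright> \<Longrightarrow> \<guillemotleft>g : s \<rightarrow> s'\<guillemotright> \<Longrightarrow> \<guillemotleft>h : t \<rightarrow> t'\<guillemotright> \<Longrightarrow>
      MAssoc R r' s' t' \<cdot> ((f \<boxtimes> g) \<boxtimes> h) = (f \<boxtimes> (g \<boxtimes> h)) \<cdot> MAssoc R r s t"
    and MLUnit_natural: "\<guillemotleft>f : r \<rightarrow> r'\<guillemotright> \<Longrightarrow> MLUnit R r' \<cdot> (\<iota> \<one> \<boxtimes> f) = f \<cdot> MLUnit R r"
    and MRUnit_natural: "\<guillemotleft>f : r \<rightarrow> r'\<guillemotright> \<Longrightarrow> MRUnit R r' \<cdot> (f \<boxtimes> \<iota> \<one>) = f \<cdot> MRUnit R r"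
    and LDist_natural: "\<guillemotleft>f : r \<rightarrow> r'\<guillemotright> \<Longrightarrow> \<guillemotleft>g : s \<rightarrow> s'\<guillemotright> \<Longrightarrow> \<guillemotleft>h : t \<rightarrow> t'\<guillemotright> \<Longrightarrow>
      LDist R r' s' t' \<cdot> (f \<boxtimes> (g \<boxplus> h)) = (f \<boxtimes> g \<boxplus> f \<boxtimes> h) \<cdot> LDist R r s t"
    and RDist_natural: "\<guillemotleft>f : r \<rightarrow> r'\<guillemotright> \<Longrightarrow> \<guillemotleft>g : s \<rightarrow> s'\<guillemotright> \<Longrightarrow> \<guillemotleft>h : t \<rightarrow> t'\<guillemotright> \<Longrightarrow>
      RDist R r' s' t' \<cdot> ((f \<boxplus> g) \<boxtimes> h) = (f \<boxtimes> h \<boxplus> g \<boxtimes> h) \<cdot> RDist R r s t"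
    and M_pentagon: "r \<in> Obj R \<Longrightarrow> s \<in> Obj R \<Longrightarrow> t \<in> Obj R \<Longrightarrow> u \<in> Obj R \<Longrightarrow>
      MAssoc R r s (t \<otimes> u) \<cdot> MAssoc R (r \<otimes> s) t u
      = (\<iota> r \<boxtimes> MAssoc R s t u) \<cdot> MAssoc R r (s \<otimes> t) u \<cdot> (MAssoc R r s t \<boxtimes> \<iota> u)"
    and M_triangle: "r \<in> Obj R \<Longrightarrow> s \<in> Obj R \<Longrightarrow>
      (\<iota> r \<boxtimes> MLUnit R s) \<cdot> MAssoc R r \<one> s = MRUnit R r \<boxtimes> \<iota> s"
    and LDist_Assoc: "r \<in> Obj R \<Longrightarrow> s \<in> Obj R \<Longrightarrow> t \<in> Obj R \<Longrightarrow> u \<in> Obj R \<Longrightarrow>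
      Assoc R (r \<otimes> s) (r \<otimes> t) (r \<otimes> u) \<cdot> (LDist R r s t \<boxplus> \<iota> (r \<otimes> u)) \<cdot> LDist R r (s \<oplus> t) u
      = (\<iota> (r \<otimes> s) \<boxplus> LDist R r t u) \<cdot> LDist R r s (t \<oplus> u) \<cdot> (\<iota> r \<boxtimes> Assoc R s t u)"
    and LDist_Symm: "r \<in> Obj R \<Longrightarrow> s \<in> Obj R \<Longrightarrow> t \<in> Obj R \<Longrightarrow>
      Symm R (r \<otimes> s) (r \<otimes> t) \<cdot> LDist R r s t = LDist R r t s \<cdot> (\<iota> r \<boxtimes> Symm R s t)"
    and RDist_Assoc: "r \<in> Obj R \<Longrightarrow> s \<in> Obj R \<Longrightarrow> t \<in> Obj R \<Longrightarrow> u \<in> Obj R \<Longrightarrow>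
      Assoc R (r \<otimes> u) (s \<otimes> u) (t \<otimes> u) \<cdot> (RDist R r s u \<boxplus> \<iota> (t \<otimes> u)) \<cdot> RDist R (r \<oplus> s) t u
      = (\<iota> (r \<otimes> u) \<boxplus> RDist R s t u) \<cdot> RDist R r (s \<oplus> t) u \<cdot> (Assoc R r s t \<boxtimes> \<iota> u)"
    and RDist_Symm: "r \<in> Obj R \<Longrightarrow> s \<in> Obj R \<Longrightarrow> t \<in> Obj R \<Longrightarrow>
      Symm R (r \<otimes> t) (s \<otimes> t) \<cdot> RDist R r s t = RDist R s r t \<cdot> (Symm R r s \<boxtimes> \<iota> t)"
    and LDist_RDist: "r \<in> Obj R \<Longrightarrow> s \<in> Obj R \<Longrightarrow> t \<in> Obj R \<Longrightarrow> u \<in> Obj R \<Longrightarrow>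
      (LDist R r t u \<boxplus> LDist R s t u) \<cdot> RDist R r s (t \<oplus> u)
      = Interchange R (r \<otimes> t) (s \<otimes> t) (r \<otimes> u) (s \<otimes> u)
        \<cdot> (RDist R r s t \<boxplus> RDist R r s u) \<cdot> LDist R (r \<oplus> s) t u"
    and MAssoc_add3: "r \<in> Obj R \<Longrightarrow> s \<in> Obj R \<Longrightarrow> t \<in> Obj R \<Longrightarrow> u \<in> Obj R \<Longrightarrow>
      (MAssoc R r s t \<boxplus> MAssoc R r s u) \<cdot> LDist R (r \<otimes> s) t u
      = LDist R r (s \<otimes> t) (s \<otimes> u) \<cdot> (\<iota> r \<boxtimes> LDist R s t u) \<cdot> MAssoc R r s (t \<oplus> u)"
    and MAssoc_add2: "r \<in> Obj R \<Longrightarrow> s \<in> Obj R \<Longrightarrow> t \<in> Obj R \<Longrightarrow> u \<in> Obj R \<Longrightarrow>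
      (MAssoc R r s u \<boxplus> MAssoc R r t u) \<cdot> RDist R (r \<otimes> s) (r \<otimes> t) u \<cdot> (LDist R r s t \<boxtimes> \<iota> u)
      = LDist R r (s \<otimes> u) (t \<otimes> u) \<cdot> (\<iota> r \<boxtimes> RDist R s t u) \<cdot> MAssoc R r (s \<oplus> t) u"
    and MAssoc_add1: "r \<in> Obj R \<Longrightarrow> s \<in> Obj R \<Longrightarrow> t \<in> Obj R \<Longrightarrow> u \<in> Obj R \<Longrightarrow>
      (MAssoc R r t u \<boxplus> MAssoc R s t u) \<cdot> RDist R (r \<otimes> t) (s \<otimes> t) u \<cdot> (RDist R r s t \<boxtimes> \<iota> u)
      = RDist R r s (t \<otimes> u) \<cdot> MAssoc R (r \<oplus> s) t u"
    and MLUnit_add: "r \<in> Obj R \<Longrightarrow> s \<in> Obj R \<Longrightarrow>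
      (MLUnit R r \<boxplus> MLUnit R s) \<cdot> LDist R \<one> r s = MLUnit R (r \<oplus> s)"
    and MRUnit_add: "r \<in> Obj R \<Longrightarrow> s \<in> Obj R \<Longrightarrow>
      (MRUnit R r \<boxplus> MRUnit R s) \<cdot> RDist R r s \<one> = MRUnit R (r \<oplus> s)"


section \<open>2-modules\<close>

record ('r, 's, 'o, 'm) mod_data = "('o, 'm) sm_data" +
  ActO    :: "'r \<Rightarrow> 'o \<Rightarrow> 'o"              (infixr "\<odot>\<index>" 70)
  ActA    :: "'s \<Rightarrow> 'm \<Rightarrow> 'm"              (infixr "\<boxdot>\<index>" 70)
  ActAdd  :: "'r \<Rightarrow> 'o \<Rightarrow> 'o \<Rightarrow> 'm"
  AddAct  :: "'r \<Rightarrow> 'r \<Rightarrow> 'o \<Rightarrow> 'm"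
  MulAct  :: "'r \<Rightarrow> 'r \<Rightarrow> 'o \<Rightarrow> 'm"
  OneAct  :: "'o \<Rightarrow> 'm"
  ActZero :: "'r \<Rightarrow> 'm"

text \<open>
  The coherence conditions express that the action is a homomorphism of 2-rings from \<open>R\<close> to the
  2-ring of endomorphisms of \<open>A\<close>.
\<close>

locale two_module = R: two_ring R + A: symmetric_2group A
  for R :: "('r, 's) ring_data" and A :: "('r, 's, 'o, 'm) mod_data" +
  assumes ActO_Obj: "r \<in> Obj R \<Longrightarrow> x \<in> Obj A \<Longrightarrow> r \<odot>\<^bsub>A\<^esub> x \<in> Obj A"
    and ActA_in_hom: "\<guillemotleft>a : r \<rightarrow>\<^bsub>R\<^esub> r'\<guillemotright> \<Longrightarrow> \<guillemotleft>f : x \<rightarrow>\<^bsub>A\<^esub> x'\<guillemotright> \<Longrightarrow>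
      \<guillemotleft>a \<boxdot>\<^bsub>A\<^esub> f : r \<odot>\<^bsub>A\<^esub> x \<rightarrow>\<^bsub>A\<^esub> r' \<odot>\<^bsub>A\<^esub> x'\<guillemotright>"
    and ActA_Ide: "r \<in> Obj R \<Longrightarrow> x \<in> Obj A \<Longrightarrow> \<iota>\<^bsub>R\<^esub> r \<boxdot>\<^bsub>A\<^esub> \<iota>\<^bsub>A\<^esub> x = \<iota>\<^bsub>A\<^esub> (r \<odot>\<^bsub>A\<^esub> x)"
    and ActA_Comp: "\<guillemotleft>a : r \<rightarrow>\<^bsub>R\<^esub> s\<guillemotright> \<Longrightarrow> \<guillemotleft>b : s \<rightarrow>\<^bsub>R\<^esub> t\<guillemotright> \<Longrightarrow> \<guillemotleft>f : x \<rightarrow>\<^bsub>A\<^esub> y\<guillemotright> \<Longrightarrow> \<guillemotleft>g : y \<rightarrow>\<^bsub>A\<^esub> z\<guillemotright> \<Longrightarrow>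
      (b \<cdot>\<^bsub>R\<^esub> a) \<boxdot>\<^bsub>A\<^esub> (g \<cdot>\<^bsub>A\<^esub> f) = (b \<boxdot>\<^bsub>A\<^esub> g) \<cdot>\<^bsub>A\<^esub> (a \<boxdot>\<^bsub>A\<^esub> f)"
    and ActAdd_in_hom: "r \<in> Obj R \<Longrightarrow> x \<in> Obj A \<Longrightarrow> y \<in> Obj A \<Longrightarrow>
      \<guillemotleft>ActAdd A r x y : r \<odot>\<^bsub>A\<^esub> (x \<oplus>\<^bsub>A\<^esub> y) \<rightarrow>\<^bsub>A\<^esub> r \<odot>\<^bsub>A\<^esub> x \<oplus>\<^bsub>A\<^esub> r \<odot>\<^bsub>A\<^esub> y\<guillemotright>"
    and AddAct_in_hom: "r \<in> Obj R \<Longrightarrow> s \<in> Obj R \<Longrightarrow> x \<in> Obj A \<Longrightarrow>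
      \<guillemotleft>AddAct A r s x : (r \<oplus>\<^bsub>R\<^esub> s) \<odot>\<^bsub>A\<^esub> x \<rightarrow>\<^bsub>A\<^esub> r \<odot>\<^bsub>A\<^esub> x \<oplus>\<^bsub>A\<^esub> s \<odot>\<^bsub>A\<^esub> x\<guillemotright>"
    and MulAct_in_hom: "r \<in> Obj R \<Longrightarrow> s \<in> Obj R \<Longrightarrow> x \<in> Obj A \<Longrightarrow>
      \<guillemotleft>MulAct A r s x : (r \<otimes>\<^bsub>R\<^esub> s) \<odot>\<^bsub>A\<^esub> x \<rightarrow>\<^bsub>A\<^esub> r \<odot>\<^bsub>A\<^esub> (s \<odot>\<^bsub>A\<^esub> x)\<guillemotright>"
    and OneAct_in_hom: "x \<in> Obj A \<Longrightarrow> \<guillemotleft>OneAct A x : \<one>\<^bsub>R\<^esub> \<odot>\<^bsub>A\<^esub> x \<rightarrow>\<^bsub>A\<^esub> x\<guillemotright>"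
    and ActZero_in_hom: "r \<in> Obj R \<Longrightarrow> \<guillemotleft>ActZero A r : r \<odot>\<^bsub>A\<^esub> \<zero>\<^bsub>A\<^esub> \<rightarrow>\<^bsub>A\<^esub> \<zero>\<^bsub>A\<^esub>\<guillemotright>"
    and ActAdd_natural: "\<guillemotleft>a : r \<rightarrow>\<^bsub>R\<^esub> r'\<guillemotright> \<Longrightarrow> \<guillemotleft>f : x \<rightarrow>\<^bsub>A\<^esub> x'\<guillemotright> \<Longrightarrow> \<guillemotleft>g : y \<rightarrow>\<^bsub>A\<^esub> y'\<guillemotright> \<Longrightarrow>
      ActAdd A r' x' y' \<cdot>\<^bsub>A\<^esub> (a \<boxdot>\<^bsub>A\<^esub> (f \<boxplus>\<^bsub>A\<^esub> g))
      = (a \<boxdot>\<^bsub>A\<^esub> f \<boxplus>\<^bsub>A\<^esub> a \<boxdot>\<^bsub>A\<^esub> g) \<cdot>\<^bsub>A\<^esub> ActAdd A r x y"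
    and AddAct_natural: "\<guillemotleft>a : r \<rightarrow>\<^bsub>R\<^esub> r'\<guillemotright> \<Longrightarrow> \<guillemotleft>b : s \<rightarrow>\<^bsub>R\<^esub> s'\<guillemotright> \<Longrightarrow> \<guillemotleft>f : x \<rightarrow>\<^bsub>A\<^esub> x'\<guillemotright> \<Longrightarrow>
      AddAct A r' s' x' \<cdot>\<^bsub>A\<^esub> ((a \<boxplus>\<^bsub>R\<^esub> b) \<boxdot>\<^bsub>A\<^esub> f)
      = (a \<boxdot>\<^bsub>A\<^esub> f \<boxplus>\<^bsub>A\<^esub> b \<boxdot>\<^bsub>A\<^esub> f) \<cdot>\<^bsub>A\<^esub> AddAct A r s x"
    and MulAct_natural: "\<guillemotleft>a : r \<rightarrow>\<^bsub>R\<^esub> r'\<guillemotright> \<Longrightarrow> \<guillemotleft>b : s \<rightarrow>\<^bsub>R\<^esub> s'\<guillemotright> \<Longrightarrow> \<guillemotleft>f : x \<rightarrow>\<^bsub>A\<^esub> x'\<guillemotright> \<Longrightarrow>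
      MulAct A r' s' x' \<cdot>\<^bsub>A\<^esub> ((a \<boxtimes>\<^bsub>R\<^esub> b) \<boxdot>\<^bsub>A\<^esub> f) = (a \<boxdot>\<^bsub>A\<^esub> (b \<boxdot>\<^bsub>A\<^esub> f)) \<cdot>\<^bsub>A\<^esub> MulAct A r s x"
    and OneAct_natural: "\<guillemotleft>f : x \<rightarrow>\<^bsub>A\<^esub> x'\<guillemotright> \<Longrightarrow>
      OneAct A x' \<cdot>\<^bsub>A\<^esub> (\<iota>\<^bsub>R\<^esub> \<one>\<^bsub>R\<^esub> \<boxdot>\<^bsub>A\<^esub> f) = f \<cdot>\<^bsub>A\<^esub> OneAct A x"
    and ActZero_natural: "\<guillemotleft>a : r \<rightarrow>\<^bsub>R\<^esub> r'\<guillemotright> \<Longrightarrow> ActZero A r' \<cdot>\<^bsub>A\<^esub> (a \<boxdot>\<^bsub>A\<^esub> \<iota>\<^bsub>A\<^esub> \<zero>\<^bsub>A\<^esub>) = ActZero A r"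
    and ActAdd_Assoc: "r \<in> Obj R \<Longrightarrow> x \<in> Obj A \<Longrightarrow> y \<in> Obj A \<Longrightarrow> z \<in> Obj A \<Longrightarrow>
      Assoc A (r \<odot>\<^bsub>A\<^esub> x) (r \<odot>\<^bsub>A\<^esub> y) (r \<odot>\<^bsub>A\<^esub> z)
        \<cdot>\<^bsub>A\<^esub> (ActAdd A r x y \<boxplus>\<^bsub>A\<^esub> \<iota>\<^bsub>A\<^esub> (r \<odot>\<^bsub>A\<^esub> z)) \<cdot>\<^bsub>A\<^esub> ActAdd A r (x \<oplus>\<^bsub>A\<^esub> y) z
      = (\<iota>\<^bsub>A\<^esub> (r \<odot>\<^bsub>A\<^esub> x) \<boxplus>\<^bsub>A\<^esub> ActAdd A r y z)
        \<cdot>\<^bsub>A\<^esub> ActAdd A r x (y \<oplus>\<^bsub>A\<^esub> z) \<cdot>\<^bsub>A\<^esub> (\<iota>\<^bsub>R\<^esub> r \<boxdot>\<^bsub>A\<^esub> Assoc A x y z)"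
    and ActAdd_Symm: "r \<in> Obj R \<Longrightarrow> x \<in> Obj A \<Longrightarrow> y \<in> Obj A \<Longrightarrow>
      Symm A (r \<odot>\<^bsub>A\<^esub> x) (r \<odot>\<^bsub>A\<^esub> y) \<cdot>\<^bsub>A\<^esub> ActAdd A r x y
      = ActAdd A r y x \<cdot>\<^bsub>A\<^esub> (\<iota>\<^bsub>R\<^esub> r \<boxdot>\<^bsub>A\<^esub> Symm A x y)"
    and ActAdd_ActZero: "r \<in> Obj R \<Longrightarrow> x \<in> Obj A \<Longrightarrow>
      LUnit A (r \<odot>\<^bsub>A\<^esub> x) \<cdot>\<^bsub>A\<^esub> (ActZero A r \<boxplus>\<^bsub>A\<^esub> \<iota>\<^bsub>A\<^esub> (r \<odot>\<^bsub>A\<^esub> x)) \<cdot>\<^bsub>A\<^esub> ActAdd A r \<zero>\<^bsub>A\<^esub> x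
      = \<iota>\<^bsub>R\<^esub> r \<boxdot>\<^bsub>A\<^esub> LUnit A x"
    and AddAct_Assoc: "r \<in> Obj R \<Longrightarrow> s \<in> Obj R \<Longrightarrow> t \<in> Obj R \<Longrightarrow> x \<in> Obj A \<Longrightarrow>
      Assoc A (r \<odot>\<^bsub>A\<^esub> x) (s \<odot>\<^bsub>A\<^esub> x) (t \<odot>\<^bsub>A\<^esub> x)
        \<cdot>\<^bsub>A\<^esub> (AddAct A r s x \<boxplus>\<^bsub>A\<^esub> \<iota>\<^bsub>A\<^esub> (t \<odot>\<^bsub>A\<^esub> x)) \<cdot>\<^bsub>A\<^esub> AddAct A (r \<oplus>\<^bsub>R\<^esub> s) t x
      = (\<iota>\<^bsub>A\<^esub> (r \<odot>\<^bsub>A\<^esub> x) \<boxplus>\<^bsub>A\<^esub> AddAct A s t x)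
        \<cdot>\<^bsub>A\<^esub> AddAct A r (s \<oplus>\<^bsub>R\<^esub> t) x \<cdot>\<^bsub>A\<^esub> (Assoc R r s t \<boxdot>\<^bsub>A\<^esub> \<iota>\<^bsub>A\<^esub> x)"
    and AddAct_Symm: "r \<in> Obj R \<Longrightarrow> s \<in> Obj R \<Longrightarrow> x \<in> Obj A \<Longrightarrow>
      Symm A (r \<odot>\<^bsub>A\<^esub> x) (s \<odot>\<^bsub>A\<^esub> x) \<cdot>\<^bsub>A\<^esub> AddAct A r s x
      = AddAct A s r x \<cdot>\<^bsub>A\<^esub> (Symm R r s \<boxdot>\<^bsub>A\<^esub> \<iota>\<^bsub>A\<^esub> x)"
    and ActAdd_AddAct: "r \<in> Obj R \<Longrightarrow> s \<in> Obj R \<Longrightarrow> x \<in> Obj A \<Longrightarrow> y \<in> Obj A \<Longrightarrow>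
      (ActAdd A r x y \<boxplus>\<^bsub>A\<^esub> ActAdd A s x y) \<cdot>\<^bsub>A\<^esub> AddAct A r s (x \<oplus>\<^bsub>A\<^esub> y)
      = Interchange A (r \<odot>\<^bsub>A\<^esub> x) (s \<odot>\<^bsub>A\<^esub> x) (r \<odot>\<^bsub>A\<^esub> y) (s \<odot>\<^bsub>A\<^esub> y)
        \<cdot>\<^bsub>A\<^esub> (AddAct A r s x \<boxplus>\<^bsub>A\<^esub> AddAct A r s y) \<cdot>\<^bsub>A\<^esub> ActAdd A (r \<oplus>\<^bsub>R\<^esub> s) x y"
    and AddAct_ActZero: "r \<in> Obj R \<Longrightarrow> s \<in> Obj R \<Longrightarrow>
      LUnit A \<zero>\<^bsub>A\<^esub> \<cdot>\<^bsub>A\<^esub> (ActZero A r \<boxplus>\<^bsub>A\<^esub> ActZero A s) \<cdot>\<^bsub>A\<^esub> AddAct A r s \<zero>\<^bsub>A\<^esub>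
      = ActZero A (r \<oplus>\<^bsub>R\<^esub> s)"
    and MulAct_ActAdd: "r \<in> Obj R \<Longrightarrow> s \<in> Obj R \<Longrightarrow> x \<in> Obj A \<Longrightarrow> y \<in> Obj A \<Longrightarrow>
      (MulAct A r s x \<boxplus>\<^bsub>A\<^esub> MulAct A r s y) \<cdot>\<^bsub>A\<^esub> ActAdd A (r \<otimes>\<^bsub>R\<^esub> s) x y
      = ActAdd A r (s \<odot>\<^bsub>A\<^esub> x) (s \<odot>\<^bsub>A\<^esub> y)
        \<cdot>\<^bsub>A\<^esub> (\<iota>\<^bsub>R\<^esub> r \<boxdot>\<^bsub>A\<^esub> ActAdd A s x y) \<cdot>\<^bsub>A\<^esub> MulAct A r s (x \<oplus>\<^bsub>A\<^esub> y)"
    and MulAct_ActZero: "r \<in> Obj R \<Longrightarrow> s \<in> Obj R \<Longrightarrow>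
      ActZero A r \<cdot>\<^bsub>A\<^esub> (\<iota>\<^bsub>R\<^esub> r \<boxdot>\<^bsub>A\<^esub> ActZero A s) \<cdot>\<^bsub>A\<^esub> MulAct A r s \<zero>\<^bsub>A\<^esub>
      = ActZero A (r \<otimes>\<^bsub>R\<^esub> s)"
    and MulAct_LDist: "r \<in> Obj R \<Longrightarrow> s \<in> Obj R \<Longrightarrow> t \<in> Obj R \<Longrightarrow> x \<in> Obj A \<Longrightarrow>
      (MulAct A r s x \<boxplus>\<^bsub>A\<^esub> MulAct A r t x)
        \<cdot>\<^bsub>A\<^esub> AddAct A (r \<otimes>\<^bsub>R\<^esub> s) (r \<otimes>\<^bsub>R\<^esub> t) x \<cdot>\<^bsub>A\<^esub> (LDist R r s t \<boxdot>\<^bsub>A\<^esub> \<iota>\<^bsub>A\<^esub> x)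
      = ActAdd A r (s \<odot>\<^bsub>A\<^esub> x) (t \<odot>\<^bsub>A\<^esub> x)
        \<cdot>\<^bsub>A\<^esub> (\<iota>\<^bsub>R\<^esub> r \<boxdot>\<^bsub>A\<^esub> AddAct A s t x) \<cdot>\<^bsub>A\<^esub> MulAct A r (s \<oplus>\<^bsub>R\<^esub> t) x"
    and MulAct_RDist: "r \<in> Obj R \<Longrightarrow> s \<in> Obj R \<Longrightarrow> t \<in> Obj R \<Longrightarrow> x \<in> Obj A \<Longrightarrow>
      (MulAct A r t x \<boxplus>\<^bsub>A\<^esub> MulAct A s t x)
        \<cdot>\<^bsub>A\<^esub> AddAct A (r \<otimes>\<^bsub>R\<^esub> t) (s \<otimes>\<^bsub>R\<^esub> t) x \<cdot>\<^bsub>A\<^esub> (RDist R r s t \<boxdot>\<^bsub>A\<^esub> \<iota>\<^bsub>A\<^esub> x)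
      = AddAct A r s (t \<odot>\<^bsub>A\<^esub> x) \<cdot>\<^bsub>A\<^esub> MulAct A (r \<oplus>\<^bsub>R\<^esub> s) t x"
    and MulAct_MAssoc: "r \<in> Obj R \<Longrightarrow> s \<in> Obj R \<Longrightarrow> t \<in> Obj R \<Longrightarrow> x \<in> Obj A \<Longrightarrow>
      MulAct A r s (t \<odot>\<^bsub>A\<^esub> x) \<cdot>\<^bsub>A\<^esub> MulAct A (r \<otimes>\<^bsub>R\<^esub> s) t x
      = (\<iota>\<^bsub>R\<^esub> r \<boxdot>\<^bsub>A\<^esub> MulAct A s t x)
        \<cdot>\<^bsub>A\<^esub> MulAct A r (s \<otimes>\<^bsub>R\<^esub> t) x \<cdot>\<^bsub>A\<^esub> (MAssoc R r s t \<boxdot>\<^bsub>A\<^esub> \<iota>\<^bsub>A\<^esub> x)"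
    and MulAct_MLUnit: "r \<in> Obj R \<Longrightarrow> x \<in> Obj A \<Longrightarrow>
      OneAct A (r \<odot>\<^bsub>A\<^esub> x) \<cdot>\<^bsub>A\<^esub> MulAct A \<one>\<^bsub>R\<^esub> r x = MLUnit R r \<boxdot>\<^bsub>A\<^esub> \<iota>\<^bsub>A\<^esub> x"
    and MulAct_MRUnit: "r \<in> Obj R \<Longrightarrow> x \<in> Obj A \<Longrightarrow>
      (\<iota>\<^bsub>R\<^esub> r \<boxdot>\<^bsub>A\<^esub> OneAct A x) \<cdot>\<^bsub>A\<^esub> MulAct A r \<one>\<^bsub>R\<^esub> x = MRUnit R r \<boxdot>\<^bsub>A\<^esub> \<iota>\<^bsub>A\<^esub> x"
    and OneAct_ActAdd: "x \<in> Obj A \<Longrightarrow> y \<in> Obj A \<Longrightarrow>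
      (OneAct A x \<boxplus>\<^bsub>A\<^esub> OneAct A y) \<cdot>\<^bsub>A\<^esub> ActAdd A \<one>\<^bsub>R\<^esub> x y = OneAct A (x \<oplus>\<^bsub>A\<^esub> y)"
    and OneAct_ActZero: "OneAct A \<zero>\<^bsub>A\<^esub> = ActZero A \<one>\<^bsub>R\<^esub>"


section \<open>Homomorphisms and 2-morphisms\<close>

text \<open>
  Besides its action on objects and arrows, a 1-morphism carries constraints with components
  \<open>AddIso F x y : F (x \<oplus> y) \<rightarrow> F x \<oplus> F y\<close>, \<open>ZeroIso F : F \<zero> \<rightarrow> \<zero>\<close> and
  \<open>ActIso F r x : F (r \<odot> x) \<rightarrow> r \<odot> F x\<close>.
\<close>

record ('r, 'o, 'm, 'p, 'q) hom_data =
  OMap    :: "'o \<Rightarrow> 'p"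
  AMap    :: "'m \<Rightarrow> 'q"
  AddIso  :: "'o \<Rightarrow> 'o \<Rightarrow> 'q"
  ZeroIso :: "'q"
  ActIso  :: "'r \<Rightarrow> 'o \<Rightarrow> 'q"

locale two_module_hom = A: two_module R A + B: two_module R B
  for R :: "('r, 's) ring_data"
    and A :: "('r, 's, 'o, 'm) mod_data" and B :: "('r, 's, 'p, 'q) mod_data" +
  fixes F :: "('r, 'o, 'm, 'p, 'q) hom_data"
  assumes OMap_Obj: "x \<in> Obj A \<Longrightarrow> OMap F x \<in> Obj B"
    and AMap_in_hom: "\<guillemotleft>f : x \<rightarrow>\<^bsub>A\<^esub> y\<guillemotright> \<Longrightarrow> \<guillemotleft>AMap F f : OMap F x \<rightarrow>\<^bsub>B\<^esub> OMap F y\<guillemotright>"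
    and AMap_Ide: "x \<in> Obj A \<Longrightarrow> AMap F (\<iota>\<^bsub>A\<^esub> x) = \<iota>\<^bsub>B\<^esub> (OMap F x)"
    and AMap_Comp: "\<guillemotleft>f : x \<rightarrow>\<^bsub>A\<^esub> y\<guillemotright> \<Longrightarrow> \<guillemotleft>g : y \<rightarrow>\<^bsub>A\<^esub> z\<guillemotright> \<Longrightarrow>
      AMap F (g \<cdot>\<^bsub>A\<^esub> f) = AMap F g \<cdot>\<^bsub>B\<^esub> AMap F f"
    and AddIso_in_hom: "x \<in> Obj A \<Longrightarrow> y \<in> Obj A \<Longrightarrow>
      \<guillemotleft>AddIso F x y : OMap F (x \<oplus>\<^bsub>A\<^esub> y) \<rightarrow>\<^bsub>B\<^esub> OMap F x \<oplus>\<^bsub>B\<^esub> OMap F y\<guillemotright>"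
    and ZeroIso_in_hom: "\<guillemotleft>ZeroIso F : OMap F \<zero>\<^bsub>A\<^esub> \<rightarrow>\<^bsub>B\<^esub> \<zero>\<^bsub>B\<^esub>\<guillemotright>"
    and ActIso_in_hom: "r \<in> Obj R \<Longrightarrow> x \<in> Obj A \<Longrightarrow>
      \<guillemotleft>ActIso F r x : OMap F (r \<odot>\<^bsub>A\<^esub> x) \<rightarrow>\<^bsub>B\<^esub> r \<odot>\<^bsub>B\<^esub> OMap F x\<guillemotright>"
    and AddIso_natural: "\<guillemotleft>f : x \<rightarrow>\<^bsub>A\<^esub> x'\<guillemotright> \<Longrightarrow> \<guillemotleft>g : y \<rightarrow>\<^bsub>A\<^esub> y'\<guillemotright> \<Longrightarrow>
      AddIso F x' y' \<cdot>\<^bsub>B\<^esub> AMap F (f \<boxplus>\<^bsub>A\<^esub> g) = (AMap F f \<boxplus>\<^bsub>B\<^esub> AMap F g) \<cdot>\<^bsub>B\<^esub> AddIso F x y"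
    and ActIso_natural: "\<guillemotleft>a : r \<rightarrow>\<^bsub>R\<^esub> r'\<guillemotright> \<Longrightarrow> \<guillemotleft>f : x \<rightarrow>\<^bsub>A\<^esub> x'\<guillemotright> \<Longrightarrow>
      ActIso F r' x' \<cdot>\<^bsub>B\<^esub> AMap F (a \<boxdot>\<^bsub>A\<^esub> f) = (a \<boxdot>\<^bsub>B\<^esub> AMap F f) \<cdot>\<^bsub>B\<^esub> ActIso F r x"
    and AddIso_Assoc: "x \<in> Obj A \<Longrightarrow> y \<in> Obj A \<Longrightarrow> z \<in> Obj A \<Longrightarrow>
      Assoc B (OMap F x) (OMap F y) (OMap F z)
        \<cdot>\<^bsub>B\<^esub> (AddIso F x y \<boxplus>\<^bsub>B\<^esub> \<iota>\<^bsub>B\<^esub> (OMap F z)) \<cdot>\<^bsub>B\<^esub> AddIso F (x \<oplus>\<^bsub>A\<^esub> y) z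
      = (\<iota>\<^bsub>B\<^esub> (OMap F x) \<boxplus>\<^bsub>B\<^esub> AddIso F y z)
        \<cdot>\<^bsub>B\<^esub> AddIso F x (y \<oplus>\<^bsub>A\<^esub> z) \<cdot>\<^bsub>B\<^esub> AMap F (Assoc A x y z)"
    and AddIso_Symm: "x \<in> Obj A \<Longrightarrow> y \<in> Obj A \<Longrightarrow>
      Symm B (OMap F x) (OMap F y) \<cdot>\<^bsub>B\<^esub> AddIso F x y = AddIso F y x \<cdot>\<^bsub>B\<^esub> AMap F (Symm A x y)"
    and AddIso_ZeroIso: "x \<in> Obj A \<Longrightarrow>
      LUnit B (OMap F x) \<cdot>\<^bsub>B\<^esub> (ZeroIso F \<boxplus>\<^bsub>B\<^esub> \<iota>\<^bsub>B\<^esub> (OMap F x)) \<cdot>\<^bsub>B\<^esub> AddIso F \<zero>\<^bsub>A\<^esub> x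
      = AMap F (LUnit A x)"
    and ActIso_ActAdd: "r \<in> Obj R \<Longrightarrow> x \<in> Obj A \<Longrightarrow> y \<in> Obj A \<Longrightarrow>
      (ActIso F r x \<boxplus>\<^bsub>B\<^esub> ActIso F r y)
        \<cdot>\<^bsub>B\<^esub> AddIso F (r \<odot>\<^bsub>A\<^esub> x) (r \<odot>\<^bsub>A\<^esub> y) \<cdot>\<^bsub>B\<^esub> AMap F (ActAdd A r x y)
      = ActAdd B r (OMap F x) (OMap F y)
        \<cdot>\<^bsub>B\<^esub> (\<iota>\<^bsub>R\<^esub> r \<boxdot>\<^bsub>B\<^esub> AddIso F x y) \<cdot>\<^bsub>B\<^esub> ActIso F r (x \<oplus>\<^bsub>A\<^esub> y)"
    and ActIso_AddAct: "r \<in> Obj R \<Longrightarrow> s \<in> Obj R \<Longrightarrow> x \<in> Obj A \<Longrightarrow>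
      (ActIso F r x \<boxplus>\<^bsub>B\<^esub> ActIso F s x)
        \<cdot>\<^bsub>B\<^esub> AddIso F (r \<odot>\<^bsub>A\<^esub> x) (s \<odot>\<^bsub>A\<^esub> x) \<cdot>\<^bsub>B\<^esub> AMap F (AddAct A r s x)
      = AddAct B r s (OMap F x) \<cdot>\<^bsub>B\<^esub> ActIso F (r \<oplus>\<^bsub>R\<^esub> s) x"
    and ActIso_MulAct: "r \<in> Obj R \<Longrightarrow> s \<in> Obj R \<Longrightarrow> x \<in> Obj A \<Longrightarrow>
      (\<iota>\<^bsub>R\<^esub> r \<boxdot>\<^bsub>B\<^esub> ActIso F s x)
        \<cdot>\<^bsub>B\<^esub> ActIso F r (s \<odot>\<^bsub>A\<^esub> x) \<cdot>\<^bsub>B\<^esub> AMap F (MulAct A r s x)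
      = MulAct B r s (OMap F x) \<cdot>\<^bsub>B\<^esub> ActIso F (r \<otimes>\<^bsub>R\<^esub> s) x"
    and ActIso_OneAct: "x \<in> Obj A \<Longrightarrow>
      AMap F (OneAct A x) = OneAct B (OMap F x) \<cdot>\<^bsub>B\<^esub> ActIso F \<one>\<^bsub>R\<^esub> x"
    and ActIso_ActZero: "r \<in> Obj R \<Longrightarrow>
      ZeroIso F \<cdot>\<^bsub>B\<^esub> AMap F (ActZero A r)
      = ActZero B r \<cdot>\<^bsub>B\<^esub> (\<iota>\<^bsub>R\<^esub> r \<boxdot>\<^bsub>B\<^esub> ZeroIso F) \<cdot>\<^bsub>B\<^esub> ActIso F r \<zero>\<^bsub>A\<^esub>"

text \<open>
  A 2-morphism is a monoidal natural transformation compatible with the action; its source and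
  target are meant to be 1-morphisms in the sense of \<open>two_module_hom\<close>.
\<close>

definition two_morphism ::
  "('r, 's) ring_data \<Rightarrow> ('r, 's, 'o, 'm) mod_data \<Rightarrow> ('r, 's, 'p, 'q) mod_data \<Rightarrow>
   ('r, 'o, 'm, 'p, 'q) hom_data \<Rightarrow> ('r, 'o, 'm, 'p, 'q) hom_data \<Rightarrow> ('o \<Rightarrow> 'q) \<Rightarrow> bool"
  where "two_morphism R A B F G \<rho> \<longleftrightarrow>
    (\<forall>x\<in>Obj A. \<guillemotleft>\<rho> x : OMap F x \<rightarrow>\<^bsub>B\<^esub> OMap G x\<guillemotright>) \<and>
    (\<forall>f\<in>Arr A. \<rho> (Tgt A f) \<cdot>\<^bsub>B\<^esub> AMap F f = AMap G f \<cdot>\<^bsub>B\<^esub> \<rho> (Src A f)) \<and>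
    (\<forall>x\<in>Obj A. \<forall>y\<in>Obj A.
      AddIso G x y \<cdot>\<^bsub>B\<^esub> \<rho> (x \<oplus>\<^bsub>A\<^esub> y) = (\<rho> x \<boxplus>\<^bsub>B\<^esub> \<rho> y) \<cdot>\<^bsub>B\<^esub> AddIso F x y) \<and>
    ZeroIso G \<cdot>\<^bsub>B\<^esub> \<rho> \<zero>\<^bsub>A\<^esub> = ZeroIso F \<and>
    (\<forall>r\<in>Obj R. \<forall>x\<in>Obj A.
      ActIso G r x \<cdot>\<^bsub>B\<^esub> \<rho> (r \<odot>\<^bsub>A\<^esub> x) = (\<iota>\<^bsub>R\<^esub> r \<boxdot>\<^bsub>B\<^esub> \<rho> x) \<cdot>\<^bsub>B\<^esub> ActIso F r x)"

definition equivalent_homs ::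
  "('r, 's) ring_data \<Rightarrow> ('r, 's, 'o, 'm) mod_data \<Rightarrow> ('r, 's, 'p, 'q) mod_data \<Rightarrow>
   ('r, 'o, 'm, 'p, 'q) hom_data \<Rightarrow> ('r, 'o, 'm, 'p, 'q) hom_data \<Rightarrow> bool"
  where "equivalent_homs R A B F G \<longleftrightarrow>
    (\<exists>\<rho>. two_morphism R A B F G \<rho> \<and> (\<forall>x\<in>Obj A. \<exists>g. inverse_arrows B (\<rho> x) g))"

definition comp_hom ::
  "('r, 's, 'v, 'w) mod_data \<Rightarrow>
   ('r, 'p, 'q, 'v, 'w) hom_data \<Rightarrow> ('r, 'o, 'm, 'p, 'q) hom_data \<Rightarrow>
   ('r, 'o, 'm, 'v, 'w) hom_data"
  where "comp_hom C G F =
    \<lparr> OMap = (\<lambda>x. OMap G (OMap F x)),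
      AMap = (\<lambda>f. AMap G (AMap F f)),
      AddIso = (\<lambda>x y. AddIso G (OMap F x) (OMap F y) \<cdot>\<^bsub>C\<^esub> AMap G (AddIso F x y)),
      ZeroIso = ZeroIso G \<cdot>\<^bsub>C\<^esub> AMap G (ZeroIso F),
      ActIso = (\<lambda>r x. ActIso G r (OMap F x) \<cdot>\<^bsub>C\<^esub> AMap G (ActIso F r x)) \<rparr>"

definition zero_hom :: "('r, 's, 'p, 'q) mod_data \<Rightarrow> ('r, 'o, 'm, 'p, 'q) hom_data"
  where "zero_hom B =
    \<lparr> OMap = (\<lambda>x. \<zero>\<^bsub>B\<^esub>),
      AMap = (\<lambda>f. \<iota>\<^bsub>B\<^esub> \<zero>\<^bsub>B\<^esub>),
      AddIso = (\<lambda>x y. Inv B (LUnit B \<zero>\<^bsub>B\<^esub>)),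
      ZeroIso = \<iota>\<^bsub>B\<^esub> \<zero>\<^bsub>B\<^esub>,
      ActIso = (\<lambda>r x. Inv B (ActZero B r)) \<rparr>"

definition sum_hom ::
  "('r, 's, 'p, 'q) mod_data \<Rightarrow> ('r, 'o, 'm, 'p, 'q) hom_data \<Rightarrow> ('r, 'o, 'm, 'p, 'q) hom_data \<Rightarrow>
   ('r, 'o, 'm, 'p, 'q) hom_data"
  where "sum_hom B F G =
    \<lparr> OMap = (\<lambda>x. OMap F x \<oplus>\<^bsub>B\<^esub> OMap G x),
      AMap = (\<lambda>f. AMap F f \<boxplus>\<^bsub>B\<^esub> AMap G f),
      AddIso = (\<lambda>x y. Interchange B (OMap F x) (OMap F y) (OMap G x) (OMap G y)
        \<cdot>\<^bsub>B\<^esub> (AddIso F x y \<boxplus>\<^bsub>B\<^esub> AddIso G x y)),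
      ZeroIso = LUnit B \<zero>\<^bsub>B\<^esub> \<cdot>\<^bsub>B\<^esub> (ZeroIso F \<boxplus>\<^bsub>B\<^esub> ZeroIso G),
      ActIso = (\<lambda>r x. Inv B (ActAdd B r (OMap F x) (OMap G x))
        \<cdot>\<^bsub>B\<^esub> (ActIso F r x \<boxplus>\<^bsub>B\<^esub> ActIso G r x)) \<rparr>"


section \<open>2-cochain complexes, their morphisms and homotopies\<close>

text \<open>
  Complexes are indexed by the integers, the part in negative degrees being the completion by
  zero: one-object-one-morphism modules, zero 1-morphisms and canonical 2-morphisms. The canonical
  2-morphism in degree \<open>n < 0\<close> is the constraint \<open>L (n + 1) \<zero> \<rightarrow> \<zero>\<close>. In negative degrees all other
  requirements hold automatically, and a morphism or homotopy has no freedom there.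
\<close>

record ('r, 's, 'o, 'm) complex_data =
  Mod :: "int \<Rightarrow> ('r, 's, 'o, 'm) mod_data"
  Dif :: "int \<Rightarrow> ('r, 'o, 'm, 'o, 'm) hom_data"
  Nul :: "int \<Rightarrow> 'o \<Rightarrow> 'm"

locale cochain_complex = two_ring R
  for R :: "('r, 's) ring_data" +
  fixes C :: "('r, 's, 'o, 'm) complex_data"
  assumes Mod_two_module: "two_module R (Mod C n)"
    and Dif_hom: "two_module_hom R (Mod C n) (Mod C (n + 1)) (Dif C n)"
    and Nul_two_morphism: "two_morphism R (Mod C n) (Mod C (n + 2))
      (comp_hom (Mod C (n + 2)) (Dif C (n + 1)) (Dif C n))
      (zero_hom (Mod C (n + 2))) (Nul C n)"
    and Nul_Dif: "x \<in> Obj (Mod C n) \<Longrightarrow>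
      ZeroIso (Dif C (n + 2)) \<cdot>\<^bsub>Mod C (n + 3)\<^esub> AMap (Dif C (n + 2)) (Nul C n x)
      = Nul C (n + 1) (OMap (Dif C n) x)"
    and negative_Obj: "n < 0 \<Longrightarrow> Obj (Mod C n) = {\<zero>\<^bsub>Mod C n\<^esub>}"
    and negative_Arr: "n < 0 \<Longrightarrow> Arr (Mod C n) = {\<iota>\<^bsub>Mod C n\<^esub> \<zero>\<^bsub>Mod C n\<^esub>}"
    and negative_Dif: "n < 0 \<Longrightarrow> Dif C n = zero_hom (Mod C (n + 1))"
    and negative_Nul: "n < 0 \<Longrightarrow> Nul C n \<zero>\<^bsub>Mod C n\<^esub> = ZeroIso (Dif C (n + 1))"

record ('r, 'o, 'm, 'p, 'q) complex_mor_data =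
  Map :: "int \<Rightarrow> ('r, 'o, 'm, 'p, 'q) hom_data"
  Sqr :: "int \<Rightarrow> 'o \<Rightarrow> 'q"

locale complex_morphism = A: cochain_complex R A + B: cochain_complex R B
  for R :: "('r, 's) ring_data"
    and A :: "('r, 's, 'o, 'm) complex_data" and B :: "('r, 's, 'p, 'q) complex_data" +
  fixes F :: "('r, 'o, 'm, 'p, 'q) complex_mor_data"
  assumes Map_hom: "two_module_hom R (Mod A n) (Mod B n) (Map F n)"
    and Sqr_two_morphism: "two_morphism R (Mod A n) (Mod B (n + 1))
      (comp_hom (Mod B (n + 1)) (Map F (n + 1)) (Dif A n))
      (comp_hom (Mod B (n + 1)) (Dif B n) (Map F n)) (Sqr F n)"
    and Map_Nul: "x \<in> Obj (Mod A n) \<Longrightarrow>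
      ZeroIso (Map F (n + 2)) \<cdot>\<^bsub>Mod B (n + 2)\<^esub> AMap (Map F (n + 2)) (Nul A n x)
      = Nul B n (OMap (Map F n) x)
        \<cdot>\<^bsub>Mod B (n + 2)\<^esub> AMap (Dif B (n + 1)) (Sqr F n x)
        \<cdot>\<^bsub>Mod B (n + 2)\<^esub> Sqr F (n + 1) (OMap (Dif A n) x)"

text \<open>
  The last condition compares two arrows in \<open>Mod B (n + 1)\<close> from \<open>F (L x)\<close> to
  \<open>M (H (L x)) \<oplus> M (G x)\<close>.
\<close>

definition cochain_homotopy ::
  "('r, 's) ring_data \<Rightarrow> ('r, 's, 'o, 'm) complex_data \<Rightarrow> ('r, 's, 'p, 'q) complex_data \<Rightarrow>
   ('r, 'o, 'm, 'p, 'q) complex_mor_data \<Rightarrow> ('r, 'o, 'm, 'p, 'q) complex_mor_data \<Rightarrow>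
   (int \<Rightarrow> ('r, 'o, 'm, 'p, 'q) hom_data) \<Rightarrow> (int \<Rightarrow> 'o \<Rightarrow> 'q) \<Rightarrow> bool"
  where "cochain_homotopy R A B F G H \<tau> \<longleftrightarrow>
    (\<forall>n. two_module_hom R (Mod A n) (Mod B (n - 1)) (H (n - 1))) \<and>
    (\<forall>n. two_morphism R (Mod A n) (Mod B n) (Map F n)
      (sum_hom (Mod B n)
        (sum_hom (Mod B n)
          (comp_hom (Mod B n) (Dif B (n - 1)) (H (n - 1)))
          (comp_hom (Mod B n) (H n) (Dif A n)))
        (Map G n))
      (\<tau> n)) \<and>
    (\<forall>n. \<forall>x\<in>Obj (Mod A n).
      (let B' = Mod B (n + 1);
           lx = OMap (Dif A n) x;
           hlx = OMap (H n) lx;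
           mhlx = OMap (Dif B n) hlx;
           hx = OMap (H (n - 1)) x;
           mhx = OMap (Dif B (n - 1)) hx;
           gx = OMap (Map G n) x;
           mgx = OMap (Dif B n) gx
       in (RUnit B' mhlx \<boxplus>\<^bsub>B'\<^esub> \<iota>\<^bsub>B'\<^esub> mgx)
          \<cdot>\<^bsub>B'\<^esub> ((\<iota>\<^bsub>B'\<^esub> mhlx \<boxplus>\<^bsub>B'\<^esub> (ZeroIso (H (n + 1)) \<cdot>\<^bsub>B'\<^esub> AMap (H (n + 1)) (Nul A n x)))
                \<boxplus>\<^bsub>B'\<^esub> Sqr G n x)
          \<cdot>\<^bsub>B'\<^esub> \<tau> (n + 1) lx
        = (LUnit B' mhlx \<boxplus>\<^bsub>B'\<^esub> \<iota>\<^bsub>B'\<^esub> mgx)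
          \<cdot>\<^bsub>B'\<^esub> ((Nul B (n - 1) hx \<boxplus>\<^bsub>B'\<^esub> \<iota>\<^bsub>B'\<^esub> mhlx) \<boxplus>\<^bsub>B'\<^esub> \<iota>\<^bsub>B'\<^esub> mgx)
          \<cdot>\<^bsub>B'\<^esub> (AddIso (Dif B n) mhx hlx \<boxplus>\<^bsub>B'\<^esub> \<iota>\<^bsub>B'\<^esub> mgx)
          \<cdot>\<^bsub>B'\<^esub> AddIso (Dif B n) (mhx \<oplus>\<^bsub>Mod B n\<^esub> hlx) gx
          \<cdot>\<^bsub>B'\<^esub> AMap (Dif B n) (\<tau> n x)
          \<cdot>\<^bsub>B'\<^esub> Sqr F n x))"

definition cochain_homotopic ::
  "('r, 's) ring_data \<Rightarrow> ('r, 's, 'o, 'm) complex_data \<Rightarrow> ('r, 's, 'p, 'q) complex_data \<Rightarrow>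
   ('r, 'o, 'm, 'p, 'q) complex_mor_data \<Rightarrow> ('r, 'o, 'm, 'p, 'q) complex_mor_data \<Rightarrow> bool"
  where "cochain_homotopic R A B F G \<longleftrightarrow> (\<exists>H \<tau>. cochain_homotopy R A B F G H \<tau>)"


section \<open>Cohomology\<close>

text \<open>
  An object of the \<open>n\<close>-th cohomology is a pair \<open>P\<close> with \<open>fst P\<close> an object of \<open>Mod C n\<close> and \<open>snd P\<close> an
  arrow from its image under the differential to zero.
\<close>

definition coh_Obj :: "('r, 's, 'o, 'm) complex_data \<Rightarrow> int \<Rightarrow> ('o \<times> 'm) set"
  where "coh_Obj C n = {P. fst P \<in> Obj (Mod C n) \<and>
    \<guillemotleft>snd P : OMap (Dif C n) (fst P) \<rightarrow>\<^bsub>Mod C (n + 1)\<^esub> \<zero>\<^bsub>Mod C (n + 1)\<^esub>\<guillemotright> \<and>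
    ZeroIso (Dif C (n + 1)) \<cdot>\<^bsub>Mod C (n + 2)\<^esub> AMap (Dif C (n + 1)) (snd P) = Nul C n (fst P)}"

definition coh_pairs ::
  "('r, 's, 'o, 'm) complex_data \<Rightarrow> int \<Rightarrow> 'o \<times> 'm \<Rightarrow> 'o \<times> 'm \<Rightarrow> ('o \<times> 'm) set"
  where "coh_pairs C n P Q = {(X, x). X \<in> Obj (Mod C (n - 1)) \<and>
    \<guillemotleft>x : fst P \<rightarrow>\<^bsub>Mod C n\<^esub> OMap (Dif C (n - 1)) X \<oplus>\<^bsub>Mod C n\<^esub> fst Q\<guillemotright> \<and>
    LUnit (Mod C (n + 1)) \<zero>\<^bsub>Mod C (n + 1)\<^esub>
      \<cdot>\<^bsub>Mod C (n + 1)\<^esub> (Nul C (n - 1) X \<boxplus>\<^bsub>Mod C (n + 1)\<^esub> snd Q)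
      \<cdot>\<^bsub>Mod C (n + 1)\<^esub> AddIso (Dif C n) (OMap (Dif C (n - 1)) X) (fst Q)
      \<cdot>\<^bsub>Mod C (n + 1)\<^esub> AMap (Dif C n) x
    = snd P}"

definition coh_equiv ::
  "('r, 's, 'o, 'm) complex_data \<Rightarrow> int \<Rightarrow> 'o \<times> 'm \<Rightarrow> 'o \<times> 'm \<Rightarrow> 'o \<times> 'm \<Rightarrow> bool"
  where "coh_equiv C n Q p p' \<longleftrightarrow>
    (\<exists>Y\<in>Obj (Mod C (n - 2)). \<exists>y.
      \<guillemotleft>y : fst p \<rightarrow>\<^bsub>Mod C (n - 1)\<^esub> OMap (Dif C (n - 2)) Y \<oplus>\<^bsub>Mod C (n - 1)\<^esub> fst p'\<guillemotright> \<and>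
      (let M = Mod C n;
           q = fst Q;
           lx' = OMap (Dif C (n - 1)) (fst p')
       in snd p' = (LUnit M lx' \<boxplus>\<^bsub>M\<^esub> \<iota>\<^bsub>M\<^esub> q)
          \<cdot>\<^bsub>M\<^esub> ((Nul C (n - 2) Y \<boxplus>\<^bsub>M\<^esub> \<iota>\<^bsub>M\<^esub> lx') \<boxplus>\<^bsub>M\<^esub> \<iota>\<^bsub>M\<^esub> q)
          \<cdot>\<^bsub>M\<^esub> (AddIso (Dif C (n - 1)) (OMap (Dif C (n - 2)) Y) (fst p') \<boxplus>\<^bsub>M\<^esub> \<iota>\<^bsub>M\<^esub> q)
          \<cdot>\<^bsub>M\<^esub> (AMap (Dif C (n - 1)) y \<boxplus>\<^bsub>M\<^esub> \<iota>\<^bsub>M\<^esub> q)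
          \<cdot>\<^bsub>M\<^esub> snd p))"

definition coh_class ::
  "('r, 's, 'o, 'm) complex_data \<Rightarrow> int \<Rightarrow> 'o \<times> 'm \<Rightarrow> 'o \<times> 'm \<Rightarrow> 'o \<times> 'm \<Rightarrow> ('o \<times> 'm) set"
  where "coh_class C n P Q p = {p' \<in> coh_pairs C n P Q. coh_equiv C n Q p p'}"

text \<open>
  An arrow of the cohomology is a triple consisting of its source, an equivalence class of pairs,
  and its target. Operations on classes are defined as unions over all representatives.
\<close>

type_synonym ('o, 'm) coh_arr = "('o \<times> 'm) \<times> ('o \<times> 'm) set \<times> ('o \<times> 'm)"

definition coh_Arr :: "('r, 's, 'o, 'm) complex_data \<Rightarrow> int \<Rightarrow> ('o, 'm) coh_arr set"
  where "coh_Arr C n =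
    {(P, coh_class C n P Q p, Q) | P p Q.
      P \<in> coh_Obj C n \<and> Q \<in> coh_Obj C n \<and> p \<in> coh_pairs C n P Q}"

text \<open>
  An arrow \<open>f\<close> of \<open>Mod C n\<close> compatible with the second components of \<open>P\<close> and \<open>Q\<close> induces an arrow in
  cohomology, with representative \<open>fst P \<rightarrow> fst Q \<rightarrow> \<zero> \<oplus> fst Q \<rightarrow> L \<zero> \<oplus> fst Q\<close>. All structural
  isomorphisms of the cohomology are obtained in this way from those of \<open>Mod C n\<close>.
\<close>

definition coh_ind ::
  "('r, 's, 'o, 'm) complex_data \<Rightarrow> int \<Rightarrow> 'o \<times> 'm \<Rightarrow> 'o \<times> 'm \<Rightarrow> 'm \<Rightarrow> ('o, 'm) coh_arr"
  where "coh_ind C n P Q f =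
    (P,
     coh_class C n P Q
       (\<zero>\<^bsub>Mod C (n - 1)\<^esub>,
        (Inv (Mod C n) (ZeroIso (Dif C (n - 1))) \<boxplus>\<^bsub>Mod C n\<^esub> \<iota>\<^bsub>Mod C n\<^esub> (fst Q))
          \<cdot>\<^bsub>Mod C n\<^esub> Inv (Mod C n) (LUnit (Mod C n) (fst Q)) \<cdot>\<^bsub>Mod C n\<^esub> f),
     Q)"

fun coh_comp ::
  "('r, 's, 'o, 'm) complex_data \<Rightarrow> int \<Rightarrow> ('o, 'm) coh_arr \<Rightarrow> ('o, 'm) coh_arr \<Rightarrow> ('o, 'm) coh_arr"
  where "coh_comp C n (P', c', Q') (P, c, Q) =
    (P,
     (\<Union>(X', x')\<in>c'. \<Union>(X, x)\<in>c.
       let M = Mod C n; L = Dif C (n - 1)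
       in coh_class C n P Q'
         (X \<oplus>\<^bsub>Mod C (n - 1)\<^esub> X',
          (Inv M (AddIso L X X') \<boxplus>\<^bsub>M\<^esub> \<iota>\<^bsub>M\<^esub> (fst Q'))
            \<cdot>\<^bsub>M\<^esub> Inv M (Assoc M (OMap L X) (OMap L X') (fst Q'))
            \<cdot>\<^bsub>M\<^esub> (\<iota>\<^bsub>M\<^esub> (OMap L X) \<boxplus>\<^bsub>M\<^esub> x') \<cdot>\<^bsub>M\<^esub> x)),
     Q')"

definition coh_addO ::
  "('r, 's, 'o, 'm) complex_data \<Rightarrow> int \<Rightarrow> 'o \<times> 'm \<Rightarrow> 'o \<times> 'm \<Rightarrow> 'o \<times> 'm"
  where "coh_addO C n P Q =
    (fst P \<oplus>\<^bsub>Mod C n\<^esub> fst Q,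
     LUnit (Mod C (n + 1)) \<zero>\<^bsub>Mod C (n + 1)\<^esub>
       \<cdot>\<^bsub>Mod C (n + 1)\<^esub> (snd P \<boxplus>\<^bsub>Mod C (n + 1)\<^esub> snd Q)
       \<cdot>\<^bsub>Mod C (n + 1)\<^esub> AddIso (Dif C n) (fst P) (fst Q))"

fun coh_addA ::
  "('r, 's, 'o, 'm) complex_data \<Rightarrow> int \<Rightarrow> ('o, 'm) coh_arr \<Rightarrow> ('o, 'm) coh_arr \<Rightarrow> ('o, 'm) coh_arr"
  where "coh_addA C n (P, c, Q) (P', c', Q') =
    (coh_addO C n P P',
     (\<Union>(X, x)\<in>c. \<Union>(X', x')\<in>c'.
       let M = Mod C n; L = Dif C (n - 1)
       in coh_class C n (coh_addO C n P P') (coh_addO C n Q Q')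
         (X \<oplus>\<^bsub>Mod C (n - 1)\<^esub> X',
          (Inv M (AddIso L X X') \<boxplus>\<^bsub>M\<^esub> \<iota>\<^bsub>M\<^esub> (fst Q \<oplus>\<^bsub>M\<^esub> fst Q'))
            \<cdot>\<^bsub>M\<^esub> Interchange M (OMap L X) (fst Q) (OMap L X') (fst Q')
            \<cdot>\<^bsub>M\<^esub> (x \<boxplus>\<^bsub>M\<^esub> x'))),
     coh_addO C n Q Q')"

definition coh_zero :: "('r, 's, 'o, 'm) complex_data \<Rightarrow> int \<Rightarrow> 'o \<times> 'm"
  where "coh_zero C n = (\<zero>\<^bsub>Mod C n\<^esub>, ZeroIso (Dif C n))"

definition coh_actO ::
  "('r, 's) ring_data \<Rightarrow> ('r, 's, 'o, 'm) complex_data \<Rightarrow> int \<Rightarrow> 'r \<Rightarrow> 'o \<times> 'm \<Rightarrow> 'o \<times> 'm"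
  where "coh_actO R C n r P =
    (r \<odot>\<^bsub>Mod C n\<^esub> fst P,
     ActZero (Mod C (n + 1)) r
       \<cdot>\<^bsub>Mod C (n + 1)\<^esub> (\<iota>\<^bsub>R\<^esub> r \<boxdot>\<^bsub>Mod C (n + 1)\<^esub> snd P)
       \<cdot>\<^bsub>Mod C (n + 1)\<^esub> ActIso (Dif C n) r (fst P))"

fun coh_actA ::
  "('r, 's) ring_data \<Rightarrow> ('r, 's, 'o, 'm) complex_data \<Rightarrow> int \<Rightarrow> 's \<Rightarrow> ('o, 'm) coh_arr \<Rightarrow> ('o, 'm) coh_arr"
  where "coh_actA R C n f (P, c, Q) =
    (coh_actO R C n (Src R f) P,
     (\<Union>(X, x)\<in>c.
       let M = Mod C n; L = Dif C (n - 1); s = Tgt R f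
       in coh_class C n (coh_actO R C n (Src R f) P) (coh_actO R C n s Q)
         (s \<odot>\<^bsub>Mod C (n - 1)\<^esub> X,
          (Inv M (ActIso L s X) \<boxplus>\<^bsub>M\<^esub> \<iota>\<^bsub>M\<^esub> (s \<odot>\<^bsub>M\<^esub> fst Q))
            \<cdot>\<^bsub>M\<^esub> ActAdd M s (OMap L X) (fst Q)
            \<cdot>\<^bsub>M\<^esub> (f \<boxdot>\<^bsub>M\<^esub> x))),
     coh_actO R C n (Tgt R f) Q)"

definition cohomology ::
  "('r, 's) ring_data \<Rightarrow> ('r, 's, 'o, 'm) complex_data \<Rightarrow> int \<Rightarrow>
   ('r, 's, 'o \<times> 'm, ('o, 'm) coh_arr) mod_data"
  where "cohomology R C n =
    (let M = Mod C n; add = coh_addO C n; act = coh_actO R C n; J = coh_ind C n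
     in \<lparr> Obj = coh_Obj C n,
          Arr = coh_Arr C n,
          Src = fst,
          Tgt = (\<lambda>f. snd (snd f)),
          Ide = (\<lambda>P. J P P (\<iota>\<^bsub>M\<^esub> (fst P))),
          Comp = coh_comp C n,
          AddO = add,
          AddA = coh_addA C n,
          Zero = coh_zero C n,
          Assoc = (\<lambda>P Q S. J (add (add P Q) S) (add P (add Q S)) (Assoc M (fst P) (fst Q) (fst S))),
          LUnit = (\<lambda>P. J (add (coh_zero C n) P) P (LUnit M (fst P))),
          RUnit = (\<lambda>P. J (add P (coh_zero C n)) P (RUnit M (fst P))),
          Symm = (\<lambda>P Q. J (add P Q) (add Q P) (Symm M (fst P) (fst Q))),
          ActO = act,
          ActA = coh_actA R C n,
          ActAdd = (\<lambda>r P Q. J (act r (add P Q)) (add (act r P) (act r Q)) (ActAdd M r (fst P) (fst Q))),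
          AddAct = (\<lambda>r s P. J (act (r \<oplus>\<^bsub>R\<^esub> s) P) (add (act r P) (act s P)) (AddAct M r s (fst P))),
          MulAct = (\<lambda>r s P. J (act (r \<otimes>\<^bsub>R\<^esub> s) P) (act r (act s P)) (MulAct M r s (fst P))),
          OneAct = (\<lambda>P. J (act \<one>\<^bsub>R\<^esub> P) P (OneAct M (fst P))),
          ActZero = (\<lambda>r. J (act r (coh_zero C n)) (coh_zero C n) (ActZero M r)) \<rparr>)"

definition coh_mapO ::
  "('r, 's, 'p, 'q) complex_data \<Rightarrow> ('r, 'o, 'm, 'p, 'q) complex_mor_data \<Rightarrow> int \<Rightarrow>
   'o \<times> 'm \<Rightarrow> 'p \<times> 'q"
  where "coh_mapO B F n P =
    (OMap (Map F n) (fst P),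
     ZeroIso (Map F (n + 1)) \<cdot>\<^bsub>Mod B (n + 1)\<^esub> AMap (Map F (n + 1)) (snd P)
       \<cdot>\<^bsub>Mod B (n + 1)\<^esub> Inv (Mod B (n + 1)) (Sqr F n (fst P)))"

fun coh_mapA ::
  "('r, 's, 'o, 'm) complex_data \<Rightarrow> ('r, 's, 'p, 'q) complex_data \<Rightarrow>
   ('r, 'o, 'm, 'p, 'q) complex_mor_data \<Rightarrow> int \<Rightarrow> ('o, 'm) coh_arr \<Rightarrow> ('p, 'q) coh_arr"
  where "coh_mapA A B F n (P, c, Q) =
    (coh_mapO B F n P,
     (\<Union>(X, x)\<in>c.
       coh_class B n (coh_mapO B F n P) (coh_mapO B F n Q)
         (OMap (Map F (n - 1)) X,
          (Sqr F (n - 1) X \<boxplus>\<^bsub>Mod B n\<^esub> \<iota>\<^bsub>Mod B n\<^esub> (OMap (Map F n) (fst Q)))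
            \<cdot>\<^bsub>Mod B n\<^esub> AddIso (Map F n) (OMap (Dif A (n - 1)) X) (fst Q)
            \<cdot>\<^bsub>Mod B n\<^esub> AMap (Map F n) x)),
     coh_mapO B F n Q)"

definition cohomology_map ::
  "('r, 's) ring_data \<Rightarrow> ('r, 's, 'o, 'm) complex_data \<Rightarrow> ('r, 's, 'p, 'q) complex_data \<Rightarrow>
   ('r, 'o, 'm, 'p, 'q) complex_mor_data \<Rightarrow> int \<Rightarrow>
   ('r, 'o \<times> 'm, ('o, 'm) coh_arr, 'p \<times> 'q, ('p, 'q) coh_arr) hom_data"
  where "cohomology_map R A B F n =
    (let f = coh_mapO B F n; J = coh_ind B n
     in \<lparr> OMap = f,
          AMap = coh_mapA A B F n,
          AddIso = (\<lambda>P Q. J (f (coh_addO A n P Q)) (coh_addO B n (f P) (f Q))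
            (AddIso (Map F n) (fst P) (fst Q))),
          ZeroIso = J (f (coh_zero A n)) (coh_zero B n) (ZeroIso (Map F n)),
          ActIso = (\<lambda>r P. J (f (coh_actO R A n r P)) (coh_actO R B n r (f P))
            (ActIso (Map F n) r (fst P))) \<rparr>)"

end

theory Submission
  imports Defs
begin

text \<open>Let \<open>L\<close> and \<open>M\<close> denote the differentials of \<open>A\<close> and \<open>B\<close>, and let \<open>P = (x, a)\<close> be an object of the
  \<open>n\<close>-th cohomology of \<open>A\<close>. The homotopy provides an arrow from \<open>F x\<close> to
  \<open>(M (H x) \<oplus> H (L x)) \<oplus> G x\<close>. As \<open>a\<close> trivialises \<open>L x\<close>, the middle summand can be discarded,
  which leaves an arrow from \<open>F x\<close> to \<open>M (H x) \<oplus> G x\<close> (\<open>reduced\<close>). Together with \<open>H x\<close> it is a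
  representative of an arrow from the image of \<open>P\<close> under \<open>F\<close> to its image under \<open>G\<close>, and the classes of
  these representatives are the components of the required 2-morphism. Four things have to hold.

  \<^item> The pair satisfies the side condition on representatives. This is the compatibility condition of
  the homotopy in degree \<open>n\<close>, combined with the cocycle condition on \<open>P\<close> (\<open>kernel_hom_reduced\<close>).
  \<^item> The components are natural with respect to an arrow \<open>[X, p]\<close> from \<open>P\<close> to \<open>Q = (q, b)\<close>. The two composites have first
  components \<open>F X \<oplus> H q\<close> and \<open>H x \<oplus> G X\<close>, which need not be isomorphic. However, \<open>H p\<close> identifies \<open>H x\<close>
  with \<open>H (L X) \<oplus> H q\<close>, the homotopy splits \<open>F X\<close> into \<open>M (H X)\<close>, \<open>H (L X)\<close> and \<open>G X\<close>, and a summand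
  of the form \<open>M (H X)\<close> is just what the equivalence of representatives neglects. That the second
  components agree is the compatibility condition in degree \<open>n - 1\<close> (\<open>reduced_natural\<close>).
  \<^item> The components are compatible with sums, zero and the action, because the homotopy is
  (\<open>reduced_AddO\<close>, \<open>reduced_Zero\<close>, \<open>reduced_ActO\<close>).
  \<^item> They are invertible, as is every arrow of the cohomology: opposites of objects provide right
  inverses, and since composition of classes is associative these are two-sided (\<open>eqv_opposite_comp\<close>).

  The operations on cohomology are defined on equivalence classes of pairs subject to a side
  condition. Two reformulations keep this under control. Firstly, \<open>(X, p)\<close> and \<open>(X', p')\<close> are equivalent
  iff \<open>p' = (u \<boxplus> \<iota>) \<cdot> p\<close> for an \<open>inessential\<close> arrow \<open>u\<close> from \<open>L X\<close> to \<open>L X'\<close>. Inessential arrows are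
  generated by the images of arrows under \<open>L\<close> and by the arrows (\<open>absorb\<close>) that discard a summand in
  the image of the composite of two consecutive differentials; they are closed under composition, inverses, sums, the
  action and morphisms of complexes, and this gives the independence of representatives. Secondly, the
  side condition says that \<open>p\<close> is an arrow in the kernel of the next differential (\<open>kernel_hom\<close>).
  All structural isomorphisms are such arrows, hence so is everything composed from them.\<close>

section \<open>Calculating with typed arrows\<close>

context groupoid
begin

lemma in_homI [intro]: "f \<in> Arr A \<Longrightarrow> Src A f = x \<Longrightarrow> Tgt A f = y \<Longrightarrow> \<guillemotleft>f : x \<rightarrow> y\<guillemotright>"
  by (simp add: in_hom_def)

lemma in_hom_self: "f \<in> Arr A \<Longrightarrow> \<guillemotleft>f : Src A f \<rightarrow> Tgt A f\<guillemotright>"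
  by (simp add: in_hom_def)

lemma Src_Tgt_Obj [simp]: "f \<in> Arr A \<Longrightarrow> Src A f \<in> Obj A" "f \<in> Arr A \<Longrightarrow> Tgt A f \<in> Obj A"
  by (auto intro: Src_Obj Tgt_Obj)

lemma Ide_type [simp]:
  assumes "x \<in> Obj A" shows "\<iota> x \<in> Arr A" "Src A (\<iota> x) = x" "Tgt A (\<iota> x) = x"
  using Ide_in_hom[OF assms] by (auto simp: in_hom_def)

lemma Comp_type [simp]:
  assumes "f \<in> Arr A" "g \<in> Arr A" "Src A g = Tgt A f"
  shows "g \<cdot> f \<in> Arr A" "Src A (g \<cdot> f) = Src A f" "Tgt A (g \<cdot> f) = Tgt A g"
  using Comp_in_hom[of f "Src A f" "Tgt A f" g "Tgt A g"] assms by (auto simp: in_hom_def)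

lemma Comp_Ide_right [simp]: "f \<in> Arr A \<Longrightarrow> Src A f = x \<Longrightarrow> f \<cdot> \<iota> x = f"
  by (rule Comp_Ide[of _ _ "Tgt A f"]) auto

lemma Comp_Ide_left [simp]: "f \<in> Arr A \<Longrightarrow> Tgt A f = x \<Longrightarrow> \<iota> x \<cdot> f = f"
  by (rule Ide_Comp[of _ "Src A f"]) auto

lemma Comp_assoc_right [simp]:
  "f \<in> Arr A \<Longrightarrow> g \<in> Arr A \<Longrightarrow> h \<in> Arr A \<Longrightarrow> Src A g = Tgt A f \<Longrightarrow> Src A h = Tgt A g \<Longrightarrow>
   (h \<cdot> g) \<cdot> f = h \<cdot> g \<cdot> f"
  by (rule Comp_assoc[of _ "Src A f" "Tgt A f" _ "Tgt A g" _ "Tgt A h"]) auto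

lemma inverse_arrows_unique:
  assumes "inverse_arrows A f g" "inverse_arrows A f h" shows "g = h"
proof -
  have "g = g \<cdot> f \<cdot> h" using assms by (auto simp: inverse_arrows_def in_hom_def)
  also have "\<dots> = (g \<cdot> f) \<cdot> h" using assms by (subst Comp_assoc_right) (auto simp: inverse_arrows_def in_hom_def)
  also have "\<dots> = h" using assms by (auto simp: inverse_arrows_def in_hom_def simp del: Comp_assoc_right)
  finally show ?thesis .
qed

lemma inverse_arrows_Inv: "f \<in> Arr A \<Longrightarrow> inverse_arrows A f (Inv A f)"
  unfolding Inv_def using ex_inverse inverse_arrows_unique by (metis theI)

lemma Inv_type [simp]:
  assumes "f \<in> Arr A"
  shows "Inv A f \<in> Arr A" "Src A (Inv A f) = Tgt A f" "Tgt A (Inv A f) = Src A f"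
    "Inv A f \<cdot> f = \<iota> (Src A f)" "f \<cdot> Inv A f = \<iota> (Tgt A f)"
  using inverse_arrows_Inv[OF assms] by (auto simp: inverse_arrows_def in_hom_def)

lemma Inv_cancel [simp]:
  assumes "f \<in> Arr A" "k \<in> Arr A"
  shows "Tgt A k = Src A f \<Longrightarrow> Inv A f \<cdot> f \<cdot> k = k" "Tgt A k = Tgt A f \<Longrightarrow> f \<cdot> Inv A f \<cdot> k = k"
  using assms by (simp_all add: Comp_assoc_right[symmetric] del: Comp_assoc_right)

lemma Inv_unique:
  assumes "f \<in> Arr A" "g \<in> Arr A" "Src A g = Tgt A f" "Tgt A g = Src A f" "g \<cdot> f = \<iota> (Src A f)"
  shows "Inv A f = g"
proof -
  have "g = (g \<cdot> f) \<cdot> Inv A f" using assms(1-4) by simp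
  also have "\<dots> = Inv A f" unfolding assms(5) using assms(1) by simp
  finally show ?thesis ..
qed

lemma Inv_Inv [simp]: "f \<in> Arr A \<Longrightarrow> Inv A (Inv A f) = f"
  by (rule Inv_unique) auto

lemma Inv_Ide [simp]: "x \<in> Obj A \<Longrightarrow> Inv A (\<iota> x) = \<iota> x"
  by (rule Inv_unique) auto

lemma Inv_Comp:
  "f \<in> Arr A \<Longrightarrow> g \<in> Arr A \<Longrightarrow> Src A g = Tgt A f \<Longrightarrow> Inv A (g \<cdot> f) = Inv A f \<cdot> Inv A g"
  by (rule Inv_unique) auto

lemma Comp_cancel_left:
  assumes "f \<cdot> g = f \<cdot> h" "f \<in> Arr A" "g \<in> Arr A" "h \<in> Arr A" "Src A f = Tgt A g" "Src A f = Tgt A h"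
  shows "g = h"
proof -
  have "g = Inv A f \<cdot> f \<cdot> g" using assms(2-) by simp
  also have "\<dots> = h" unfolding assms(1) using assms(2-) by simp
  finally show ?thesis .
qed

lemma Comp_cancel_right:
  assumes "g \<cdot> f = h \<cdot> f" "f \<in> Arr A" "g \<in> Arr A" "h \<in> Arr A" "Src A g = Tgt A f" "Src A h = Tgt A f"
  shows "g = h"
proof -
  have "g = (g \<cdot> f) \<cdot> Inv A f" using assms(2-) by simp
  also have "\<dots> = h" unfolding assms(1) using assms(2-) by simp
  finally show ?thesis .
qed

lemma Inv_shift_left:
  assumes "f \<cdot> g = h" "f \<in> Arr A" "g \<in> Arr A" "Src A f = Tgt A g"
  shows "g = Inv A f \<cdot> h"
  using assms by auto

text \<open>Composites are kept associated to the right, so an equation between composites has to be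
  extended by an arbitrary first factor before it can rewrite inside a longer composite.\<close>

lemma Comp_eq_extend:
  assumes "g \<cdot> f = h" "f \<in> Arr A" "g \<in> Arr A" "Src A g = Tgt A f" "k \<in> Arr A" "Src A f = Tgt A k"
  shows "g \<cdot> f \<cdot> k = h \<cdot> k"
  using assms Comp_assoc_right[of k f g] by simp

end

section \<open>Coherence in symmetric 2-groups\<close>

context symmetric_2group
begin

lemma Zero_AddO_Obj [simp]: "\<zero> \<in> Obj A" "x \<in> Obj A \<Longrightarrow> y \<in> Obj A \<Longrightarrow> x \<oplus> y \<in> Obj A"
  by (auto intro: Zero_Obj AddO_Obj)

lemma AddA_type [simp]:
  assumes "f \<in> Arr A" "g \<in> Arr A"
  shows "f \<boxplus> g \<in> Arr A" "Src A (f \<boxplus> g) = Src A f \<oplus> Src A g" "Tgt A (f \<boxplus> g) = Tgt A f \<oplus> Tgt A g"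
  using AddA_in_hom[of f "Src A f" "Tgt A f" g "Src A g" "Tgt A g"] assms by (auto simp: in_hom_def)

lemma Assoc_type [simp]:
  assumes "x \<in> Obj A" "y \<in> Obj A" "z \<in> Obj A"
  shows "Assoc A x y z \<in> Arr A" "Src A (Assoc A x y z) = (x \<oplus> y) \<oplus> z" "Tgt A (Assoc A x y z) = x \<oplus> (y \<oplus> z)"
  using Assoc_in_hom[OF assms] by (auto simp: in_hom_def)

lemma LUnit_type [simp]:
  assumes "x \<in> Obj A"
  shows "LUnit A x \<in> Arr A" "Src A (LUnit A x) = \<zero> \<oplus> x" "Tgt A (LUnit A x) = x"
  using LUnit_in_hom[OF assms] by (auto simp: in_hom_def)

lemma RUnit_type [simp]:
  assumes "x \<in> Obj A"
  shows "RUnit A x \<in> Arr A" "Src A (RUnit A x) = x \<oplus> \<zero>" "Tgt A (RUnit A x) = x"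
  using RUnit_in_hom[OF assms] by (auto simp: in_hom_def)

lemma Symm_type [simp]:
  assumes "x \<in> Obj A" "y \<in> Obj A"
  shows "Symm A x y \<in> Arr A" "Src A (Symm A x y) = x \<oplus> y" "Tgt A (Symm A x y) = y \<oplus> x"
  using Symm_in_hom[OF assms] by (auto simp: in_hom_def)

declare AddA_Ide [simp]

text \<open>Sums of arrows are merged wherever they meet. With composites associated to the right, this
  brings a composite into a normal form in which sums alternate with structural isomorphisms.\<close>

lemma AddA_merge [simp]:
  assumes "f \<in> Arr A" "g \<in> Arr A" "f' \<in> Arr A" "g' \<in> Arr A" "Src A g = Tgt A f" "Src A g' = Tgt A f'"
  shows "(g \<boxplus> g') \<cdot> (f \<boxplus> f') = (g \<cdot> f) \<boxplus> (g' \<cdot> f')"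
  by (rule AddA_Comp[symmetric]) (use assms in auto)

lemma AddA_merge_pre [simp]:
  assumes "f \<in> Arr A" "g \<in> Arr A" "f' \<in> Arr A" "g' \<in> Arr A" "Src A g = Tgt A f" "Src A g' = Tgt A f'"
    "k \<in> Arr A" "Tgt A k = Src A f \<oplus> Src A f'"
  shows "(g \<boxplus> g') \<cdot> (f \<boxplus> f') \<cdot> k = ((g \<cdot> f) \<boxplus> (g' \<cdot> f')) \<cdot> k"
  by (rule Comp_eq_extend[OF AddA_merge]) (use assms in auto)

lemma Inv_AddA [simp]: "f \<in> Arr A \<Longrightarrow> g \<in> Arr A \<Longrightarrow> Inv A (f \<boxplus> g) = Inv A f \<boxplus> Inv A g"
  by (rule Inv_unique) auto

lemma Assoc_nat:
  assumes "f \<in> Arr A" "g \<in> Arr A" "h \<in> Arr A"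
  shows "Assoc A (Tgt A f) (Tgt A g) (Tgt A h) \<cdot> ((f \<boxplus> g) \<boxplus> h)
    = (f \<boxplus> (g \<boxplus> h)) \<cdot> Assoc A (Src A f) (Src A g) (Src A h)"
  using assms by (auto intro!: Assoc_natural)

lemma Inv_Assoc_nat:
  assumes "f \<in> Arr A" "g \<in> Arr A" "h \<in> Arr A"
  shows "Inv A (Assoc A (Tgt A f) (Tgt A g) (Tgt A h)) \<cdot> (f \<boxplus> (g \<boxplus> h))
    = ((f \<boxplus> g) \<boxplus> h) \<cdot> Inv A (Assoc A (Src A f) (Src A g) (Src A h))"
proof (rule Comp_cancel_right[where f = "Assoc A (Src A f) (Src A g) (Src A h)"])
  show "(Inv A (Assoc A (Tgt A f) (Tgt A g) (Tgt A h)) \<cdot> (f \<boxplus> (g \<boxplus> h))) \<cdot> Assoc A (Src A f) (Src A g) (Src A h)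
    = (((f \<boxplus> g) \<boxplus> h) \<cdot> Inv A (Assoc A (Src A f) (Src A g) (Src A h))) \<cdot> Assoc A (Src A f) (Src A g) (Src A h)"
    using assms by (simp add: Assoc_nat[symmetric])
qed (use assms in auto)

lemma LUnit_nat: "f \<in> Arr A \<Longrightarrow> LUnit A (Tgt A f) \<cdot> (\<iota> \<zero> \<boxplus> f) = f \<cdot> LUnit A (Src A f)"
  by (auto intro!: LUnit_natural)

lemma RUnit_nat: "f \<in> Arr A \<Longrightarrow> RUnit A (Tgt A f) \<cdot> (f \<boxplus> \<iota> \<zero>) = f \<cdot> RUnit A (Src A f)"
  by (auto intro!: RUnit_natural)

lemma Symm_nat: "f \<in> Arr A \<Longrightarrow> g \<in> Arr A \<Longrightarrow>
    Symm A (Tgt A f) (Tgt A g) \<cdot> (f \<boxplus> g) = (g \<boxplus> f) \<cdot> Symm A (Src A f) (Src A g)"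
  by (auto intro!: Symm_natural)

lemma Zero_AddA_faithful:
  assumes "\<iota> \<zero> \<boxplus> f = \<iota> \<zero> \<boxplus> g" "f \<in> Arr A" "g \<in> Arr A" "Src A f = Src A g" "Tgt A f = Tgt A g"
  shows "f = g"
proof (rule Comp_cancel_right[where f = "LUnit A (Src A f)"])
  show "f \<cdot> LUnit A (Src A f) = g \<cdot> LUnit A (Src A f)"
    using LUnit_nat[of f] LUnit_nat[of g] assms by simp
qed (use assms in auto)

lemma AddA_Zero_faithful:
  assumes "f \<boxplus> \<iota> \<zero> = g \<boxplus> \<iota> \<zero>" "f \<in> Arr A" "g \<in> Arr A" "Src A f = Src A g" "Tgt A f = Tgt A g"
  shows "f = g"
proof (rule Comp_cancel_right[where f = "RUnit A (Src A f)"])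
  show "f \<cdot> RUnit A (Src A f) = g \<cdot> RUnit A (Src A f)"
    using RUnit_nat[of f] RUnit_nat[of g] assms by simp
qed (use assms in auto)

lemma RUnit_triangle: "x \<in> Obj A \<Longrightarrow> y \<in> Obj A \<Longrightarrow>
    (RUnit A x \<boxplus> \<iota> y) \<cdot> Inv A (Assoc A x \<zero> y) = \<iota> x \<boxplus> LUnit A y"
  by (simp add: triangle[symmetric])

text \<open>Kelly's argument: the pentagon and the triangle give the identity after \<open>\<zero>\<close> has been added on
  the left, and adding \<open>\<zero>\<close> is faithful.\<close>

lemma LUnit_Assoc:
  assumes x: "x \<in> Obj A" and y: "y \<in> Obj A"
  shows "LUnit A (x \<oplus> y) \<cdot> Assoc A \<zero> x y = LUnit A x \<boxplus> \<iota> y"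
proof -
  let ?z = "\<zero>"
  have n1: "Assoc A ?z x y \<cdot> ((\<iota> ?z \<boxplus> LUnit A x) \<boxplus> \<iota> y)
      = (\<iota> ?z \<boxplus> (LUnit A x \<boxplus> \<iota> y)) \<cdot> Assoc A ?z (?z \<oplus> x) y"
    using Assoc_nat[of "\<iota> ?z" "LUnit A x" "\<iota> y"] x y by simp
  have n2: "Assoc A ?z x y \<cdot> ((RUnit A ?z \<boxplus> \<iota> x) \<boxplus> \<iota> y)
      = (RUnit A ?z \<boxplus> \<iota> (x \<oplus> y)) \<cdot> Assoc A (?z \<oplus> ?z) x y"
    using Assoc_nat[of "RUnit A ?z" "\<iota> x" "\<iota> y"] x y by simp
  have "(\<iota> ?z \<boxplus> LUnit A (x \<oplus> y)) \<cdot> (\<iota> ?z \<boxplus> Assoc A ?z x y) \<cdot> Assoc A ?z (?z \<oplus> x) y \<cdot> (Assoc A ?z ?z x \<boxplus> \<iota> y)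
    = ((\<iota> ?z \<boxplus> LUnit A (x \<oplus> y)) \<cdot> Assoc A ?z ?z (x \<oplus> y)) \<cdot> Assoc A (?z \<oplus> ?z) x y"
    using x y by (simp add: pentagon[symmetric] del: AddA_merge_pre)
  also have "\<dots> = (RUnit A ?z \<boxplus> \<iota> (x \<oplus> y)) \<cdot> Assoc A (?z \<oplus> ?z) x y"
    using x y by (simp only: triangle Zero_AddO_Obj)
  also have "\<dots> = Assoc A ?z x y \<cdot> (((\<iota> ?z \<boxplus> LUnit A x) \<cdot> Assoc A ?z ?z x) \<boxplus> \<iota> y)"
    using x y by (simp add: n2[symmetric] triangle)
  also have "\<dots> = (Assoc A ?z x y \<cdot> ((\<iota> ?z \<boxplus> LUnit A x) \<boxplus> \<iota> y)) \<cdot> (Assoc A ?z ?z x \<boxplus> \<iota> y)"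
    using x y by simp
  also have "\<dots> = (\<iota> ?z \<boxplus> (LUnit A x \<boxplus> \<iota> y)) \<cdot> Assoc A ?z (?z \<oplus> x) y \<cdot> (Assoc A ?z ?z x \<boxplus> \<iota> y)"
    unfolding n1 using x y by simp
  finally have "(\<iota> ?z \<boxplus> (LUnit A (x \<oplus> y) \<cdot> Assoc A ?z x y)) \<cdot> (Assoc A ?z (?z \<oplus> x) y \<cdot> (Assoc A ?z ?z x \<boxplus> \<iota> y))
     = (\<iota> ?z \<boxplus> (LUnit A x \<boxplus> \<iota> y)) \<cdot> (Assoc A ?z (?z \<oplus> x) y \<cdot> (Assoc A ?z ?z x \<boxplus> \<iota> y))"
    using x y by simp
  then have "\<iota> ?z \<boxplus> (LUnit A (x \<oplus> y) \<cdot> Assoc A ?z x y) = \<iota> ?z \<boxplus> (LUnit A x \<boxplus> \<iota> y)"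
    by (rule Comp_cancel_right) (use x y in auto)
  then show ?thesis
    by (rule Zero_AddA_faithful) (use x y in auto)
qed

text \<open>The hexagon at \<open>x, \<zero>, \<zero>\<close>, followed by a left unit, gives the identity after \<open>\<zero>\<close> has been added
  on the right.\<close>

lemma LUnit_Symm:
  assumes x: "x \<in> Obj A" shows "LUnit A x \<cdot> Symm A x \<zero> = RUnit A x"
proof -
  let ?z = "\<zero>"
  have s: "Symm A x ?z \<cdot> (\<iota> x \<boxplus> LUnit A ?z) = (LUnit A ?z \<boxplus> \<iota> x) \<cdot> Symm A x (?z \<oplus> ?z)"
    using Symm_nat[of "\<iota> x" "LUnit A ?z"] x by simp
  have "Symm A x ?z \<cdot> (RUnit A x \<boxplus> \<iota> ?z) = (Symm A x ?z \<cdot> (\<iota> x \<boxplus> LUnit A ?z)) \<cdot> Assoc A x ?z ?z"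
    using x by (simp add: triangle)
  also have "\<dots> = (LUnit A (?z \<oplus> x) \<cdot> Assoc A ?z ?z x) \<cdot> Symm A x (?z \<oplus> ?z) \<cdot> Assoc A x ?z ?z"
    unfolding s using x by (simp only: LUnit_Assoc Zero_AddO_Obj, simp)
  also have "\<dots> = LUnit A (?z \<oplus> x) \<cdot> (\<iota> ?z \<boxplus> Symm A x ?z) \<cdot> Assoc A ?z x ?z \<cdot> (Symm A x ?z \<boxplus> \<iota> ?z)"
    using x by (simp add: hexagon)
  also have "\<dots> = (LUnit A (?z \<oplus> x) \<cdot> (\<iota> ?z \<boxplus> Symm A x ?z)) \<cdot> Assoc A ?z x ?z \<cdot> (Symm A x ?z \<boxplus> \<iota> ?z)"
    using x by simp
  also have "\<dots> = Symm A x ?z \<cdot> (LUnit A (x \<oplus> ?z) \<cdot> Assoc A ?z x ?z) \<cdot> (Symm A x ?z \<boxplus> \<iota> ?z)"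
    using LUnit_nat[of "Symm A x ?z"] x by simp
  also have "\<dots> = Symm A x ?z \<cdot> ((LUnit A x \<cdot> Symm A x ?z) \<boxplus> \<iota> ?z)"
    unfolding LUnit_Assoc[OF x Zero_Obj] using x by simp
  finally have "RUnit A x \<boxplus> \<iota> ?z = (LUnit A x \<cdot> Symm A x ?z) \<boxplus> \<iota> ?z"
    by (rule Comp_cancel_left) (use x in auto)
  then show ?thesis
    by (rule AddA_Zero_faithful[symmetric]) (use x in auto)
qed

lemma LUnit_Zero: "LUnit A \<zero> = RUnit A \<zero>"
proof -
  have "RUnit A \<zero> \<boxplus> \<iota> \<zero> = (\<iota> \<zero> \<boxplus> LUnit A \<zero>) \<cdot> Assoc A \<zero> \<zero> \<zero>" by (simp add: triangle)
  also have "\<iota> \<zero> \<boxplus> LUnit A \<zero> = LUnit A (\<zero> \<oplus> \<zero>)"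
    by (rule Comp_cancel_left[of "LUnit A \<zero>"]) (use LUnit_nat[of "LUnit A \<zero>"] in auto)
  also have "\<dots> \<cdot> Assoc A \<zero> \<zero> \<zero> = LUnit A \<zero> \<boxplus> \<iota> \<zero>" by (simp add: LUnit_Assoc)
  finally show ?thesis by (rule AddA_Zero_faithful[symmetric]) auto
qed

lemma Symm_Zero: "Symm A \<zero> \<zero> = \<iota> (\<zero> \<oplus> \<zero>)"
  by (rule Comp_cancel_left[of "LUnit A \<zero>"]) (auto simp: LUnit_Symm, simp add: LUnit_Zero)

lemma Inv_Symm [simp]: "x \<in> Obj A \<Longrightarrow> y \<in> Obj A \<Longrightarrow> Inv A (Symm A x y) = Symm A y x"
  by (rule Inv_unique) (auto simp: Symm_Symm)

text \<open>Again Kelly's argument, with the pentagon at \<open>x, y, \<zero>, \<zero>\<close>.\<close>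

lemma RUnit_Assoc:
  assumes x: "x \<in> Obj A" and y: "y \<in> Obj A"
  shows "(\<iota> x \<boxplus> RUnit A y) \<cdot> Assoc A x y \<zero> = RUnit A (x \<oplus> y)"
proof -
  let ?z = "\<zero>"
  have n1: "(\<iota> x \<boxplus> (\<iota> y \<boxplus> LUnit A ?z)) \<cdot> Assoc A x y (?z \<oplus> ?z)
      = Assoc A x y ?z \<cdot> (\<iota> (x \<oplus> y) \<boxplus> LUnit A ?z)"
    using Assoc_nat[of "\<iota> x" "\<iota> y" "LUnit A ?z"] x y by simp
  have n2: "Assoc A x y ?z \<cdot> ((\<iota> x \<boxplus> RUnit A y) \<boxplus> \<iota> ?z)
      = (\<iota> x \<boxplus> (RUnit A y \<boxplus> \<iota> ?z)) \<cdot> Assoc A x (y \<oplus> ?z) ?z"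
    using Assoc_nat[of "\<iota> x" "RUnit A y" "\<iota> ?z"] x y by simp
  have "Assoc A x y ?z \<cdot> ((\<iota> x \<boxplus> RUnit A y) \<boxplus> \<iota> ?z) \<cdot> (Assoc A x y ?z \<boxplus> \<iota> ?z)
      = (Assoc A x y ?z \<cdot> ((\<iota> x \<boxplus> RUnit A y) \<boxplus> \<iota> ?z)) \<cdot> (Assoc A x y ?z \<boxplus> \<iota> ?z)"
    using x y by simp
  also have "\<dots> = (\<iota> x \<boxplus> ((\<iota> y \<boxplus> LUnit A ?z) \<cdot> Assoc A y ?z ?z)) \<cdot> Assoc A x (y \<oplus> ?z) ?z \<cdot> (Assoc A x y ?z \<boxplus> \<iota> ?z)"
    unfolding n2 using x y by (simp add: triangle)
  also have "\<dots> = (\<iota> x \<boxplus> (\<iota> y \<boxplus> LUnit A ?z)) \<cdot> ((\<iota> x \<boxplus> Assoc A y ?z ?z) \<cdot> Assoc A x (y \<oplus> ?z) ?z \<cdot> (Assoc A x y ?z \<boxplus> \<iota> ?z))"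
    using x y by simp
  also have "\<dots> = ((\<iota> x \<boxplus> (\<iota> y \<boxplus> LUnit A ?z)) \<cdot> Assoc A x y (?z \<oplus> ?z)) \<cdot> Assoc A (x \<oplus> y) ?z ?z"
    using x y by (simp only: pentagon[symmetric] Zero_AddO_Obj, simp)
  also have "\<dots> = Assoc A x y ?z \<cdot> (RUnit A (x \<oplus> y) \<boxplus> \<iota> ?z)"
    unfolding n1 using x y by (simp add: triangle)
  finally have "((\<iota> x \<boxplus> RUnit A y) \<boxplus> \<iota> ?z) \<cdot> (Assoc A x y ?z \<boxplus> \<iota> ?z) = RUnit A (x \<oplus> y) \<boxplus> \<iota> ?z"
    by (rule Comp_cancel_left) (use x y in auto)
  then have "((\<iota> x \<boxplus> RUnit A y) \<cdot> Assoc A x y ?z) \<boxplus> \<iota> ?z = RUnit A (x \<oplus> y) \<boxplus> \<iota> ?z"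
    using x y by simp
  then show ?thesis
    by (rule AddA_Zero_faithful) (use x y in auto)
qed

text \<open>The part of \<open>Interchange\<close> that does not involve the last summand.\<close>

definition Shuffle :: "'a \<Rightarrow> 'a \<Rightarrow> 'a \<Rightarrow> 'b"
  where "Shuffle a b d = Inv A (Assoc A a d b) \<cdot> (\<iota> a \<boxplus> Symm A b d) \<cdot> Assoc A a b d"

lemma Shuffle_type [simp]:
  assumes "a \<in> Obj A" "b \<in> Obj A" "d \<in> Obj A"
  shows "Shuffle a b d \<in> Arr A" "Src A (Shuffle a b d) = (a \<oplus> b) \<oplus> d" "Tgt A (Shuffle a b d) = (a \<oplus> d) \<oplus> b"
  using assms by (simp_all add: Shuffle_def)

lemma Interchange_type [simp]:
  assumes "a \<in> Obj A" "b \<in> Obj A" "d \<in> Obj A" "e \<in> Obj A"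
  shows "Interchange A a b d e \<in> Arr A"
    "Src A (Interchange A a b d e) = (a \<oplus> b) \<oplus> (d \<oplus> e)"
    "Tgt A (Interchange A a b d e) = (a \<oplus> d) \<oplus> (b \<oplus> e)"
  using assms by (simp_all add: Interchange_def)

lemma Shuffle_nat:
  assumes "f \<in> Arr A" "g \<in> Arr A" "h \<in> Arr A"
  shows "Shuffle (Tgt A f) (Tgt A g) (Tgt A h) \<cdot> ((f \<boxplus> g) \<boxplus> h)
    = ((f \<boxplus> h) \<boxplus> g) \<cdot> Shuffle (Src A f) (Src A g) (Src A h)"
proof -
  have "Shuffle (Tgt A f) (Tgt A g) (Tgt A h) \<cdot> ((f \<boxplus> g) \<boxplus> h)
    = Inv A (Assoc A (Tgt A f) (Tgt A h) (Tgt A g)) \<cdot> (f \<boxplus> (Symm A (Tgt A g) (Tgt A h) \<cdot> (g \<boxplus> h)))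
        \<cdot> Assoc A (Src A f) (Src A g) (Src A h)"
    using assms by (simp add: Shuffle_def Assoc_nat)
  also have "\<dots> = Inv A (Assoc A (Tgt A f) (Tgt A h) (Tgt A g)) \<cdot> (f \<boxplus> (h \<boxplus> g))
        \<cdot> (\<iota> (Src A f) \<boxplus> Symm A (Src A g) (Src A h)) \<cdot> Assoc A (Src A f) (Src A g) (Src A h)"
    using assms by (simp add: Symm_nat)
  also have "\<dots> = ((f \<boxplus> h) \<boxplus> g) \<cdot> Shuffle (Src A f) (Src A g) (Src A h)"
    using assms by (simp add: Shuffle_def Comp_eq_extend[OF Inv_Assoc_nat[OF assms(1,3,2)]] del: AddA_merge_pre)
  finally show ?thesis .
qed

text \<open>By the pentagon, an interchange moves nothing but the two inner summands. Naturality of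
  \<open>Interchange\<close> therefore reduces to that of \<open>Shuffle\<close>. Conversely, a shuffle of first components of
  representatives can be traded for an interchange.\<close>

lemma Interchange_Shuffle:
  assumes o: "a \<in> Obj A" "b \<in> Obj A" "d \<in> Obj A" "e \<in> Obj A"
  shows "Interchange A a b d e \<cdot> Assoc A (a \<oplus> b) d e = Assoc A (a \<oplus> d) b e \<cdot> (Shuffle a b d \<boxplus> \<iota> e)"
proof -
  have n: "(\<iota> a \<boxplus> (Symm A b d \<boxplus> \<iota> e)) \<cdot> Assoc A a (b \<oplus> d) e
      = Assoc A a (d \<oplus> b) e \<cdot> ((\<iota> a \<boxplus> Symm A b d) \<boxplus> \<iota> e)"
    using Assoc_nat[of "\<iota> a" "Symm A b d" "\<iota> e"] o by simp
  have p: "(\<iota> a \<boxplus> Assoc A d b e) \<cdot> Assoc A a (d \<oplus> b) e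
      = (Assoc A a d (b \<oplus> e) \<cdot> Assoc A (a \<oplus> d) b e) \<cdot> (Inv A (Assoc A a d b) \<boxplus> \<iota> e)"
    unfolding pentagon[OF o(1,3,2,4)] using o by simp
  have "Interchange A a b d e \<cdot> Assoc A (a \<oplus> b) d e
    = Inv A (Assoc A a d (b \<oplus> e)) \<cdot> (\<iota> a \<boxplus> (Assoc A d b e \<cdot> (Symm A b d \<boxplus> \<iota> e) \<cdot> Inv A (Assoc A b d e)))
      \<cdot> Assoc A a b (d \<oplus> e) \<cdot> Assoc A (a \<oplus> b) d e"
    using o by (simp add: Interchange_def)
  also have "\<dots> = Inv A (Assoc A a d (b \<oplus> e)) \<cdot> (\<iota> a \<boxplus> Assoc A d b e) \<cdot> ((\<iota> a \<boxplus> (Symm A b d \<boxplus> \<iota> e))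
      \<cdot> Assoc A a (b \<oplus> d) e) \<cdot> (Assoc A a b d \<boxplus> \<iota> e)"
    unfolding pentagon[OF o] using o by simp
  also have "\<dots> = Inv A (Assoc A a d (b \<oplus> e)) \<cdot> ((\<iota> a \<boxplus> Assoc A d b e) \<cdot> Assoc A a (d \<oplus> b) e)
      \<cdot> ((\<iota> a \<boxplus> Symm A b d) \<boxplus> \<iota> e) \<cdot> (Assoc A a b d \<boxplus> \<iota> e)"
    unfolding n using o by simp
  also have "\<dots> = Assoc A (a \<oplus> d) b e \<cdot> (Shuffle a b d \<boxplus> \<iota> e)"
    unfolding p using o by (simp add: Shuffle_def)
  finally show ?thesis .
qed

lemma Interchange_nat:
  assumes a: "f \<in> Arr A" "g \<in> Arr A" "h \<in> Arr A" "k \<in> Arr A"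
  shows "Interchange A (Tgt A f) (Tgt A g) (Tgt A h) (Tgt A k) \<cdot> ((f \<boxplus> g) \<boxplus> (h \<boxplus> k))
    = ((f \<boxplus> h) \<boxplus> (g \<boxplus> k)) \<cdot> Interchange A (Src A f) (Src A g) (Src A h) (Src A k)" (is "?l = ?r")
proof (rule Comp_cancel_right[where f = "Assoc A (Src A f \<oplus> Src A g) (Src A h) (Src A k)"])
  have "?l \<cdot> Assoc A (Src A f \<oplus> Src A g) (Src A h) (Src A k)
    = (Interchange A (Tgt A f) (Tgt A g) (Tgt A h) (Tgt A k) \<cdot> Assoc A (Tgt A f \<oplus> Tgt A g) (Tgt A h) (Tgt A k))
       \<cdot> (((f \<boxplus> g) \<boxplus> h) \<boxplus> k)"
    using Assoc_nat[of "f \<boxplus> g" h k] a by simp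
  also have "\<dots> = Assoc A (Tgt A f \<oplus> Tgt A h) (Tgt A g) (Tgt A k)
      \<cdot> (((f \<boxplus> h) \<boxplus> g) \<boxplus> k) \<cdot> (Shuffle (Src A f) (Src A g) (Src A h) \<boxplus> \<iota> (Src A k))"
    using a by (simp add: Interchange_Shuffle Shuffle_nat)
  also have "\<dots> = ((f \<boxplus> h) \<boxplus> (g \<boxplus> k)) \<cdot> Assoc A (Src A f \<oplus> Src A h) (Src A g) (Src A k)
      \<cdot> (Shuffle (Src A f) (Src A g) (Src A h) \<boxplus> \<iota> (Src A k))"
    using Comp_eq_extend[OF Assoc_nat[of "f \<boxplus> h" g k], of "Shuffle (Src A f) (Src A g) (Src A h) \<boxplus> \<iota> (Src A k)"] a
    by (simp del: AddA_merge)
  also have "\<dots> = ?r \<cdot> Assoc A (Src A f \<oplus> Src A g) (Src A h) (Src A k)"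
    using a by (simp add: Interchange_Shuffle)
  finally show "?l \<cdot> Assoc A (Src A f \<oplus> Src A g) (Src A h) (Src A k) = ?r \<cdot> Assoc A (Src A f \<oplus> Src A g) (Src A h) (Src A k)" .
qed (use a in auto)

lemma Interchange_Interchange:
  assumes o: "a \<in> Obj A" "b \<in> Obj A" "d \<in> Obj A" "e \<in> Obj A"
  shows "Interchange A a d b e \<cdot> Interchange A a b d e = \<iota> ((a \<oplus> b) \<oplus> (d \<oplus> e))"
proof -
  have "Interchange A a d b e \<cdot> Interchange A a b d e
    = Inv A (Assoc A a b (d \<oplus> e)) \<cdot> (\<iota> a \<boxplus> (Assoc A b d e \<cdot> ((Symm A d b \<cdot> Symm A b d) \<boxplus> \<iota> e) \<cdot> Inv A (Assoc A b d e)))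
      \<cdot> Assoc A a b (d \<oplus> e)"
    using o by (simp add: Interchange_def)
  also have "\<dots> = \<iota> ((a \<oplus> b) \<oplus> (d \<oplus> e))" using o by (simp add: Symm_Symm)
  finally show ?thesis .
qed

text \<open>The unit isomorphisms absorb a zero that is moved past \<open>q\<close>. Hence discarding trivialised summands
  is compatible with sums.\<close>

lemma Interchange_RUnit:
  assumes o: "p \<in> Obj A" "q \<in> Obj A"
  shows "(RUnit A p \<boxplus> RUnit A q) \<cdot> Interchange A p q \<zero> \<zero> = RUnit A (p \<oplus> q) \<cdot> (\<iota> (p \<oplus> q) \<boxplus> LUnit A \<zero>)"
proof -
  have m: "RUnit A q \<cdot> LUnit A (q \<oplus> \<zero>) \<cdot> Assoc A \<zero> q \<zero> \<cdot> (Symm A q \<zero> \<boxplus> \<iota> \<zero>) \<cdot> Inv A (Assoc A q \<zero> \<zero>)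
      = RUnit A q \<cdot> (\<iota> q \<boxplus> LUnit A \<zero>)"
  proof -
    have "LUnit A (q \<oplus> \<zero>) \<cdot> Assoc A \<zero> q \<zero> \<cdot> (Symm A q \<zero> \<boxplus> \<iota> \<zero>) \<cdot> Inv A (Assoc A q \<zero> \<zero>)
       = (LUnit A (q \<oplus> \<zero>) \<cdot> Assoc A \<zero> q \<zero>) \<cdot> (Symm A q \<zero> \<boxplus> \<iota> \<zero>) \<cdot> Inv A (Assoc A q \<zero> \<zero>)"
      using o by simp
    also have "\<dots> = (RUnit A q \<boxplus> \<iota> \<zero>) \<cdot> Inv A (Assoc A q \<zero> \<zero>)"
      unfolding LUnit_Assoc[OF o(2) Zero_Obj] using o by (simp add: LUnit_Symm)
    finally show ?thesis using o by (simp add: RUnit_triangle)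
  qed
  have "(RUnit A p \<boxplus> RUnit A q) \<cdot> Interchange A p q \<zero> \<zero>
    = (\<iota> p \<boxplus> RUnit A q) \<cdot> ((RUnit A p \<boxplus> \<iota> (q \<oplus> \<zero>)) \<cdot> Inv A (Assoc A p \<zero> (q \<oplus> \<zero>)))
      \<cdot> (\<iota> p \<boxplus> (Assoc A \<zero> q \<zero> \<cdot> (Symm A q \<zero> \<boxplus> \<iota> \<zero>) \<cdot> Inv A (Assoc A q \<zero> \<zero>))) \<cdot> Assoc A p q (\<zero> \<oplus> \<zero>)"
    using o by (simp add: Interchange_def)
  also have "\<dots> = (\<iota> p \<boxplus> (RUnit A q \<cdot> LUnit A (q \<oplus> \<zero>) \<cdot> Assoc A \<zero> q \<zero> \<cdot> (Symm A q \<zero> \<boxplus> \<iota> \<zero>)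
      \<cdot> Inv A (Assoc A q \<zero> \<zero>))) \<cdot> Assoc A p q (\<zero> \<oplus> \<zero>)"
    using o by (subst RUnit_triangle) simp_all
  also have "\<dots> = (\<iota> p \<boxplus> RUnit A q) \<cdot> (\<iota> p \<boxplus> (\<iota> q \<boxplus> LUnit A \<zero>)) \<cdot> Assoc A p q (\<zero> \<oplus> \<zero>)"
    unfolding m using o by simp
  also have "\<dots> = ((\<iota> p \<boxplus> RUnit A q) \<cdot> Assoc A p q \<zero>) \<cdot> (\<iota> (p \<oplus> q) \<boxplus> LUnit A \<zero>)"
    using Assoc_nat[of "\<iota> p" "\<iota> q" "LUnit A \<zero>"] o by (simp del: AddA_merge_pre)
  also have "\<dots> = RUnit A (p \<oplus> q) \<cdot> (\<iota> (p \<oplus> q) \<boxplus> LUnit A \<zero>)"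
    unfolding RUnit_Assoc[OF o] ..
  finally show ?thesis .
qed

end

section \<open>2-modules and their homomorphisms\<close>

context two_module
begin

lemma ActO_Obj' [simp]: "r \<in> Obj R \<Longrightarrow> x \<in> Obj A \<Longrightarrow> r \<odot>\<^bsub>A\<^esub> x \<in> Obj A"
  by (rule ActO_Obj)

lemma ActA_type [simp]:
  assumes "a \<in> Arr R" "f \<in> Arr A"
  shows "a \<boxdot>\<^bsub>A\<^esub> f \<in> Arr A" "Src A (a \<boxdot>\<^bsub>A\<^esub> f) = Src R a \<odot>\<^bsub>A\<^esub> Src A f"
    "Tgt A (a \<boxdot>\<^bsub>A\<^esub> f) = Tgt R a \<odot>\<^bsub>A\<^esub> Tgt A f"
  using ActA_in_hom[OF R.in_hom_self[OF assms(1)] A.in_hom_self[OF assms(2)]] by (auto simp: in_hom_def)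

declare ActA_Ide [simp]

lemma ActAdd_type [simp]:
  assumes "r \<in> Obj R" "x \<in> Obj A" "y \<in> Obj A"
  shows "ActAdd A r x y \<in> Arr A" "Src A (ActAdd A r x y) = r \<odot>\<^bsub>A\<^esub> (x \<oplus>\<^bsub>A\<^esub> y)"
    "Tgt A (ActAdd A r x y) = r \<odot>\<^bsub>A\<^esub> x \<oplus>\<^bsub>A\<^esub> r \<odot>\<^bsub>A\<^esub> y"
  using ActAdd_in_hom[OF assms] by (auto simp: in_hom_def)

lemma ActZero_type [simp]:
  assumes "r \<in> Obj R"
  shows "ActZero A r \<in> Arr A" "Src A (ActZero A r) = r \<odot>\<^bsub>A\<^esub> \<zero>\<^bsub>A\<^esub>" "Tgt A (ActZero A r) = \<zero>\<^bsub>A\<^esub>"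
  using ActZero_in_hom[OF assms] by (auto simp: in_hom_def)

lemma ActA_merge [simp]:
  assumes "r \<in> Obj R" "f \<in> Arr A" "g \<in> Arr A" "Src A g = Tgt A f"
  shows "(\<iota>\<^bsub>R\<^esub> r \<boxdot>\<^bsub>A\<^esub> g) \<cdot>\<^bsub>A\<^esub> (\<iota>\<^bsub>R\<^esub> r \<boxdot>\<^bsub>A\<^esub> f) = \<iota>\<^bsub>R\<^esub> r \<boxdot>\<^bsub>A\<^esub> (g \<cdot>\<^bsub>A\<^esub> f)"
  using ActA_Comp[of "\<iota>\<^bsub>R\<^esub> r" r r "\<iota>\<^bsub>R\<^esub> r" r f "Src A f" "Tgt A f" g "Tgt A g"] assms
  by (simp add: in_hom_def)

lemma ActA_merge_pre [simp]:
  assumes "r \<in> Obj R" "f \<in> Arr A" "g \<in> Arr A" "Src A g = Tgt A f" "k \<in> Arr A" "Tgt A k = r \<odot>\<^bsub>A\<^esub> Src A f"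
  shows "(\<iota>\<^bsub>R\<^esub> r \<boxdot>\<^bsub>A\<^esub> g) \<cdot>\<^bsub>A\<^esub> (\<iota>\<^bsub>R\<^esub> r \<boxdot>\<^bsub>A\<^esub> f) \<cdot>\<^bsub>A\<^esub> k = (\<iota>\<^bsub>R\<^esub> r \<boxdot>\<^bsub>A\<^esub> (g \<cdot>\<^bsub>A\<^esub> f)) \<cdot>\<^bsub>A\<^esub> k"
  by (rule A.Comp_eq_extend[OF ActA_merge]) (use assms in auto)

lemma Inv_ActA [simp]:
  assumes "r \<in> Obj R" "f \<in> Arr A"
  shows "Inv A (\<iota>\<^bsub>R\<^esub> r \<boxdot>\<^bsub>A\<^esub> f) = \<iota>\<^bsub>R\<^esub> r \<boxdot>\<^bsub>A\<^esub> Inv A f"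
  by (rule A.Inv_unique) (use assms in auto)

lemma ActAdd_nat:
  assumes "r \<in> Obj R" "f \<in> Arr A" "g \<in> Arr A"
  shows "ActAdd A r (Tgt A f) (Tgt A g) \<cdot>\<^bsub>A\<^esub> (\<iota>\<^bsub>R\<^esub> r \<boxdot>\<^bsub>A\<^esub> (f \<boxplus>\<^bsub>A\<^esub> g))
      = (\<iota>\<^bsub>R\<^esub> r \<boxdot>\<^bsub>A\<^esub> f \<boxplus>\<^bsub>A\<^esub> \<iota>\<^bsub>R\<^esub> r \<boxdot>\<^bsub>A\<^esub> g) \<cdot>\<^bsub>A\<^esub> ActAdd A r (Src A f) (Src A g)"
  using assms by (intro ActAdd_natural R.in_homI A.in_homI) auto

text \<open>The symmetry carries the axiom with the zero on the left to the other side.\<close>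

lemma ActAdd_ActZero_right:
  assumes o: "r \<in> Obj R" "x \<in> Obj A"
  shows "RUnit A (r \<odot>\<^bsub>A\<^esub> x) \<cdot>\<^bsub>A\<^esub> (\<iota>\<^bsub>A\<^esub> (r \<odot>\<^bsub>A\<^esub> x) \<boxplus>\<^bsub>A\<^esub> ActZero A r) \<cdot>\<^bsub>A\<^esub> ActAdd A r x \<zero>\<^bsub>A\<^esub>
      = \<iota>\<^bsub>R\<^esub> r \<boxdot>\<^bsub>A\<^esub> RUnit A x"
proof -
  have "\<iota>\<^bsub>R\<^esub> r \<boxdot>\<^bsub>A\<^esub> RUnit A x = (\<iota>\<^bsub>R\<^esub> r \<boxdot>\<^bsub>A\<^esub> LUnit A x) \<cdot>\<^bsub>A\<^esub> (\<iota>\<^bsub>R\<^esub> r \<boxdot>\<^bsub>A\<^esub> Symm A x \<zero>\<^bsub>A\<^esub>)"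
    using o by (simp add: A.LUnit_Symm)
  also have "\<dots> = LUnit A (r \<odot>\<^bsub>A\<^esub> x) \<cdot>\<^bsub>A\<^esub> (ActZero A r \<boxplus>\<^bsub>A\<^esub> \<iota>\<^bsub>A\<^esub> (r \<odot>\<^bsub>A\<^esub> x))
      \<cdot>\<^bsub>A\<^esub> Symm A (r \<odot>\<^bsub>A\<^esub> x) (r \<odot>\<^bsub>A\<^esub> \<zero>\<^bsub>A\<^esub>) \<cdot>\<^bsub>A\<^esub> ActAdd A r x \<zero>\<^bsub>A\<^esub>"
    using o by (simp add: ActAdd_ActZero[symmetric] ActAdd_Symm)
  also have "\<dots> = LUnit A (r \<odot>\<^bsub>A\<^esub> x) \<cdot>\<^bsub>A\<^esub> Symm A (r \<odot>\<^bsub>A\<^esub> x) \<zero>\<^bsub>A\<^esub>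
      \<cdot>\<^bsub>A\<^esub> (\<iota>\<^bsub>A\<^esub> (r \<odot>\<^bsub>A\<^esub> x) \<boxplus>\<^bsub>A\<^esub> ActZero A r) \<cdot>\<^bsub>A\<^esub> ActAdd A r x \<zero>\<^bsub>A\<^esub>"
    using A.Comp_eq_extend[OF A.Symm_nat[of "\<iota>\<^bsub>A\<^esub> (r \<odot>\<^bsub>A\<^esub> x)" "ActZero A r"], of "ActAdd A r x \<zero>\<^bsub>A\<^esub>"] o by simp
  also have "\<dots> = RUnit A (r \<odot>\<^bsub>A\<^esub> x) \<cdot>\<^bsub>A\<^esub> (\<iota>\<^bsub>A\<^esub> (r \<odot>\<^bsub>A\<^esub> x) \<boxplus>\<^bsub>A\<^esub> ActZero A r) \<cdot>\<^bsub>A\<^esub> ActAdd A r x \<zero>\<^bsub>A\<^esub>"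
    using o by (simp add: A.LUnit_Symm[symmetric])
  finally show ?thesis ..
qed

end

text \<open>The assumptions are those of \<open>two_module_hom\<close>; the target is made the implicit structure, so that
  unindexed operations are those of \<open>B\<close>.\<close>

locale module_hom = two_module_hom R A B F
  for R :: "('r, 's) ring_data" and A :: "('r, 's, 'o, 'm) mod_data"
    and B :: "('r, 's, 'p, 'q) mod_data" (structure) and F

context module_hom
begin

lemma OMap_Obj' [simp]: "x \<in> Obj A \<Longrightarrow> OMap F x \<in> Obj B"
  by (rule OMap_Obj)

lemma AMap_type [simp]:
  assumes "f \<in> Arr A"
  shows "AMap F f \<in> Arr B" "Src B (AMap F f) = OMap F (Src A f)" "Tgt B (AMap F f) = OMap F (Tgt A f)"
  using AMap_in_hom[OF A.A.in_hom_self[OF assms]] by (auto simp: in_hom_def)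

declare AMap_Ide [simp]

lemma AMap_Comp' [simp]:
  "f \<in> Arr A \<Longrightarrow> g \<in> Arr A \<Longrightarrow> Src A g = Tgt A f \<Longrightarrow> AMap F (g \<cdot>\<^bsub>A\<^esub> f) = AMap F g \<cdot> AMap F f"
  by (intro AMap_Comp A.A.in_homI) auto

lemma AMap_Inv [simp]: "f \<in> Arr A \<Longrightarrow> AMap F (Inv A f) = Inv B (AMap F f)"
  by (rule B.A.Inv_unique[symmetric]) (auto simp flip: AMap_Comp')

lemma AddIso_type [simp]:
  assumes "x \<in> Obj A" "y \<in> Obj A"
  shows "AddIso F x y \<in> Arr B" "Src B (AddIso F x y) = OMap F (x \<oplus>\<^bsub>A\<^esub> y)"
    "Tgt B (AddIso F x y) = OMap F x \<oplus> OMap F y"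
  using AddIso_in_hom[OF assms] by (auto simp: in_hom_def)

lemma ZeroIso_type [simp]:
  shows "ZeroIso F \<in> Arr B" "Src B (ZeroIso F) = OMap F \<zero>\<^bsub>A\<^esub>" "Tgt B (ZeroIso F) = \<zero>"
  using ZeroIso_in_hom by (auto simp: in_hom_def)

lemma ActIso_type [simp]:
  assumes "r \<in> Obj R" "x \<in> Obj A"
  shows "ActIso F r x \<in> Arr B" "Src B (ActIso F r x) = OMap F (r \<odot>\<^bsub>A\<^esub> x)"
    "Tgt B (ActIso F r x) = r \<odot> OMap F x"
  using ActIso_in_hom[OF assms] by (auto simp: in_hom_def)

lemma AddIso_nat:
  assumes "f \<in> Arr A" "g \<in> Arr A"
  shows "AddIso F (Tgt A f) (Tgt A g) \<cdot> AMap F (f \<boxplus>\<^bsub>A\<^esub> g)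
    = (AMap F f \<boxplus> AMap F g) \<cdot> AddIso F (Src A f) (Src A g)"
  using assms by (intro AddIso_natural A.A.in_homI) auto

lemma AMap_AddA:
  assumes "f \<in> Arr A" "g \<in> Arr A"
  shows "AMap F (f \<boxplus>\<^bsub>A\<^esub> g) = Inv B (AddIso F (Tgt A f) (Tgt A g))
    \<cdot> (AMap F f \<boxplus> AMap F g) \<cdot> AddIso F (Src A f) (Src A g)"
  using assms by (simp add: AddIso_nat[symmetric])

lemma ActIso_nat:
  assumes "r \<in> Obj R" "f \<in> Arr A"
  shows "ActIso F r (Tgt A f) \<cdot> AMap F (\<iota>\<^bsub>R\<^esub> r \<boxdot>\<^bsub>A\<^esub> f)
    = (\<iota>\<^bsub>R\<^esub> r \<boxdot> AMap F f) \<cdot> ActIso F r (Src A f)"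
  using assms by (intro ActIso_natural A.A.in_homI A.R.in_homI) auto

lemma AddIso_ZeroIso_right:
  assumes o: "x \<in> Obj A"
  shows "RUnit B (OMap F x) \<cdot> (\<iota> (OMap F x) \<boxplus> ZeroIso F) \<cdot> AddIso F x \<zero>\<^bsub>A\<^esub>
      = AMap F (RUnit A x)"
proof -
  have "AMap F (RUnit A x) = AMap F (LUnit A x) \<cdot> AMap F (Symm A x \<zero>\<^bsub>A\<^esub>)"
    using o by (simp add: A.A.LUnit_Symm[symmetric])
  also have "\<dots> = LUnit B (OMap F x) \<cdot> (ZeroIso F \<boxplus> \<iota> (OMap F x))
      \<cdot> Symm B (OMap F x) (OMap F \<zero>\<^bsub>A\<^esub>) \<cdot> AddIso F x \<zero>\<^bsub>A\<^esub>"
    using o by (simp add: AddIso_ZeroIso[symmetric] AddIso_Symm)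
  also have "\<dots> = LUnit B (OMap F x) \<cdot> Symm B (OMap F x) \<zero>
      \<cdot> (\<iota> (OMap F x) \<boxplus> ZeroIso F) \<cdot> AddIso F x \<zero>\<^bsub>A\<^esub>"
    using B.A.Comp_eq_extend[OF B.A.Symm_nat[of "\<iota> (OMap F x)" "ZeroIso F"], of "AddIso F x \<zero>\<^bsub>A\<^esub>"] o by simp
  also have "\<dots> = RUnit B (OMap F x) \<cdot> (\<iota> (OMap F x) \<boxplus> ZeroIso F) \<cdot> AddIso F x \<zero>\<^bsub>A\<^esub>"
    using o by (simp add: B.A.LUnit_Symm[symmetric])
  finally show ?thesis ..
qed

text \<open>A homomorphism respects shuffles because it respects associativity and symmetry.\<close>

lemma AddIso_Shuffle:
  assumes o: "x \<in> Obj A" "y \<in> Obj A" "z \<in> Obj A"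
  shows "(AddIso F x z \<boxplus> \<iota> (OMap F y)) \<cdot> AddIso F (x \<oplus>\<^bsub>A\<^esub> z) y \<cdot> AMap F (A.A.Shuffle x y z)
    = B.A.Shuffle (OMap F x) (OMap F y) (OMap F z) \<cdot> (AddIso F x y \<boxplus> \<iota> (OMap F z)) \<cdot> AddIso F (x \<oplus>\<^bsub>A\<^esub> y) z"
    (is "?l = ?r")
proof -
  let ?x = "OMap F x" and ?y = "OMap F y" and ?z = "OMap F z"
  have n: "AddIso F x (z \<oplus>\<^bsub>A\<^esub> y) \<cdot> AMap F (\<iota>\<^bsub>A\<^esub> x \<boxplus>\<^bsub>A\<^esub> Symm A y z)
     = (\<iota> ?x \<boxplus> AMap F (Symm A y z)) \<cdot> AddIso F x (y \<oplus>\<^bsub>A\<^esub> z)"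
    using AddIso_nat[of "\<iota>\<^bsub>A\<^esub> x" "Symm A y z"] o by simp
  have c: "(AddIso F x z \<boxplus> \<iota> ?y) \<cdot> AddIso F (x \<oplus>\<^bsub>A\<^esub> z) y \<cdot> AMap F (Inv A (Assoc A x z y))
     = Inv B (Assoc B ?x ?z ?y) \<cdot> (\<iota> ?x \<boxplus> AddIso F z y) \<cdot> AddIso F x (z \<oplus>\<^bsub>A\<^esub> y)"
    by (rule B.A.Comp_cancel_left[of "Assoc B ?x ?z ?y"], rule B.A.Comp_cancel_right[where f = "AMap F (Assoc A x z y)"])
      (use o in \<open>simp_all add: AddIso_Assoc\<close>)
  have "?l = ((AddIso F x z \<boxplus> \<iota> ?y) \<cdot> AddIso F (x \<oplus>\<^bsub>A\<^esub> z) y \<cdot> AMap F (Inv A (Assoc A x z y)))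
      \<cdot> AMap F (\<iota>\<^bsub>A\<^esub> x \<boxplus>\<^bsub>A\<^esub> Symm A y z) \<cdot> AMap F (Assoc A x y z)"
    using o by (simp add: A.A.Shuffle_def)
  also have "\<dots> = Inv B (Assoc B ?x ?z ?y) \<cdot> (\<iota> ?x \<boxplus> AddIso F z y)
      \<cdot> (AddIso F x (z \<oplus>\<^bsub>A\<^esub> y) \<cdot> AMap F (\<iota>\<^bsub>A\<^esub> x \<boxplus>\<^bsub>A\<^esub> Symm A y z)) \<cdot> AMap F (Assoc A x y z)"
    unfolding c using o by simp
  also have "\<dots> = Inv B (Assoc B ?x ?z ?y) \<cdot> (\<iota> ?x \<boxplus> Symm B ?y ?z)
      \<cdot> ((\<iota> ?x \<boxplus> AddIso F y z) \<cdot> AddIso F x (y \<oplus>\<^bsub>A\<^esub> z) \<cdot> AMap F (Assoc A x y z))"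
    unfolding n using o by (simp add: AddIso_Symm)
  also have "\<dots> = ?r"
    unfolding AddIso_Assoc[OF o, symmetric] using o by (simp add: B.A.Shuffle_def)
  finally show ?thesis .
qed

end

section \<open>Arrows absorbed by a vanishing composite\<close>

text \<open>Two consecutive differentials of a complex. In the arrows of the cohomology at \<open>M\<close>, the first components of
  representatives are objects of \<open>X\<close>, and the objects of \<open>Y\<close> serve to identify representatives.\<close>

locale null_sequence = D: module_hom R Y X D + L: module_hom R X M L
  for R :: "('r, 's) ring_data" and Y :: "('r, 's, 'y, 'yy) mod_data"
    and X :: "('r, 's, 'x, 'xx) mod_data" and M :: "('r, 's, 'o, 'm) mod_data" (structure) and D L +
  fixes \<nu> :: "'y \<Rightarrow> 'm"
  assumes null: "two_morphism R Y M (comp_hom M L D) (zero_hom M) \<nu>"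
begin

lemma null_type [simp]:
  assumes "y \<in> Obj Y"
  shows "\<nu> y \<in> Arr M" "Src M (\<nu> y) = OMap L (OMap D y)" "Tgt M (\<nu> y) = \<zero>"
  using null assms by (auto simp: two_morphism_def comp_hom_def zero_hom_def in_hom_def)

lemma null_nat:
  assumes "g \<in> Arr Y" shows "\<nu> (Tgt Y g) \<cdot> AMap L (AMap D g) = \<nu> (Src Y g)"
  using null assms by (auto simp: two_morphism_def comp_hom_def zero_hom_def)

lemma null_AddO:
  assumes o: "y \<in> Obj Y" "z \<in> Obj Y"
  shows "\<nu> (y \<oplus>\<^bsub>Y\<^esub> z) = LUnit M \<zero> \<cdot> (\<nu> y \<boxplus> \<nu> z) \<cdot> AddIso L (OMap D y) (OMap D z)
    \<cdot> AMap L (AddIso D y z)"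
proof -
  have "Inv M (LUnit M \<zero>) \<cdot> \<nu> (y \<oplus>\<^bsub>Y\<^esub> z) = (\<nu> y \<boxplus> \<nu> z) \<cdot> AddIso L (OMap D y) (OMap D z)
    \<cdot> AMap L (AddIso D y z)"
    using null o by (auto simp: two_morphism_def comp_hom_def zero_hom_def)
  from L.B.A.Inv_shift_left[OF this] show ?thesis using o by simp
qed

lemma null_Zero: "\<nu> \<zero>\<^bsub>Y\<^esub> = ZeroIso L \<cdot> AMap L (ZeroIso D)"
  using null by (auto simp: two_morphism_def comp_hom_def zero_hom_def)

lemma null_ActO:
  assumes o: "r \<in> Obj R" "y \<in> Obj Y"
  shows "\<nu> (r \<odot>\<^bsub>Y\<^esub> y) = ActZero M r \<cdot> (\<iota>\<^bsub>R\<^esub> r \<boxdot> \<nu> y) \<cdot> ActIso L r (OMap D y)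
    \<cdot> AMap L (ActIso D r y)"
proof -
  have "Inv M (ActZero M r) \<cdot> \<nu> (r \<odot>\<^bsub>Y\<^esub> y) = (\<iota>\<^bsub>R\<^esub> r \<boxdot> \<nu> y) \<cdot> ActIso L r (OMap D y)
    \<cdot> AMap L (ActIso D r y)"
    using null o by (auto simp: two_morphism_def comp_hom_def zero_hom_def)
  from L.B.A.Inv_shift_left[OF this] show ?thesis using o by simp
qed

text \<open>The arrow from \<open>L (D y \<oplus> x)\<close> to \<open>L x\<close> that discards the summand \<open>L (D y)\<close> along its trivialisation.\<close>

definition absorb :: "'y \<Rightarrow> 'x \<Rightarrow> 'm"
  where "absorb y x = LUnit M (OMap L x) \<cdot> (\<nu> y \<boxplus> \<iota> (OMap L x)) \<cdot> AddIso L (OMap D y) x"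

lemma absorb_type [simp]:
  assumes "y \<in> Obj Y" "x \<in> Obj X"
  shows "absorb y x \<in> Arr M" "Src M (absorb y x) = OMap L (OMap D y \<oplus>\<^bsub>X\<^esub> x)" "Tgt M (absorb y x) = OMap L x"
  using assms by (simp_all add: absorb_def)

text \<open>The trivialisation of \<open>L (D \<zero>)\<close> is the canonical one, so discarding it is the image of an arrow of \<open>X\<close>.\<close>

lemma absorb_Zero:
  assumes o: "x \<in> Obj X"
  shows "absorb \<zero>\<^bsub>Y\<^esub> x = AMap L (LUnit X x \<cdot>\<^bsub>X\<^esub> (ZeroIso D \<boxplus>\<^bsub>X\<^esub> \<iota>\<^bsub>X\<^esub> x))"
  using o L.AddIso_nat[of "ZeroIso D" "\<iota>\<^bsub>X\<^esub> x"] 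
  by (simp add: absorb_def null_Zero L.AddIso_ZeroIso[symmetric])

lemma absorb_nat:
  assumes a: "g \<in> Arr Y" "f \<in> Arr X"
  shows "absorb (Tgt Y g) (Tgt X f) \<cdot> AMap L (AMap D g \<boxplus>\<^bsub>X\<^esub> f) = AMap L f \<cdot> absorb (Src Y g) (Src X f)"
proof -
  have "absorb (Tgt Y g) (Tgt X f) \<cdot> AMap L (AMap D g \<boxplus>\<^bsub>X\<^esub> f)
    = LUnit M (OMap L (Tgt X f)) \<cdot> (\<nu> (Src Y g) \<boxplus> AMap L f) \<cdot> AddIso L (OMap D (Src Y g)) (Src X f)"
    using a L.AddIso_nat[of "AMap D g" f] by (simp add: absorb_def null_nat)
  also have "\<dots> = (LUnit M (OMap L (Tgt X f)) \<cdot> (\<iota> \<zero> \<boxplus> AMap L f)) \<cdot> (\<nu> (Src Y g) \<boxplus> \<iota> (OMap L (Src X f)))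
      \<cdot> AddIso L (OMap D (Src Y g)) (Src X f)"
    using a by simp
  also have "\<dots> = AMap L f \<cdot> absorb (Src Y g) (Src X f)"
    using a L.B.A.LUnit_nat[of "AMap L f"] by (simp add: absorb_def)
  finally show ?thesis .
qed

text \<open>As \<open>\<nu>\<close> is monoidal, discarding two summands one after the other amounts to discarding their sum.\<close>

lemma absorb_absorb:
  assumes o: "y \<in> Obj Y" "z \<in> Obj Y" "x \<in> Obj X"
  shows "absorb y x \<cdot> absorb z (OMap D y \<oplus>\<^bsub>X\<^esub> x) = absorb (z \<oplus>\<^bsub>Y\<^esub> y) x
    \<cdot> AMap L ((Inv X (AddIso D z y) \<boxplus>\<^bsub>X\<^esub> \<iota>\<^bsub>X\<^esub> x) \<cdot>\<^bsub>X\<^esub> Inv X (Assoc X (OMap D z) (OMap D y) x))"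
    (is "?l = ?r")
proof -
  let ?dy = "OMap D y" and ?dz = "OMap D z" and ?lx = "OMap L x"
  let ?w = "(\<nu> z \<boxplus> ((\<nu> y \<boxplus> \<iota> ?lx) \<cdot> AddIso L ?dy x)) \<cdot> AddIso L ?dz (?dy \<oplus>\<^bsub>X\<^esub> x)"
  have "?l = LUnit M ?lx \<cdot> (((\<nu> y \<boxplus> \<iota> ?lx) \<cdot> AddIso L ?dy x) \<cdot> LUnit M (OMap L (?dy \<oplus>\<^bsub>X\<^esub> x)))
     \<cdot> (\<nu> z \<boxplus> \<iota> (OMap L (?dy \<oplus>\<^bsub>X\<^esub> x))) \<cdot> AddIso L ?dz (?dy \<oplus>\<^bsub>X\<^esub> x)"
    using o by (simp add: absorb_def)
  also have "((\<nu> y \<boxplus> \<iota> ?lx) \<cdot> AddIso L ?dy x) \<cdot> LUnit M (OMap L (?dy \<oplus>\<^bsub>X\<^esub> x))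
     = LUnit M (\<zero> \<oplus> ?lx) \<cdot> (\<iota> \<zero> \<boxplus> ((\<nu> y \<boxplus> \<iota> ?lx) \<cdot> AddIso L ?dy x))"
    using o L.B.A.LUnit_nat[of "(\<nu> y \<boxplus> \<iota> ?lx) \<cdot> AddIso L ?dy x"] by simp
  finally have l: "?l = LUnit M ?lx \<cdot> LUnit M (\<zero> \<oplus> ?lx) \<cdot> ?w"
    using o by simp
  have "?r = LUnit M ?lx \<cdot> (\<nu> (z \<oplus>\<^bsub>Y\<^esub> y) \<boxplus> \<iota> ?lx)
     \<cdot> (AddIso L (OMap D (z \<oplus>\<^bsub>Y\<^esub> y)) x \<cdot> AMap L (Inv X (AddIso D z y) \<boxplus>\<^bsub>X\<^esub> \<iota>\<^bsub>X\<^esub> x))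
     \<cdot> AMap L (Inv X (Assoc X ?dz ?dy x))"
    using o by (simp add: absorb_def del: L.AMap_Inv L.B.A.AddA_merge_pre)
  also have "AddIso L (OMap D (z \<oplus>\<^bsub>Y\<^esub> y)) x \<cdot> AMap L (Inv X (AddIso D z y) \<boxplus>\<^bsub>X\<^esub> \<iota>\<^bsub>X\<^esub> x)
     = (Inv M (AMap L (AddIso D z y)) \<boxplus> \<iota> ?lx) \<cdot> AddIso L (?dz \<oplus>\<^bsub>X\<^esub> ?dy) x"
    using o L.AddIso_nat[of "Inv X (AddIso D z y)" "\<iota>\<^bsub>X\<^esub> x"] by simp
  finally have "?r = LUnit M ?lx \<cdot> (LUnit M \<zero> \<boxplus> \<iota> ?lx) \<cdot> ((\<nu> z \<boxplus> \<nu> y) \<boxplus> \<iota> ?lx)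
     \<cdot> (AddIso L ?dz ?dy \<boxplus> \<iota> ?lx) \<cdot> AddIso L (?dz \<oplus>\<^bsub>X\<^esub> ?dy) x \<cdot> Inv M (AMap L (Assoc X ?dz ?dy x))"
    using o by (simp add: null_AddO)
  also have "(AddIso L ?dz ?dy \<boxplus> \<iota> ?lx) \<cdot> AddIso L (?dz \<oplus>\<^bsub>X\<^esub> ?dy) x \<cdot> Inv M (AMap L (Assoc X ?dz ?dy x))
     = Inv M (Assoc M (OMap L ?dz) (OMap L ?dy) ?lx) \<cdot> (\<iota> (OMap L ?dz) \<boxplus> AddIso L ?dy x)
       \<cdot> AddIso L ?dz (?dy \<oplus>\<^bsub>X\<^esub> x)"
    by (rule L.B.A.Comp_cancel_left[of "Assoc M (OMap L ?dz) (OMap L ?dy) ?lx"],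
        rule L.B.A.Comp_cancel_right[where f = "AMap L (Assoc X ?dz ?dy x)"])
      (use o in \<open>simp_all add: L.AddIso_Assoc\<close>)
  finally have "?r = LUnit M ?lx \<cdot> (LUnit M \<zero> \<boxplus> \<iota> ?lx)
     \<cdot> (((\<nu> z \<boxplus> \<nu> y) \<boxplus> \<iota> ?lx) \<cdot> Inv M (Assoc M (OMap L ?dz) (OMap L ?dy) ?lx))
     \<cdot> (\<iota> (OMap L ?dz) \<boxplus> AddIso L ?dy x) \<cdot> AddIso L ?dz (?dy \<oplus>\<^bsub>X\<^esub> x)"
    using o by simp
  also have "((\<nu> z \<boxplus> \<nu> y) \<boxplus> \<iota> ?lx) \<cdot> Inv M (Assoc M (OMap L ?dz) (OMap L ?dy) ?lx)
     = Inv M (Assoc M \<zero> \<zero> ?lx) \<cdot> (\<nu> z \<boxplus> (\<nu> y \<boxplus> \<iota> ?lx))"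
    using o L.B.A.Inv_Assoc_nat[of "\<nu> z" "\<nu> y" "\<iota> ?lx"] by simp
  finally have "?r = LUnit M ?lx \<cdot> ((LUnit M \<zero> \<boxplus> \<iota> ?lx) \<cdot> Inv M (Assoc M \<zero> \<zero> ?lx)) \<cdot> ?w"
    using o by simp
  also have "(LUnit M \<zero> \<boxplus> \<iota> ?lx) \<cdot> Inv M (Assoc M \<zero> \<zero> ?lx) = LUnit M (\<zero> \<oplus> ?lx)"
    using o by (simp add: L.B.A.LUnit_Assoc[symmetric])
  finally show ?thesis using l by simp
qed

text \<open>A further summand \<open>z\<close> is not affected: both the constraint of \<open>L\<close> and the left unit are compatible
  with associativity.\<close>

lemma absorb_AddO:
  assumes o: "y \<in> Obj Y" "x \<in> Obj X" "z \<in> Obj X"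
  shows "AddIso L x z \<cdot> absorb y (x \<oplus>\<^bsub>X\<^esub> z) \<cdot> AMap L (Assoc X (OMap D y) x z)
    = (absorb y x \<boxplus> \<iota> (OMap L z)) \<cdot> AddIso L (OMap D y \<oplus>\<^bsub>X\<^esub> x) z" (is "?l = ?r")
proof -
  let ?d = "OMap D y" and ?lx = "OMap L x" and ?lz = "OMap L z"
  have "?l = (AddIso L x z \<cdot> LUnit M (OMap L (x \<oplus>\<^bsub>X\<^esub> z))) \<cdot> (\<nu> y \<boxplus> \<iota> (OMap L (x \<oplus>\<^bsub>X\<^esub> z)))
      \<cdot> AddIso L ?d (x \<oplus>\<^bsub>X\<^esub> z) \<cdot> AMap L (Assoc X ?d x z)"
    using o by (simp add: absorb_def)
  also have "AddIso L x z \<cdot> LUnit M (OMap L (x \<oplus>\<^bsub>X\<^esub> z)) = LUnit M (?lx \<oplus> ?lz) \<cdot> (\<iota> \<zero> \<boxplus> AddIso L x z)"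
    using o L.B.A.LUnit_nat[of "AddIso L x z"] by simp
  finally have "?l = LUnit M (?lx \<oplus> ?lz) \<cdot> (\<nu> y \<boxplus> \<iota> (?lx \<oplus> ?lz)) \<cdot> 
      ((\<iota> (OMap L ?d) \<boxplus> AddIso L x z) \<cdot> AddIso L ?d (x \<oplus>\<^bsub>X\<^esub> z) \<cdot> AMap L (Assoc X ?d x z))"
    using o by simp
  also have "\<dots> = LUnit M (?lx \<oplus> ?lz) \<cdot> ((\<nu> y \<boxplus> (\<iota> ?lx \<boxplus> \<iota> ?lz)) \<cdot> Assoc M (OMap L ?d) ?lx ?lz)
      \<cdot> (AddIso L ?d x \<boxplus> \<iota> ?lz) \<cdot> AddIso L (?d \<oplus>\<^bsub>X\<^esub> x) z"
    using o by (simp add: L.AddIso_Assoc[symmetric])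
  also have "(\<nu> y \<boxplus> (\<iota> ?lx \<boxplus> \<iota> ?lz)) \<cdot> Assoc M (OMap L ?d) ?lx ?lz
      = Assoc M \<zero> ?lx ?lz \<cdot> ((\<nu> y \<boxplus> \<iota> ?lx) \<boxplus> \<iota> ?lz)"
    using o L.B.A.Assoc_nat[of "\<nu> y" "\<iota> ?lx" "\<iota> ?lz"] by simp
  finally have "?l = (LUnit M (?lx \<oplus> ?lz) \<cdot> Assoc M \<zero> ?lx ?lz) \<cdot> ((\<nu> y \<boxplus> \<iota> ?lx) \<boxplus> \<iota> ?lz)
      \<cdot> (AddIso L ?d x \<boxplus> \<iota> ?lz) \<cdot> AddIso L (?d \<oplus>\<^bsub>X\<^esub> x) z"
    using o by simp
  also have "LUnit M (?lx \<oplus> ?lz) \<cdot> Assoc M \<zero> ?lx ?lz = LUnit M ?lx \<boxplus> \<iota> ?lz"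
    using o by (simp add: L.B.A.LUnit_Assoc)
  finally show ?thesis using o by (simp add: absorb_def)
qed

text \<open>As \<open>\<nu>\<close> is compatible with the action, so is discarding a summand.\<close>

lemma absorb_ActO:
  assumes o: "r \<in> Obj R" "y \<in> Obj Y" "x \<in> Obj X"
  shows "(\<iota>\<^bsub>R\<^esub> r \<boxdot> absorb y x) \<cdot> ActIso L r (OMap D y \<oplus>\<^bsub>X\<^esub> x)
    = ActIso L r x \<cdot> absorb (r \<odot>\<^bsub>Y\<^esub> y) (r \<odot>\<^bsub>X\<^esub> x)
      \<cdot> AMap L ((Inv X (ActIso D r y) \<boxplus>\<^bsub>X\<^esub> \<iota>\<^bsub>X\<^esub> (r \<odot>\<^bsub>X\<^esub> x)) \<cdot>\<^bsub>X\<^esub> ActAdd X r (OMap D y) x)"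
    (is "?l = ?r")
proof -
  let ?d = "OMap D y" and ?lx = "OMap L x" and ?rx = "r \<odot>\<^bsub>X\<^esub> x" and ?rl = "r \<odot> OMap L x"
  let ?i = "\<iota>\<^bsub>R\<^esub> r"
  let ?aa = "ActAdd M r (OMap L ?d) ?lx" and ?a0 = "ActAdd M r \<zero> ?lx"
  have c: "?i \<boxdot> LUnit M ?lx = LUnit M ?rl \<cdot> (ActZero M r \<boxplus> \<iota> ?rl) \<cdot> ?a0"
    using o by (simp add: L.B.ActAdd_ActZero)
  have n: "?a0 \<cdot> (?i \<boxdot> (\<nu> y \<boxplus> \<iota> ?lx)) = ((?i \<boxdot> \<nu> y) \<boxplus> \<iota> ?rl) \<cdot> ?aa"
    using o L.B.ActAdd_nat[of r "\<nu> y" "\<iota> ?lx"] by simp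
  have "?l = (?i \<boxdot> LUnit M ?lx) \<cdot> (?i \<boxdot> (\<nu> y \<boxplus> \<iota> ?lx)) \<cdot> (?i \<boxdot> AddIso L ?d x)
      \<cdot> ActIso L r (?d \<oplus>\<^bsub>X\<^esub> x)"
    using o by (simp add: absorb_def)
  also have "\<dots> = LUnit M ?rl \<cdot> (ActZero M r \<boxplus> \<iota> ?rl) \<cdot> (?a0 \<cdot> (?i \<boxdot> (\<nu> y \<boxplus> \<iota> ?lx)))
      \<cdot> (?i \<boxdot> AddIso L ?d x) \<cdot> ActIso L r (?d \<oplus>\<^bsub>X\<^esub> x)"
    unfolding c using o by simp
  also have "\<dots> = LUnit M ?rl \<cdot> (ActZero M r \<boxplus> \<iota> ?rl) \<cdot> ((?i \<boxdot> \<nu> y) \<boxplus> \<iota> ?rl)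
      \<cdot> (?aa \<cdot> (?i \<boxdot> AddIso L ?d x) \<cdot> ActIso L r (?d \<oplus>\<^bsub>X\<^esub> x))"
    unfolding n using o by simp
  also have "\<dots> = LUnit M ?rl \<cdot> ((ActZero M r \<cdot> (?i \<boxdot> \<nu> y) \<cdot> ActIso L r ?d) \<boxplus> ActIso L r x)
      \<cdot> AddIso L (r \<odot>\<^bsub>X\<^esub> ?d) ?rx \<cdot> AMap L (ActAdd X r ?d x)"
    using o by (simp add: L.ActIso_ActAdd[symmetric])
  also have "ActZero M r \<cdot> (?i \<boxdot> \<nu> y) \<cdot> ActIso L r ?d = \<nu> (r \<odot>\<^bsub>Y\<^esub> y) \<cdot> AMap L (Inv X (ActIso D r y))"
    using o by (simp add: null_ActO)
  also have "LUnit M ?rl \<cdot> ((\<nu> (r \<odot>\<^bsub>Y\<^esub> y) \<cdot> AMap L (Inv X (ActIso D r y))) \<boxplus> ActIso L r x)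
      \<cdot> AddIso L (r \<odot>\<^bsub>X\<^esub> ?d) ?rx \<cdot> AMap L (ActAdd X r ?d x)
    = (LUnit M ?rl \<cdot> (\<iota> \<zero> \<boxplus> ActIso L r x)) \<cdot> (\<nu> (r \<odot>\<^bsub>Y\<^esub> y) \<boxplus> \<iota> (OMap L ?rx))
      \<cdot> ((AMap L (Inv X (ActIso D r y)) \<boxplus> \<iota> (OMap L ?rx)) \<cdot> AddIso L (r \<odot>\<^bsub>X\<^esub> ?d) ?rx)
      \<cdot> AMap L (ActAdd X r ?d x)"
    using o by simp
  also have "(AMap L (Inv X (ActIso D r y)) \<boxplus> \<iota> (OMap L ?rx)) \<cdot> AddIso L (r \<odot>\<^bsub>X\<^esub> ?d) ?rx
     = AddIso L (OMap D (r \<odot>\<^bsub>Y\<^esub> y)) ?rx \<cdot> AMap L (Inv X (ActIso D r y) \<boxplus>\<^bsub>X\<^esub> \<iota>\<^bsub>X\<^esub> ?rx)"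
    using o L.AddIso_nat[of "Inv X (ActIso D r y)" "\<iota>\<^bsub>X\<^esub> ?rx"] by simp
  also have "LUnit M ?rl \<cdot> (\<iota> \<zero> \<boxplus> ActIso L r x) = ActIso L r x \<cdot> LUnit M (OMap L ?rx)"
    using o L.B.A.LUnit_nat[of "ActIso L r x"] by simp
  finally show ?thesis using o by (simp add: absorb_def)
qed

text \<open>The arrows by which equivalent representatives differ. The closure properties below are what makes
  the operations on classes well defined.\<close>

definition inessential :: "'m \<Rightarrow> 'x \<Rightarrow> 'x \<Rightarrow> bool"
  where "inessential u x x' \<longleftrightarrow> x' \<in> Obj X \<and>
    (\<exists>y\<in>Obj Y. \<exists>f\<in>Arr X. Src X f = x \<and> Tgt X f = OMap D y \<oplus>\<^bsub>X\<^esub> x' \<and> u = absorb y x' \<cdot> AMap L f)"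

lemma inessentialD:
  assumes "inessential u x x'"
  shows "x \<in> Obj X" "x' \<in> Obj X" "u \<in> Arr M" "Src M u = OMap L x" "Tgt M u = OMap L x'"
  using assms by (auto simp: inessential_def)

lemma inessential_absorb: "y \<in> Obj Y \<Longrightarrow> x \<in> Obj X \<Longrightarrow> inessential (absorb y x) (OMap D y \<oplus>\<^bsub>X\<^esub> x) x"
  unfolding inessential_def
  by (intro conjI bexI[of _ y] bexI[of _ "\<iota>\<^bsub>X\<^esub> (OMap D y \<oplus>\<^bsub>X\<^esub> x)"]) auto

text \<open>The witness has \<open>y = \<zero>\<close>, inserted by the inverse of the left unit.\<close>

lemma inessential_AMap:
  assumes a: "f \<in> Arr X" shows "inessential (AMap L f) (Src X f) (Tgt X f)"
proof -
  let ?g = "(Inv X (ZeroIso D) \<boxplus>\<^bsub>X\<^esub> \<iota>\<^bsub>X\<^esub> (Tgt X f)) \<cdot>\<^bsub>X\<^esub> Inv X (LUnit X (Tgt X f)) \<cdot>\<^bsub>X\<^esub> f"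
  have "(LUnit X (Tgt X f) \<cdot>\<^bsub>X\<^esub> (ZeroIso D \<boxplus>\<^bsub>X\<^esub> \<iota>\<^bsub>X\<^esub> (Tgt X f))) \<cdot>\<^bsub>X\<^esub> ?g = f"
    using a by simp
  then have "AMap L f = AMap L (LUnit X (Tgt X f) \<cdot>\<^bsub>X\<^esub> (ZeroIso D \<boxplus>\<^bsub>X\<^esub> \<iota>\<^bsub>X\<^esub> (Tgt X f))) \<cdot> AMap L ?g"
    using a L.AMap_Comp'[of ?g "LUnit X (Tgt X f) \<cdot>\<^bsub>X\<^esub> (ZeroIso D \<boxplus>\<^bsub>X\<^esub> \<iota>\<^bsub>X\<^esub> (Tgt X f))"]
    by (simp only: D.B.A.Comp_type D.B.A.AddA_type D.B.A.LUnit_type D.B.A.Inv_type D.ZeroIso_type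
        D.B.A.Ide_type D.B.A.Src_Tgt_Obj D.B.A.Zero_AddO_Obj D.OMap_Obj' D.A.A.Zero_AddO_Obj)
  also have "\<dots> = absorb \<zero>\<^bsub>Y\<^esub> (Tgt X f) \<cdot> AMap L ?g"
    using a by (simp only: absorb_Zero D.B.A.Src_Tgt_Obj)
  finally show ?thesis
    unfolding inessential_def using a by (intro conjI bexI[of _ "\<zero>\<^bsub>Y\<^esub>"] bexI[of _ ?g]) auto
qed

text \<open>The arrow of \<open>X\<close> in the second factor is moved past the first absorption by naturality; then the two
  absorptions are merged.\<close>

lemma inessential_Comp:
  assumes "inessential u x x'" "inessential v x' x''" shows "inessential (v \<cdot> u) x x''"
proof -
  obtain y f where f: "y \<in> Obj Y" "f \<in> Arr X" "Src X f = x" "Tgt X f = OMap D y \<oplus>\<^bsub>X\<^esub> x'" "u = absorb y x' \<cdot> AMap L f"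
    using assms(1) by (auto simp: inessential_def)
  obtain z g where g: "z \<in> Obj Y" "g \<in> Arr X" "Src X g = x'" "Tgt X g = OMap D z \<oplus>\<^bsub>X\<^esub> x''" "v = absorb z x'' \<cdot> AMap L g"
    using assms(2) by (auto simp: inessential_def)
  have o: "x' \<in> Obj X" "x'' \<in> Obj X" using assms inessentialD by blast+
  let ?h = "(Inv X (AddIso D y z) \<boxplus>\<^bsub>X\<^esub> \<iota>\<^bsub>X\<^esub> x'') \<cdot>\<^bsub>X\<^esub> Inv X (Assoc X (OMap D y) (OMap D z) x'')"
  let ?k = "\<iota>\<^bsub>X\<^esub> (OMap D y) \<boxplus>\<^bsub>X\<^esub> g"
  have "v \<cdot> u = absorb z x'' \<cdot> (AMap L g \<cdot> absorb y x') \<cdot> AMap L f"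
    using f g o by simp
  also have "AMap L g \<cdot> absorb y x' = absorb y (OMap D z \<oplus>\<^bsub>X\<^esub> x'') \<cdot> AMap L ?k"
    using absorb_nat[of "\<iota>\<^bsub>Y\<^esub> y" g] f g by simp
  also have "absorb z x'' \<cdot> (absorb y (OMap D z \<oplus>\<^bsub>X\<^esub> x'') \<cdot> AMap L ?k) \<cdot> AMap L f
    = (absorb z x'' \<cdot> absorb y (OMap D z \<oplus>\<^bsub>X\<^esub> x'')) \<cdot> AMap L ?k \<cdot> AMap L f"
    using f g o by simp
  also have "absorb z x'' \<cdot> absorb y (OMap D z \<oplus>\<^bsub>X\<^esub> x'') = absorb (y \<oplus>\<^bsub>Y\<^esub> z) x'' \<cdot> AMap L ?h"
    using f g o by (simp only: absorb_absorb)
  finally have "v \<cdot> u = absorb (y \<oplus>\<^bsub>Y\<^esub> z) x'' \<cdot> AMap L (?h \<cdot>\<^bsub>X\<^esub> ?k \<cdot>\<^bsub>X\<^esub> f)"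
    using f g o by simp
  then show ?thesis
    unfolding inessential_def using f g o
    by (intro conjI bexI[of _ "y \<oplus>\<^bsub>Y\<^esub> z"] bexI[of _ "?h \<cdot>\<^bsub>X\<^esub> ?k \<cdot>\<^bsub>X\<^esub> f"]) auto
qed

text \<open>If \<open>z\<close> is opposite to \<open>y\<close>, absorbing both amounts to absorbing \<open>\<zero>\<close>, which comes from \<open>X\<close>.
  So the inverse of the absorption of \<open>y\<close> is the absorption of \<open>z\<close>, up to the image of an arrow of \<open>X\<close>.\<close>

lemma inessential_Inv:
  assumes "inessential u x x'" shows "inessential (Inv M u) x' x"
proof -
  obtain y f where f: "y \<in> Obj Y" "f \<in> Arr X" "Src X f = x" "Tgt X f = OMap D y \<oplus>\<^bsub>X\<^esub> x'" "u = absorb y x' \<cdot> AMap L f"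
    using assms by (auto simp: inessential_def)
  have o: "x' \<in> Obj X" using assms inessentialD by blast
  obtain z e' where z: "z \<in> Obj Y" and e': "\<guillemotleft>e' : y \<oplus>\<^bsub>Y\<^esub> z \<rightarrow>\<^bsub>Y\<^esub> \<zero>\<^bsub>Y\<^esub>\<guillemotright>"
    using D.A.A.ex_opposite[OF f(1)] by blast
  define e where "e = e' \<cdot>\<^bsub>Y\<^esub> Symm Y z y"
  have e: "e \<in> Arr Y" "Src Y e = z \<oplus>\<^bsub>Y\<^esub> y" "Tgt Y e = \<zero>\<^bsub>Y\<^esub>"
    using e' f z by (auto simp: e_def in_hom_def)
  let ?h = "(Inv X (AddIso D z y) \<boxplus>\<^bsub>X\<^esub> \<iota>\<^bsub>X\<^esub> x') \<cdot>\<^bsub>X\<^esub> Inv X (Assoc X (OMap D z) (OMap D y) x')"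
  define g where "g = LUnit X x' \<cdot>\<^bsub>X\<^esub> (ZeroIso D \<boxplus>\<^bsub>X\<^esub> \<iota>\<^bsub>X\<^esub> x') \<cdot>\<^bsub>X\<^esub> (AMap D e \<boxplus>\<^bsub>X\<^esub> \<iota>\<^bsub>X\<^esub> x') \<cdot>\<^bsub>X\<^esub> ?h"
  have g: "g \<in> Arr X" "Src X g = OMap D z \<oplus>\<^bsub>X\<^esub> (OMap D y \<oplus>\<^bsub>X\<^esub> x')" "Tgt X g = x'"
    unfolding g_def using f z o e by simp_all
  have "absorb y x' \<cdot> absorb z (OMap D y \<oplus>\<^bsub>X\<^esub> x') = absorb (z \<oplus>\<^bsub>Y\<^esub> y) x' \<cdot> AMap L ?h"
    using f z o by (simp only: absorb_absorb)
  also have "absorb (z \<oplus>\<^bsub>Y\<^esub> y) x' = absorb \<zero>\<^bsub>Y\<^esub> x' \<cdot> AMap L (AMap D e \<boxplus>\<^bsub>X\<^esub> \<iota>\<^bsub>X\<^esub> x')"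
    using absorb_nat[of e "\<iota>\<^bsub>X\<^esub> x'"] e f z o by simp
  also have "(absorb \<zero>\<^bsub>Y\<^esub> x' \<cdot> AMap L (AMap D e \<boxplus>\<^bsub>X\<^esub> \<iota>\<^bsub>X\<^esub> x')) \<cdot> AMap L ?h = AMap L g"
    unfolding g_def using e f z o by (simp add: absorb_Zero del: D.B.A.AddA_merge_pre)
  finally have K: "absorb y x' \<cdot> absorb z (OMap D y \<oplus>\<^bsub>X\<^esub> x') = AMap L g" .
  have "absorb z (OMap D y \<oplus>\<^bsub>X\<^esub> x') = Inv M (absorb y x') \<cdot> AMap L g"
    using L.B.A.Inv_shift_left[OF K] f z o by simp
  then have "Inv M (absorb y x') = absorb z (OMap D y \<oplus>\<^bsub>X\<^esub> x') \<cdot> AMap L (Inv X g)"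
    using f z o g by simp
  moreover have "inessential (AMap L (Inv X g)) x' (OMap D z \<oplus>\<^bsub>X\<^esub> (OMap D y \<oplus>\<^bsub>X\<^esub> x'))"
    using inessential_AMap[of "Inv X g"] g by simp
  ultimately have "inessential (Inv M (absorb y x')) x' (OMap D y \<oplus>\<^bsub>X\<^esub> x')"
    using inessential_Comp[OF _ inessential_absorb[of z "OMap D y \<oplus>\<^bsub>X\<^esub> x'"]] z f o by simp
  moreover have "inessential (AMap L (Inv X f)) (OMap D y \<oplus>\<^bsub>X\<^esub> x') x"
    using inessential_AMap[of "Inv X f"] f by simp
  ultimately have "inessential (AMap L (Inv X f) \<cdot> Inv M (absorb y x')) x' x"
    by (rule inessential_Comp)
  then show ?thesis using f o by (simp add: L.B.A.Inv_Comp)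
qed

lemma inessential_AddA_left:
  assumes "inessential u x x'" "z \<in> Obj X"
  shows "inessential (Inv M (AddIso L x' z) \<cdot> (u \<boxplus> \<iota> (OMap L z)) \<cdot> AddIso L x z) (x \<oplus>\<^bsub>X\<^esub> z) (x' \<oplus>\<^bsub>X\<^esub> z)"
proof -
  obtain y f where f: "y \<in> Obj Y" "f \<in> Arr X" "Src X f = x" "Tgt X f = OMap D y \<oplus>\<^bsub>X\<^esub> x'" "u = absorb y x' \<cdot> AMap L f"
    using assms by (auto simp: inessential_def)
  have o: "x \<in> Obj X" "x' \<in> Obj X" using assms inessentialD by blast+
  let ?g = "Assoc X (OMap D y) x' z \<cdot>\<^bsub>X\<^esub> (f \<boxplus>\<^bsub>X\<^esub> \<iota>\<^bsub>X\<^esub> z)"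
  have "(u \<boxplus> \<iota> (OMap L z)) \<cdot> AddIso L x z
    = (absorb y x' \<boxplus> \<iota> (OMap L z)) \<cdot> (AMap L f \<boxplus> \<iota> (OMap L z)) \<cdot> AddIso L x z"
    using f o assms(2) by simp
  also have "(AMap L f \<boxplus> \<iota> (OMap L z)) \<cdot> AddIso L x z
     = AddIso L (OMap D y \<oplus>\<^bsub>X\<^esub> x') z \<cdot> AMap L (f \<boxplus>\<^bsub>X\<^esub> \<iota>\<^bsub>X\<^esub> z)"
    using L.AddIso_nat[of f "\<iota>\<^bsub>X\<^esub> z"] f assms(2) by simp
  also have "(absorb y x' \<boxplus> \<iota> (OMap L z)) \<cdot> AddIso L (OMap D y \<oplus>\<^bsub>X\<^esub> x') z \<cdot> AMap L (f \<boxplus>\<^bsub>X\<^esub> \<iota>\<^bsub>X\<^esub> z)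
    = AddIso L x' z \<cdot> absorb y (x' \<oplus>\<^bsub>X\<^esub> z) \<cdot> AMap L ?g"
    using L.B.A.Comp_eq_extend[OF absorb_AddO[OF f(1) o(2) assms(2), symmetric], of "AMap L (f \<boxplus>\<^bsub>X\<^esub> \<iota>\<^bsub>X\<^esub> z)"] f o assms(2) by simp
  finally have "Inv M (AddIso L x' z) \<cdot> (u \<boxplus> \<iota> (OMap L z)) \<cdot> AddIso L x z = absorb y (x' \<oplus>\<^bsub>X\<^esub> z) \<cdot> AMap L ?g"
    using f o assms(2) by simp
  then show ?thesis
    unfolding inessential_def using f o assms(2) by (intro conjI bexI[of _ y] bexI[of _ ?g]) auto
qed

text \<open>Conjugating by the symmetry exchanges the two summands.\<close>

lemma inessential_AddA_right:
  assumes u: "inessential u x x'" and z: "z \<in> Obj X"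
  shows "inessential (Inv M (AddIso L z x') \<cdot> (\<iota> (OMap L z) \<boxplus> u) \<cdot> AddIso L z x) (z \<oplus>\<^bsub>X\<^esub> x) (z \<oplus>\<^bsub>X\<^esub> x')"
proof -
  note t = inessentialD[OF u]
  let ?v = "Inv M (AddIso L x' z) \<cdot> (u \<boxplus> \<iota> (OMap L z)) \<cdot> AddIso L x z"
  have s: "inessential (AMap L (Symm X z x)) (z \<oplus>\<^bsub>X\<^esub> x) (x \<oplus>\<^bsub>X\<^esub> z)"
    "inessential (AMap L (Symm X x' z)) (x' \<oplus>\<^bsub>X\<^esub> z) (z \<oplus>\<^bsub>X\<^esub> x')"
    using inessential_AMap[of "Symm X z x"] inessential_AMap[of "Symm X x' z"] t z by simp_all
  have i: "inessential (AMap L (Symm X x' z) \<cdot> ?v \<cdot> AMap L (Symm X z x)) (z \<oplus>\<^bsub>X\<^esub> x) (z \<oplus>\<^bsub>X\<^esub> x')"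
    by (rule inessential_Comp[OF inessential_Comp[OF s(1) inessential_AddA_left[OF u z]] s(2)])
  have 1: "AMap L (Symm X x' z) \<cdot> Inv M (AddIso L x' z) = Inv M (AddIso L z x') \<cdot> Symm M (OMap L x') (OMap L z)"
    by (rule L.B.A.Comp_cancel_left[of "AddIso L z x'"], rule L.B.A.Comp_cancel_right[where f = "AddIso L x' z"])
      (use t z in \<open>simp_all add: L.AddIso_Symm\<close>)
  have "AMap L (Symm X x' z) \<cdot> ?v \<cdot> AMap L (Symm X z x)
    = (AMap L (Symm X x' z) \<cdot> Inv M (AddIso L x' z)) \<cdot> (u \<boxplus> \<iota> (OMap L z)) \<cdot> AddIso L x z \<cdot> AMap L (Symm X z x)"
    using t z by simp
  also have "\<dots> = Inv M (AddIso L z x') \<cdot> (Symm M (OMap L x') (OMap L z) \<cdot> (u \<boxplus> \<iota> (OMap L z)))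
       \<cdot> Symm M (OMap L z) (OMap L x) \<cdot> AddIso L z x"
    unfolding 1 using t z by (simp add: L.AddIso_Symm)
  also have "\<dots> = Inv M (AddIso L z x') \<cdot> (\<iota> (OMap L z) \<boxplus> u) \<cdot>
       (Symm M (OMap L x) (OMap L z) \<cdot> Symm M (OMap L z) (OMap L x)) \<cdot> AddIso L z x"
    using L.B.A.Symm_nat[of u "\<iota> (OMap L z)"] t z by simp
  finally show ?thesis using i t z by (simp add: L.B.A.Symm_Symm)
qed

lemma inessential_AddA:
  assumes u: "inessential u x x'" and v: "inessential v z z'"
  shows "inessential (Inv M (AddIso L x' z') \<cdot> (u \<boxplus> v) \<cdot> AddIso L x z) (x \<oplus>\<^bsub>X\<^esub> z) (x' \<oplus>\<^bsub>X\<^esub> z')"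
  using inessential_Comp[OF inessential_AddA_left[OF u, of z] inessential_AddA_right[OF v, of x']]
    inessentialD[OF u] inessentialD[OF v] by simp

lemma inessential_ActA:
  assumes u: "inessential u x x'" and r: "r \<in> Obj R"
  shows "inessential (Inv M (ActIso L r x') \<cdot> (\<iota>\<^bsub>R\<^esub> r \<boxdot> u) \<cdot> ActIso L r x) (r \<odot>\<^bsub>X\<^esub> x) (r \<odot>\<^bsub>X\<^esub> x')"
proof -
  obtain y f where f: "y \<in> Obj Y" "f \<in> Arr X" "Src X f = x" "Tgt X f = OMap D y \<oplus>\<^bsub>X\<^esub> x'" "u = absorb y x' \<cdot> AMap L f"
    using u by (auto simp: inessential_def)
  have o: "x \<in> Obj X" "x' \<in> Obj X" using u inessentialD by blast+
  let ?h = "(Inv X (ActIso D r y) \<boxplus>\<^bsub>X\<^esub> \<iota>\<^bsub>X\<^esub> (r \<odot>\<^bsub>X\<^esub> x')) \<cdot>\<^bsub>X\<^esub> ActAdd X r (OMap D y) x'"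
  let ?g = "?h \<cdot>\<^bsub>X\<^esub> (\<iota>\<^bsub>R\<^esub> r \<boxdot>\<^bsub>X\<^esub> f)"
  have "(\<iota>\<^bsub>R\<^esub> r \<boxdot> u) \<cdot> ActIso L r x
    = (\<iota>\<^bsub>R\<^esub> r \<boxdot> absorb y x') \<cdot> (\<iota>\<^bsub>R\<^esub> r \<boxdot> AMap L f) \<cdot> ActIso L r x"
    using f o r by simp
  also have "(\<iota>\<^bsub>R\<^esub> r \<boxdot> AMap L f) \<cdot> ActIso L r x = ActIso L r (OMap D y \<oplus>\<^bsub>X\<^esub> x') \<cdot> AMap L (\<iota>\<^bsub>R\<^esub> r \<boxdot>\<^bsub>X\<^esub> f)"
    using L.ActIso_nat[of r f] f r by simp
  also have "(\<iota>\<^bsub>R\<^esub> r \<boxdot> absorb y x') \<cdot> ActIso L r (OMap D y \<oplus>\<^bsub>X\<^esub> x') \<cdot> AMap L (\<iota>\<^bsub>R\<^esub> r \<boxdot>\<^bsub>X\<^esub> f)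
    = ActIso L r x' \<cdot> absorb (r \<odot>\<^bsub>Y\<^esub> y) (r \<odot>\<^bsub>X\<^esub> x') \<cdot> AMap L ?g"
    using L.B.A.Comp_eq_extend[OF absorb_ActO[OF r f(1) o(2)], of "AMap L (\<iota>\<^bsub>R\<^esub> r \<boxdot>\<^bsub>X\<^esub> f)"] f o r by simp
  finally have "Inv M (ActIso L r x') \<cdot> (\<iota>\<^bsub>R\<^esub> r \<boxdot> u) \<cdot> ActIso L r x
    = absorb (r \<odot>\<^bsub>Y\<^esub> y) (r \<odot>\<^bsub>X\<^esub> x') \<cdot> AMap L ?g"
    using f o r by simp
  then show ?thesis
    unfolding inessential_def using f o r
    by (intro conjI bexI[of _ "r \<odot>\<^bsub>Y\<^esub> y"] bexI[of _ ?g]) auto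
qed

end

section \<open>Representatives of arrows\<close>

context module_hom
begin

text \<open>Only the types of a representative; equivalence of representatives makes sense at this level. The
  side condition is added in \<open>kernel_rep\<close>.\<close>

definition represents :: "'o \<times> 'q \<Rightarrow> 'p \<Rightarrow> 'p \<Rightarrow> bool"
  where "represents p a b \<longleftrightarrow> fst p \<in> Obj A \<and> b \<in> Obj B \<and> snd p \<in> Arr B \<and>
    Src B (snd p) = a \<and> Tgt B (snd p) = OMap F (fst p) \<oplus> b"

lemma representsD:
  assumes "represents p a b"
  shows "fst p \<in> Obj A" "b \<in> Obj B" "a \<in> Obj B" "snd p \<in> Arr B" "Src B (snd p) = a"
    "Tgt B (snd p) = OMap F (fst p) \<oplus> b"
  using assms by (auto simp: represents_def)

definition ind_rep :: "'p \<Rightarrow> 'q \<Rightarrow> 'o \<times> 'q"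
  where "ind_rep b f = (\<zero>\<^bsub>A\<^esub>, (Inv B (ZeroIso F) \<boxplus> \<iota> b) \<cdot> Inv B (LUnit B b) \<cdot> f)"

definition comp_rep :: "'p \<Rightarrow> 'o \<times> 'q \<Rightarrow> 'o \<times> 'q \<Rightarrow> 'o \<times> 'q"
  where "comp_rep c q p = (fst p \<oplus>\<^bsub>A\<^esub> fst q,
    (Inv B (AddIso F (fst p) (fst q)) \<boxplus> \<iota> c)
    \<cdot> Inv B (Assoc B (OMap F (fst p)) (OMap F (fst q)) c)
    \<cdot> (\<iota> (OMap F (fst p)) \<boxplus> snd q) \<cdot> snd p)"

definition add_rep :: "'p \<Rightarrow> 'p \<Rightarrow> 'o \<times> 'q \<Rightarrow> 'o \<times> 'q \<Rightarrow> 'o \<times> 'q"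
  where "add_rep b b' p p' = (fst p \<oplus>\<^bsub>A\<^esub> fst p',
    (Inv B (AddIso F (fst p) (fst p')) \<boxplus> \<iota> (b \<oplus> b'))
    \<cdot> Interchange B (OMap F (fst p)) b (OMap F (fst p')) b' \<cdot> (snd p \<boxplus> snd p'))"

definition act_rep :: "'r \<Rightarrow> 'p \<Rightarrow> 'o \<times> 'q \<Rightarrow> 'o \<times> 'q"
  where "act_rep r b p = (r \<odot>\<^bsub>A\<^esub> fst p,
    (Inv B (ActIso F r (fst p)) \<boxplus> \<iota> (r \<odot> b))
    \<cdot> ActAdd B r (OMap F (fst p)) b \<cdot> (\<iota>\<^bsub>R\<^esub> r \<boxdot> snd p))"

text \<open>A representative of the inverse of the class of \<open>p\<close>. Its first component is an object \<open>x\<close> opposite to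
  that of \<open>p\<close>, as witnessed by \<open>e\<close>. Its second component passes from \<open>b\<close> to \<open>F (x \<oplus> fst p) \<oplus> b\<close>, then to
  \<open>F x \<oplus> (F (fst p) \<oplus> b)\<close>, and ends with the inverse of \<open>snd p\<close>.\<close>

definition opposite_rep :: "'p \<Rightarrow> 'o \<Rightarrow> 'm \<Rightarrow> 'o \<times> 'q \<Rightarrow> 'o \<times> 'q"
  where "opposite_rep b x e p = (x,
    (\<iota> (OMap F x) \<boxplus> Inv B (snd p)) \<cdot> Assoc B (OMap F x) (OMap F (fst p)) b
    \<cdot> (AddIso F x (fst p) \<boxplus> \<iota> b) \<cdot> (AMap F (Inv A e) \<boxplus> \<iota> b)
    \<cdot> (Inv B (ZeroIso F) \<boxplus> \<iota> b) \<cdot> Inv B (LUnit B b))"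

lemma represents_ind:
  "f \<in> Arr B \<Longrightarrow> Src B f = a \<Longrightarrow> Tgt B f = b \<Longrightarrow> represents (ind_rep b f) a b"
  by (auto simp: represents_def ind_rep_def)

lemma represents_comp:
  assumes p: "represents p a b" and q: "represents q b c" shows "represents (comp_rep c q p) a c"
  using representsD[OF p] representsD[OF q] by (simp add: represents_def comp_rep_def)

lemma represents_add:
  assumes p: "represents p a b" and q: "represents p' a' b'"
  shows "represents (add_rep b b' p p') (a \<oplus> a') (b \<oplus> b')"
  using representsD[OF p] representsD[OF q] by (simp add: represents_def add_rep_def)

lemma represents_act:
  assumes p: "represents p a b" and r: "r \<in> Obj R"
  shows "represents (act_rep r b p) (r \<odot> a) (r \<odot> b)"
  using representsD[OF p] r by (simp add: represents_def act_rep_def)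

lemma represents_opposite:
  assumes p: "represents p a b" and e: "x \<in> Obj A" "\<guillemotleft>e : x \<oplus>\<^bsub>A\<^esub> fst p \<rightarrow>\<^bsub>A\<^esub> \<zero>\<^bsub>A\<^esub>\<guillemotright>"
  shows "represents (opposite_rep b x e p) b a"
  using representsD[OF p] e by (auto simp: represents_def opposite_rep_def in_hom_def)

end

context null_sequence
begin

definition eqv :: "'o \<Rightarrow> 'x \<times> 'm \<Rightarrow> 'x \<times> 'm \<Rightarrow> bool"
  where "eqv b p p' \<longleftrightarrow> (\<exists>u. inessential u (fst p) (fst p') \<and> snd p' = (u \<boxplus> \<iota> b) \<cdot> snd p)"

lemma eqvI: "inessential u (fst p) (fst p') \<Longrightarrow> snd p' = (u \<boxplus> \<iota> b) \<cdot> snd p \<Longrightarrow> eqv b p p'"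
  by (auto simp: eqv_def)

text \<open>The common case: an arrow between the first components that matches the second components.\<close>

lemma eqv_AMapI:
  assumes "f \<in> Arr X" "Src X f = fst p" "Tgt X f = fst p'" "snd p' = (AMap L f \<boxplus> \<iota> b) \<cdot> snd p"
  shows "eqv b p p'"
  using eqvI[of "AMap L f" p p' b] inessential_AMap[of f] assms by simp

lemma eqv_represents: "eqv b p p' \<Longrightarrow> L.represents p a b \<Longrightarrow> L.represents p' a b"
  by (auto simp: eqv_def L.represents_def inessentialD)

lemma eqv_refl:
  assumes "L.represents p a b" shows "eqv b p p"
  using L.representsD[OF assms] by (intro eqv_AMapI[of "\<iota>\<^bsub>X\<^esub> (fst p)"]) simp_all

lemma eqv_sym:
  assumes p: "L.represents p a b" and e: "eqv b p p'" shows "eqv b p' p"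
proof -
  obtain u where u: "inessential u (fst p) (fst p')" "snd p' = (u \<boxplus> \<iota> b) \<cdot> snd p"
    using e by (auto simp: eqv_def)
  show ?thesis
    by (rule eqvI[OF inessential_Inv[OF u(1)]]) (use L.representsD[OF p] inessentialD[OF u(1)] u(2) in simp)
qed

lemma eqv_trans:
  assumes p: "L.represents p a b" and e: "eqv b p p'" "eqv b p' p''" shows "eqv b p p''"
proof -
  obtain u where u: "inessential u (fst p) (fst p')" "snd p' = (u \<boxplus> \<iota> b) \<cdot> snd p"
    using e by (auto simp: eqv_def)
  obtain v where v: "inessential v (fst p') (fst p'')" "snd p'' = (v \<boxplus> \<iota> b) \<cdot> snd p'"
    using e by (auto simp: eqv_def)
  show ?thesis
    by (rule eqvI[OF inessential_Comp[OF u(1) v(1)]])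
      (use L.representsD[OF p] inessentialD[OF u(1)] inessentialD[OF v(1)] u(2) v(2) in simp)
qed

lemma eqv_comp:
  assumes p: "L.represents p a b" and q: "L.represents q b c" and e: "eqv b p p'" "eqv c q q'"
  shows "eqv c (L.comp_rep c q p) (L.comp_rep c q' p')"
proof -
  obtain u where u: "inessential u (fst p) (fst p')" "snd p' = (u \<boxplus> \<iota> b) \<cdot> snd p"
    using e by (auto simp: eqv_def)
  obtain v where v: "inessential v (fst q) (fst q')" "snd q' = (v \<boxplus> \<iota> c) \<cdot> snd q"
    using e by (auto simp: eqv_def)
  note t = L.representsD[OF p] L.representsD[OF q] inessentialD[OF u(1)] inessentialD[OF v(1)]
  let ?a1 = "AddIso L (fst p) (fst q)" and ?a2 = "AddIso L (fst p') (fst q')"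
  have n: "Inv M (Assoc M (OMap L (fst p')) (OMap L (fst q')) c) \<cdot> (u \<boxplus> (v \<boxplus> \<iota> c))
    = ((u \<boxplus> v) \<boxplus> \<iota> c) \<cdot> Inv M (Assoc M (OMap L (fst p)) (OMap L (fst q)) c)"
    using L.B.A.Inv_Assoc_nat[of u v "\<iota> c"] t by simp
  have "snd (L.comp_rep c q' p') = (Inv M ?a2 \<boxplus> \<iota> c)
     \<cdot> (Inv M (Assoc M (OMap L (fst p')) (OMap L (fst q')) c) \<cdot> (u \<boxplus> (v \<boxplus> \<iota> c)))
     \<cdot> (\<iota> (OMap L (fst p)) \<boxplus> snd q) \<cdot> snd p"
    unfolding L.comp_rep_def u(2) v(2) using t by simp
  also have "\<dots> = ((Inv M ?a2 \<cdot> (u \<boxplus> v) \<cdot> ?a1) \<boxplus> \<iota> c) \<cdot> snd (L.comp_rep c q p)"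
    unfolding n L.comp_rep_def using t by simp
  finally show ?thesis
    by (rule eqvI[rotated]) (use inessential_AddA[OF u(1) v(1)] in \<open>simp add: L.comp_rep_def\<close>)
qed

lemma eqv_add:
  assumes p: "L.represents p a b" and q: "L.represents q a' c" and e: "eqv b p p'" "eqv c q q'"
  shows "eqv (b \<oplus> c) (L.add_rep b c p q) (L.add_rep b c p' q')"
proof -
  obtain u where u: "inessential u (fst p) (fst p')" "snd p' = (u \<boxplus> \<iota> b) \<cdot> snd p"
    using e by (auto simp: eqv_def)
  obtain v where v: "inessential v (fst q) (fst q')" "snd q' = (v \<boxplus> \<iota> c) \<cdot> snd q"
    using e by (auto simp: eqv_def)
  note t = L.representsD[OF p] L.representsD[OF q] inessentialD[OF u(1)] inessentialD[OF v(1)]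
  let ?a1 = "AddIso L (fst p) (fst q)" and ?a2 = "AddIso L (fst p') (fst q')"
  have n: "Interchange M (OMap L (fst p')) b (OMap L (fst q')) c \<cdot> ((u \<boxplus> \<iota> b) \<boxplus> (v \<boxplus> \<iota> c))
    = ((u \<boxplus> v) \<boxplus> \<iota> (b \<oplus> c)) \<cdot> Interchange M (OMap L (fst p)) b (OMap L (fst q)) c"
    using L.B.A.Interchange_nat[of u "\<iota> b" v "\<iota> c"] t by simp
  have "snd (L.add_rep b c p' q') = (Inv M ?a2 \<boxplus> \<iota> (b \<oplus> c))
     \<cdot> (Interchange M (OMap L (fst p')) b (OMap L (fst q')) c \<cdot> ((u \<boxplus> \<iota> b) \<boxplus> (v \<boxplus> \<iota> c)))
     \<cdot> (snd p \<boxplus> snd q)"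
    unfolding L.add_rep_def u(2) v(2) using t by simp
  also have "\<dots> = ((Inv M ?a2 \<cdot> (u \<boxplus> v) \<cdot> ?a1) \<boxplus> \<iota> (b \<oplus> c)) \<cdot> snd (L.add_rep b c p q)"
    unfolding n L.add_rep_def using t by simp
  finally show ?thesis
    by (rule eqvI[rotated]) (use inessential_AddA[OF u(1) v(1)] in \<open>simp add: L.add_rep_def\<close>)
qed

lemma eqv_act:
  assumes p: "L.represents p a b" and r: "r \<in> Obj R" and e: "eqv b p p'"
  shows "eqv (r \<odot> b) (L.act_rep r b p) (L.act_rep r b p')"
proof -
  obtain u where u: "inessential u (fst p) (fst p')" "snd p' = (u \<boxplus> \<iota> b) \<cdot> snd p"
    using e by (auto simp: eqv_def)
  note t = L.representsD[OF p] inessentialD[OF u(1)]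
  let ?a1 = "ActIso L r (fst p)" and ?a2 = "ActIso L r (fst p')"
  have n: "ActAdd M r (OMap L (fst p')) b \<cdot> (\<iota>\<^bsub>R\<^esub> r \<boxdot> (u \<boxplus> \<iota> b))
    = ((\<iota>\<^bsub>R\<^esub> r \<boxdot> u) \<boxplus> \<iota> (r \<odot> b)) \<cdot> ActAdd M r (OMap L (fst p)) b"
    using L.B.ActAdd_nat[of r u "\<iota> b"] t r by simp
  have "snd (L.act_rep r b p') = (Inv M ?a2 \<boxplus> \<iota> (r \<odot> b))
     \<cdot> (ActAdd M r (OMap L (fst p')) b \<cdot> (\<iota>\<^bsub>R\<^esub> r \<boxdot> (u \<boxplus> \<iota> b))) \<cdot> (\<iota>\<^bsub>R\<^esub> r \<boxdot> snd p)"
    unfolding L.act_rep_def u(2) using t r by simp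
  also have "\<dots> = ((Inv M ?a2 \<cdot> (\<iota>\<^bsub>R\<^esub> r \<boxdot> u) \<cdot> ?a1) \<boxplus> \<iota> (r \<odot> b)) \<cdot> snd (L.act_rep r b p)"
    unfolding n L.act_rep_def using t r by simp
  finally show ?thesis
    by (rule eqvI[rotated]) (use inessential_ActA[OF u(1) r] in \<open>simp add: L.act_rep_def\<close>)
qed

lemma eqv_ind_comp:
  assumes p: "L.represents p a b" and f: "f \<in> Arr M" "Src M f = b" "Tgt M f = c"
  shows "eqv c (L.comp_rep c (L.ind_rep c f) p) (fst p, (\<iota> (OMap L (fst p)) \<boxplus> f) \<cdot> snd p)"
proof (rule eqv_AMapI[of "RUnit X (fst p)"])
  note t = L.representsD[OF p] 
  let ?l = "OMap L (fst p)"
  have "c \<in> Obj M" using f by auto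
  note t = t f this
  have n: "((\<iota> ?l \<boxplus> ZeroIso L) \<boxplus> \<iota> c) \<cdot> Inv M (Assoc M ?l (OMap L \<zero>\<^bsub>X\<^esub>) c)
     = Inv M (Assoc M ?l \<zero> c) \<cdot> (\<iota> ?l \<boxplus> (ZeroIso L \<boxplus> \<iota> c))"
    using L.B.A.Inv_Assoc_nat[of "\<iota> ?l" "ZeroIso L" "\<iota> c"] t by simp
  have "(AMap L (RUnit X (fst p)) \<boxplus> \<iota> c) \<cdot> snd (L.comp_rep c (L.ind_rep c f) p)
    = (RUnit M ?l \<boxplus> \<iota> c) \<cdot> (((\<iota> ?l \<boxplus> ZeroIso L) \<boxplus> \<iota> c) \<cdot> Inv M (Assoc M ?l (OMap L \<zero>\<^bsub>X\<^esub>) c))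
      \<cdot> (\<iota> ?l \<boxplus> ((Inv M (ZeroIso L) \<boxplus> \<iota> c) \<cdot> Inv M (LUnit M c) \<cdot> f)) \<cdot> snd p"
    using t by (simp add: L.comp_rep_def L.ind_rep_def L.AddIso_ZeroIso_right[symmetric])
  also have "\<dots> = ((RUnit M ?l \<boxplus> \<iota> c) \<cdot> Inv M (Assoc M ?l \<zero> c))
      \<cdot> (\<iota> ?l \<boxplus> (Inv M (LUnit M c) \<cdot> f)) \<cdot> snd p"
    unfolding n using t by simp
  also have "(RUnit M ?l \<boxplus> \<iota> c) \<cdot> Inv M (Assoc M ?l \<zero> c) = \<iota> ?l \<boxplus> LUnit M c"
    using t by (simp add: L.B.A.RUnit_triangle)
  finally show "snd (fst p, (\<iota> ?l \<boxplus> f) \<cdot> snd p)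
     = (AMap L (RUnit X (fst p)) \<boxplus> \<iota> c) \<cdot> snd (L.comp_rep c (L.ind_rep c f) p)"
    using t by simp
qed (use L.representsD[OF p] in \<open>simp_all add: L.comp_rep_def L.ind_rep_def\<close>)

lemma eqv_comp_ind:
  assumes p: "L.represents p a b" and f: "f \<in> Arr M" "Tgt M f = a"
  shows "eqv b (L.comp_rep b p (L.ind_rep a f)) (fst p, snd p \<cdot> f)"
proof (rule eqv_AMapI[of "LUnit X (fst p)"])
  note t = L.representsD[OF p] f
  let ?l = "OMap L (fst p)"
  have n: "((ZeroIso L \<boxplus> \<iota> ?l) \<boxplus> \<iota> b) \<cdot> Inv M (Assoc M (OMap L \<zero>\<^bsub>X\<^esub>) ?l b)
     = Inv M (Assoc M \<zero> ?l b) \<cdot> (ZeroIso L \<boxplus> \<iota> (?l \<oplus> b))"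
    using L.B.A.Inv_Assoc_nat[of "ZeroIso L" "\<iota> ?l" "\<iota> b"] t by simp
  have "(AMap L (LUnit X (fst p)) \<boxplus> \<iota> b) \<cdot> snd (L.comp_rep b p (L.ind_rep a f))
    = (LUnit M ?l \<boxplus> \<iota> b) \<cdot> (((ZeroIso L \<boxplus> \<iota> ?l) \<boxplus> \<iota> b) \<cdot> Inv M (Assoc M (OMap L \<zero>\<^bsub>X\<^esub>) ?l b))
      \<cdot> (Inv M (ZeroIso L) \<boxplus> snd p) \<cdot> Inv M (LUnit M a) \<cdot> f"
    using t by (simp add: L.comp_rep_def L.ind_rep_def L.AddIso_ZeroIso[symmetric])
  also have "\<dots> = ((LUnit M ?l \<boxplus> \<iota> b) \<cdot> Inv M (Assoc M \<zero> ?l b))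
      \<cdot> (\<iota> \<zero> \<boxplus> snd p) \<cdot> Inv M (LUnit M a) \<cdot> f"
    unfolding n using t by simp
  also have "(LUnit M ?l \<boxplus> \<iota> b) \<cdot> Inv M (Assoc M \<zero> ?l b) = LUnit M (?l \<oplus> b)"
    using t by (simp add: L.B.A.LUnit_Assoc[symmetric])
  also have "LUnit M (?l \<oplus> b) \<cdot> (\<iota> \<zero> \<boxplus> snd p) \<cdot> Inv M (LUnit M a) \<cdot> f = snd p \<cdot> f"
    using L.B.A.Comp_eq_extend[OF L.B.A.LUnit_nat[of "snd p"], of "Inv M (LUnit M a) \<cdot> f"] t by simp
  finally show "snd (fst p, snd p \<cdot> f) = (AMap L (LUnit X (fst p)) \<boxplus> \<iota> b) \<cdot> snd (L.comp_rep b p (L.ind_rep a f))"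
    by simp
qed (use L.representsD[OF p] in \<open>simp_all add: L.comp_rep_def L.ind_rep_def\<close>)

text \<open>The first components are related by the associativity of \<open>X\<close>. Once everything else has been moved out
  of the way by naturality, the pentagon and the compatibility of \<open>L\<close> with associativity remain.\<close>

lemma eqv_comp_assoc:
  assumes p: "L.represents p a b" and q: "L.represents q b c" and s: "L.represents s c d"
  shows "eqv d (L.comp_rep d s (L.comp_rep c q p)) (L.comp_rep d (L.comp_rep d s q) p)"
proof (rule eqv_AMapI[of "Assoc X (fst p) (fst q) (fst s)"])
  note t = L.representsD[OF p] L.representsD[OF q] L.representsD[OF s]
  let ?X = "fst p" and ?Y = "fst q" and ?Z = "fst s"
  let ?x = "OMap L ?X" and ?y = "OMap L ?Y" and ?z = "OMap L ?Z"
  let ?w = "(\<iota> ?x \<boxplus> ((\<iota> ?y \<boxplus> snd s) \<cdot> snd q)) \<cdot> snd p"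
  have n1: "Inv M (Assoc M (OMap L (?X \<oplus>\<^bsub>X\<^esub> ?Y)) ?z d) \<cdot> (Inv M (AddIso L ?X ?Y) \<boxplus> \<iota> (?z \<oplus> d))
     = ((Inv M (AddIso L ?X ?Y) \<boxplus> \<iota> ?z) \<boxplus> \<iota> d) \<cdot> Inv M (Assoc M (?x \<oplus> ?y) ?z d)"
    using L.B.A.Inv_Assoc_nat[of "Inv M (AddIso L ?X ?Y)" "\<iota> ?z" "\<iota> d"] t by simp
  have n2: "(\<iota> (?x \<oplus> ?y) \<boxplus> snd s) \<cdot> Inv M (Assoc M ?x ?y c)
     = Inv M (Assoc M ?x ?y (?z \<oplus> d)) \<cdot> (\<iota> ?x \<boxplus> (\<iota> ?y \<boxplus> snd s))"
    using L.B.A.Inv_Assoc_nat[of "\<iota> ?x" "\<iota> ?y" "snd s"] t by simp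
  have n3: "Inv M (Assoc M ?x (OMap L (?Y \<oplus>\<^bsub>X\<^esub> ?Z)) d) \<cdot> (\<iota> ?x \<boxplus> (Inv M (AddIso L ?Y ?Z) \<boxplus> \<iota> d))
     = ((\<iota> ?x \<boxplus> Inv M (AddIso L ?Y ?Z)) \<boxplus> \<iota> d) \<cdot> Inv M (Assoc M ?x (?y \<oplus> ?z) d)"
    using L.B.A.Inv_Assoc_nat[of "\<iota> ?x" "Inv M (AddIso L ?Y ?Z)" "\<iota> d"] t by simp
  have p1: "Inv M (Assoc M ?x (?y \<oplus> ?z) d) \<cdot> (\<iota> ?x \<boxplus> Inv M (Assoc M ?y ?z d))
     = (Assoc M ?x ?y ?z \<boxplus> \<iota> d) \<cdot> Inv M (Assoc M ?x ?y (?z \<oplus> d) \<cdot> Assoc M (?x \<oplus> ?y) ?z d)"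
    unfolding L.B.A.pentagon[OF L.OMap_Obj'[OF t(1)] L.OMap_Obj'[OF t(7)] L.OMap_Obj'[OF t(13)] t(14)]
    using t by (simp add: L.B.A.Inv_Comp)
  have a: "AMap L (Assoc X ?X ?Y ?Z) \<cdot> Inv M (AddIso L (?X \<oplus>\<^bsub>X\<^esub> ?Y) ?Z) \<cdot> (Inv M (AddIso L ?X ?Y) \<boxplus> \<iota> ?z)
     = Inv M (AddIso L ?X (?Y \<oplus>\<^bsub>X\<^esub> ?Z)) \<cdot> (\<iota> ?x \<boxplus> Inv M (AddIso L ?Y ?Z)) \<cdot> Assoc M ?x ?y ?z"
    (is "?l = ?r")
  proof (rule L.B.A.Comp_cancel_right[where f = "(AddIso L ?X ?Y \<boxplus> \<iota> ?z) \<cdot> AddIso L (?X \<oplus>\<^bsub>X\<^esub> ?Y) ?Z"])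
    show "?l \<cdot> ((AddIso L ?X ?Y \<boxplus> \<iota> ?z) \<cdot> AddIso L (?X \<oplus>\<^bsub>X\<^esub> ?Y) ?Z)
       = ?r \<cdot> ((AddIso L ?X ?Y \<boxplus> \<iota> ?z) \<cdot> AddIso L (?X \<oplus>\<^bsub>X\<^esub> ?Y) ?Z)"
      using t by (simp add: L.AddIso_Assoc)
  qed (use t in auto)
  have "(AMap L (Assoc X ?X ?Y ?Z) \<boxplus> \<iota> d) \<cdot> snd (L.comp_rep d s (L.comp_rep c q p))
    = ((AMap L (Assoc X ?X ?Y ?Z) \<cdot> Inv M (AddIso L (?X \<oplus>\<^bsub>X\<^esub> ?Y) ?Z)) \<boxplus> \<iota> d)
      \<cdot> (Inv M (Assoc M (OMap L (?X \<oplus>\<^bsub>X\<^esub> ?Y)) ?z d) \<cdot> (Inv M (AddIso L ?X ?Y) \<boxplus> \<iota> (?z \<oplus> d)))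
      \<cdot> ((\<iota> (?x \<oplus> ?y) \<boxplus> snd s) \<cdot> Inv M (Assoc M ?x ?y c)) \<cdot> (\<iota> ?x \<boxplus> snd q) \<cdot> snd p"
    using t by (simp add: L.comp_rep_def)
  also have "\<dots> = ((AMap L (Assoc X ?X ?Y ?Z) \<cdot> Inv M (AddIso L (?X \<oplus>\<^bsub>X\<^esub> ?Y) ?Z) \<cdot> (Inv M (AddIso L ?X ?Y) \<boxplus> \<iota> ?z)) \<boxplus> \<iota> d)
     \<cdot> Inv M (Assoc M (?x \<oplus> ?y) ?z d) \<cdot> Inv M (Assoc M ?x ?y (?z \<oplus> d)) \<cdot> ?w"
    unfolding n1 n2 using t by simp
  also have "\<dots> = ((Inv M (AddIso L ?X (?Y \<oplus>\<^bsub>X\<^esub> ?Z)) \<cdot> (\<iota> ?x \<boxplus> Inv M (AddIso L ?Y ?Z))) \<boxplus> \<iota> d)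
     \<cdot> ((Assoc M ?x ?y ?z \<boxplus> \<iota> d) \<cdot> Inv M (Assoc M ?x ?y (?z \<oplus> d) \<cdot> Assoc M (?x \<oplus> ?y) ?z d)) \<cdot> ?w"
    unfolding a using t by (simp add: L.B.A.Inv_Comp)
  also have "\<dots> = (Inv M (AddIso L ?X (?Y \<oplus>\<^bsub>X\<^esub> ?Z)) \<boxplus> \<iota> d)
     \<cdot> (((\<iota> ?x \<boxplus> Inv M (AddIso L ?Y ?Z)) \<boxplus> \<iota> d) \<cdot> Inv M (Assoc M ?x (?y \<oplus> ?z) d))
     \<cdot> (\<iota> ?x \<boxplus> Inv M (Assoc M ?y ?z d)) \<cdot> ?w"
    unfolding p1[symmetric] using t by simp
  also have "\<dots> = snd (L.comp_rep d (L.comp_rep d s q) p)"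
    unfolding n3[symmetric] using t by (simp add: L.comp_rep_def)
  finally show "snd (L.comp_rep d (L.comp_rep d s q) p)
    = (AMap L (Assoc X ?X ?Y ?Z) \<boxplus> \<iota> d) \<cdot> snd (L.comp_rep d s (L.comp_rep c q p))" ..
qed (use L.representsD[OF p] L.representsD[OF q] L.representsD[OF s] in \<open>simp_all add: L.comp_rep_def\<close>)

text \<open>Composed in this order, \<open>snd p\<close> meets its inverse directly. In the other order the two are separated by
  a swap of summands, and an indirect argument is used in \<open>eqv_opposite_comp\<close>.\<close>

lemma eqv_comp_opposite:
  assumes p: "L.represents p a b" and e: "x \<in> Obj X" "\<guillemotleft>e : x \<oplus>\<^bsub>X\<^esub> fst p \<rightarrow>\<^bsub>X\<^esub> \<zero>\<^bsub>X\<^esub>\<guillemotright>"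
  shows "eqv b (L.comp_rep b p (L.opposite_rep b x e p)) (L.ind_rep b (\<iota> b))"
proof (rule eqv_AMapI[of e])
  note t = L.representsD[OF p] e(1) e(2)[unfolded in_hom_def]
  show "snd (L.ind_rep b (\<iota> b)) = (AMap L e \<boxplus> \<iota> b) \<cdot> snd (L.comp_rep b p (L.opposite_rep b x e p))"
    using t by (simp add: L.comp_rep_def L.ind_rep_def L.opposite_rep_def)
qed (use L.representsD[OF p] e in \<open>simp_all add: L.comp_rep_def L.ind_rep_def L.opposite_rep_def in_hom_def\<close>)

lemma ex_opposite_left:
  assumes "x \<in> Obj X" shows "\<exists>y\<in>Obj X. \<exists>e. \<guillemotleft>e : y \<oplus>\<^bsub>X\<^esub> x \<rightarrow>\<^bsub>X\<^esub> \<zero>\<^bsub>X\<^esub>\<guillemotright>"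
proof -
  obtain y e where y: "y \<in> Obj X" "\<guillemotleft>e : x \<oplus>\<^bsub>X\<^esub> y \<rightarrow>\<^bsub>X\<^esub> \<zero>\<^bsub>X\<^esub>\<guillemotright>"
    using D.B.A.ex_opposite[OF assms] by blast
  then have "\<guillemotleft>e \<cdot>\<^bsub>X\<^esub> Symm X y x : y \<oplus>\<^bsub>X\<^esub> x \<rightarrow>\<^bsub>X\<^esub> \<zero>\<^bsub>X\<^esub>\<guillemotright>"
    using assms by (auto simp: in_hom_def)
  with y show ?thesis by blast
qed

text \<open>Let \<open>k\<close> be a right inverse of the right inverse \<open>q\<close> of \<open>p\<close>. By associativity \<open>k\<close> is equivalent to \<open>p\<close>,
  so \<open>q\<close> is also a left inverse of \<open>p\<close>.\<close>

lemma eqv_opposite_comp: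
  assumes p: "L.represents p a b" and e: "x \<in> Obj X" "\<guillemotleft>e : x \<oplus>\<^bsub>X\<^esub> fst p \<rightarrow>\<^bsub>X\<^esub> \<zero>\<^bsub>X\<^esub>\<guillemotright>"
  shows "eqv a (L.comp_rep a (L.opposite_rep b x e p) p) (L.ind_rep a (\<iota> a))"
proof -
  let ?q = "L.opposite_rep b x e p"
  have q: "L.represents ?q b a" by (rule L.represents_opposite[OF p e])
  note t = L.representsD[OF p]
  obtain y e' where y: "y \<in> Obj X" "\<guillemotleft>e' : y \<oplus>\<^bsub>X\<^esub> fst ?q \<rightarrow>\<^bsub>X\<^esub> \<zero>\<^bsub>X\<^esub>\<guillemotright>"
    using ex_opposite_left[of "fst ?q"] L.representsD[OF q] by blast
  let ?k = "L.opposite_rep a y e' ?q"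
  have k: "L.represents ?k a b" by (rule L.represents_opposite[OF q y])
  have ib: "L.represents (L.ind_rep b (\<iota> b)) b b" and ia: "L.represents (L.ind_rep a (\<iota> a)) a a"
    using t by (simp_all add: L.represents_ind)
  have pq: "eqv b (L.comp_rep b p ?q) (L.ind_rep b (\<iota> b))" by (rule eqv_comp_opposite[OF p e])
  have qk: "eqv a (L.comp_rep a ?q ?k) (L.ind_rep a (\<iota> a))" by (rule eqv_comp_opposite[OF q y])
  have 1: "eqv b (L.comp_rep b (L.comp_rep b p ?q) ?k) (L.comp_rep b (L.ind_rep b (\<iota> b)) ?k)"
    by (rule eqv_comp[OF k L.represents_comp[OF q p] eqv_refl[OF k] pq])
  have 2: "eqv b (L.comp_rep b (L.ind_rep b (\<iota> b)) ?k) ?k"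
    using eqv_ind_comp[OF k, of "\<iota> b" b] L.representsD[OF k] by simp
  have 3: "eqv b (L.comp_rep b p (L.comp_rep a ?q ?k)) (L.comp_rep b (L.comp_rep b p ?q) ?k)"
    by (rule eqv_comp_assoc[OF k q p])
  have 4: "eqv b (L.comp_rep b p (L.comp_rep a ?q ?k)) (L.comp_rep b p (L.ind_rep a (\<iota> a)))"
    by (rule eqv_comp[OF L.represents_comp[OF k q] p qk eqv_refl[OF p]])
  have 5: "eqv b (L.comp_rep b p (L.ind_rep a (\<iota> a))) p"
    using eqv_comp_ind[OF p, of "\<iota> a"] t by simp
  have r: "L.represents (L.comp_rep b p (L.comp_rep a ?q ?k)) a b"
    by (intro L.represents_comp[OF L.represents_comp[OF k q] p])
  have pk: "eqv b p ?k"
    using eqv_trans[OF p eqv_sym[OF r eqv_trans[OF r 4 5]] eqv_trans[OF r 3 eqv_trans[OF _ 1 2]]]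
      L.represents_comp[OF k L.represents_comp[OF q p]] by blast
  have "eqv a (L.comp_rep a ?q p) (L.comp_rep a ?q ?k)"
    by (rule eqv_comp[OF p q pk eqv_refl[OF q]])
  then show ?thesis
    using qk eqv_trans L.represents_comp[OF p q] by blast
qed

end

section \<open>The kernel of a homomorphism\<close>

context module_hom
begin

text \<open>The kernel of \<open>F\<close> consists of the objects with a trivialisation of their image and of the arrows
  compatible with the trivialisations. The side conditions in cohomology have this form, and
  they are preserved by all operations because every structural isomorphism lies in the kernel.\<close>

definition kernel_obj :: "'o \<times> 'q \<Rightarrow> bool"
  where "kernel_obj P \<longleftrightarrow> fst P \<in> Obj A \<and> snd P \<in> Arr B \<and> Src B (snd P) = OMap F (fst P) \<and> Tgt B (snd P) = \<zero>"

definition kernel_hom :: "'o \<times> 'q \<Rightarrow> 'o \<times> 'q \<Rightarrow> 'm \<Rightarrow> bool"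
  where "kernel_hom P Q f \<longleftrightarrow> f \<in> Arr A \<and> Src A f = fst P \<and> Tgt A f = fst Q \<and> snd Q \<cdot> AMap F f = snd P"

definition kernel_add :: "'o \<times> 'q \<Rightarrow> 'o \<times> 'q \<Rightarrow> 'o \<times> 'q"
  where "kernel_add P Q = (fst P \<oplus>\<^bsub>A\<^esub> fst Q,
    LUnit B \<zero> \<cdot> (snd P \<boxplus> snd Q) \<cdot> AddIso F (fst P) (fst Q))"

definition kernel_zero :: "'o \<times> 'q" where "kernel_zero = (\<zero>\<^bsub>A\<^esub>, ZeroIso F)"

definition kernel_act :: "'r \<Rightarrow> 'o \<times> 'q \<Rightarrow> 'o \<times> 'q"
  where "kernel_act r P = (r \<odot>\<^bsub>A\<^esub> fst P,
    ActZero B r \<cdot> (\<iota>\<^bsub>R\<^esub> r \<boxdot> snd P) \<cdot> ActIso F r (fst P))"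

lemma kernel_objD:
  assumes "kernel_obj P"
  shows "fst P \<in> Obj A" "snd P \<in> Arr B" "Src B (snd P) = OMap F (fst P)" "Tgt B (snd P) = \<zero>"
  using assms by (auto simp: kernel_obj_def)

lemma kernel_homD:
  assumes "kernel_hom P Q f"
  shows "f \<in> Arr A" "Src A f = fst P" "Tgt A f = fst Q" "snd Q \<cdot> AMap F f = snd P" "fst P \<in> Obj A"
  using assms A.A.Src_Obj[of f] by (auto simp: kernel_hom_def)

lemma kernel_obj_add [simp]: "kernel_obj P \<Longrightarrow> kernel_obj Q \<Longrightarrow> kernel_obj (kernel_add P Q)"
  by (simp add: kernel_obj_def kernel_add_def)

lemma kernel_obj_zero [simp]: "kernel_obj kernel_zero"
  by (simp add: kernel_obj_def kernel_zero_def)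

lemma kernel_obj_act [simp]: "kernel_obj P \<Longrightarrow> r \<in> Obj R \<Longrightarrow> kernel_obj (kernel_act r P)"
  by (simp add: kernel_obj_def kernel_act_def)

lemma kernel_hom_Ide: "kernel_obj P \<Longrightarrow> kernel_hom P P (\<iota>\<^bsub>A\<^esub> (fst P))"
  by (simp add: kernel_obj_def kernel_hom_def)

lemma kernel_hom_Comp:
  assumes S: "kernel_obj S" and f: "kernel_hom P Q f" and g: "kernel_hom Q S g"
  shows "kernel_hom P S (g \<cdot>\<^bsub>A\<^esub> f)"
proof -
  note t = kernel_objD[OF S] kernel_homD(1-3)[OF f] kernel_homD(1-3)[OF g]
  have "snd S \<cdot> AMap F (g \<cdot>\<^bsub>A\<^esub> f) = (snd S \<cdot> AMap F g) \<cdot> AMap F f"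
    using t by simp
  also have "\<dots> = snd P" unfolding kernel_homD(4)[OF g] kernel_homD(4)[OF f] ..
  finally show ?thesis using t by (simp add: kernel_hom_def del: AMap_Comp')
qed

lemma kernel_hom_Inv:
  assumes Q: "kernel_obj Q" and f: "kernel_hom P Q f" shows "kernel_hom Q P (Inv A f)"
proof -
  note t = kernel_objD[OF Q] kernel_homD(1-3)[OF f]
  have "snd P \<cdot> AMap F (Inv A f) = (snd Q \<cdot> AMap F f) \<cdot> AMap F (Inv A f)"
    unfolding kernel_homD(4)[OF f] ..
  also have "\<dots> = snd Q" using t by simp
  finally show ?thesis using t by (simp add: kernel_hom_def del: AMap_Inv)
qed

lemma kernel_hom_AddA:
  assumes o: "kernel_obj P'" "kernel_obj Q'" and f: "kernel_hom P P' f" and g: "kernel_hom Q Q' g"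
  shows "kernel_hom (kernel_add P Q) (kernel_add P' Q') (f \<boxplus>\<^bsub>A\<^esub> g)"
proof -
  note t = kernel_objD[OF o(1)] kernel_objD[OF o(2)] kernel_homD(1-3,5)[OF f] kernel_homD(1-3,5)[OF g]
  have "snd (kernel_add P' Q') \<cdot> AMap F (f \<boxplus>\<^bsub>A\<^esub> g)
    = LUnit B \<zero> \<cdot> (snd P' \<boxplus> snd Q') \<cdot> AddIso F (fst P') (fst Q') \<cdot> AMap F (f \<boxplus>\<^bsub>A\<^esub> g)"
    using t by (simp add: kernel_add_def)
  also have "\<dots> = LUnit B \<zero> \<cdot> ((snd P' \<cdot> AMap F f) \<boxplus> (snd Q' \<cdot> AMap F g)) \<cdot> AddIso F (fst P) (fst Q)"
    using t AddIso_nat[of f g] by simp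
  also have "\<dots> = snd (kernel_add P Q)" unfolding kernel_homD(4)[OF f] kernel_homD(4)[OF g] by (simp add: kernel_add_def)
  finally show ?thesis using t by (simp add: kernel_hom_def, simp add: kernel_add_def)
qed

lemma kernel_hom_LUnit:
  assumes P: "kernel_obj P" shows "kernel_hom (kernel_add kernel_zero P) P (LUnit A (fst P))"
proof -
  note t = kernel_objD[OF P]
  have "snd P \<cdot> AMap F (LUnit A (fst P)) = (snd P \<cdot> LUnit B (OMap F (fst P)))
      \<cdot> (ZeroIso F \<boxplus> \<iota> (OMap F (fst P))) \<cdot> AddIso F \<zero>\<^bsub>A\<^esub> (fst P)"
    using t by (simp add: AddIso_ZeroIso[symmetric])
  also have "snd P \<cdot> LUnit B (OMap F (fst P)) = LUnit B \<zero> \<cdot> (\<iota> \<zero> \<boxplus> snd P)"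
    using B.A.LUnit_nat[of "snd P"] t by simp
  finally show ?thesis using t by (simp add: kernel_hom_def kernel_add_def kernel_zero_def)
qed

lemma kernel_hom_Symm:
  assumes P: "kernel_obj P" and Q: "kernel_obj Q"
  shows "kernel_hom (kernel_add P Q) (kernel_add Q P) (Symm A (fst P) (fst Q))"
proof -
  note t = kernel_objD[OF P] kernel_objD[OF Q]
  have "snd (kernel_add Q P) \<cdot> AMap F (Symm A (fst P) (fst Q))
     = LUnit B \<zero> \<cdot> ((snd Q \<boxplus> snd P) \<cdot> Symm B (OMap F (fst P)) (OMap F (fst Q))) \<cdot> AddIso F (fst P) (fst Q)"
    using t by (simp add: kernel_add_def AddIso_Symm)
  also have "(snd Q \<boxplus> snd P) \<cdot> Symm B (OMap F (fst P)) (OMap F (fst Q)) = snd P \<boxplus> snd Q"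
    using B.A.Symm_nat[of "snd P" "snd Q"] t by (simp add: B.A.Symm_Zero)
  finally show ?thesis using t by (simp add: kernel_hom_def kernel_add_def)
qed

lemma kernel_hom_Assoc:
  assumes P: "kernel_obj P" and Q: "kernel_obj Q" and S: "kernel_obj S"
  shows "kernel_hom (kernel_add (kernel_add P Q) S) (kernel_add P (kernel_add Q S)) (Assoc A (fst P) (fst Q) (fst S))"
proof -
  note t = kernel_objD[OF P] kernel_objD[OF Q] kernel_objD[OF S]
  let ?p = "OMap F (fst P)" and ?q = "OMap F (fst Q)" and ?s = "OMap F (fst S)" and ?z = "\<zero>"
  have u: "(\<iota> ?z \<boxplus> LUnit B ?z) \<cdot> Assoc B ?z ?z ?z = LUnit B ?z \<boxplus> \<iota> ?z"
    using B.A.triangle[of ?z ?z] by (simp add: B.A.LUnit_Zero)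
  have "snd (kernel_add P (kernel_add Q S)) \<cdot> AMap F (Assoc A (fst P) (fst Q) (fst S))
     = LUnit B ?z \<cdot> (\<iota> ?z \<boxplus> LUnit B ?z) \<cdot> (snd P \<boxplus> (snd Q \<boxplus> snd S))
      \<cdot> ((\<iota> ?p \<boxplus> AddIso F (fst Q) (fst S)) \<cdot> AddIso F (fst P) (fst Q \<oplus>\<^bsub>A\<^esub> fst S)
        \<cdot> AMap F (Assoc A (fst P) (fst Q) (fst S)))"
    using t by (simp add: kernel_add_def)
  also have "\<dots> = LUnit B ?z \<cdot> (\<iota> ?z \<boxplus> LUnit B ?z) \<cdot> ((snd P \<boxplus> (snd Q \<boxplus> snd S)) \<cdot> Assoc B ?p ?q ?s)
      \<cdot> (AddIso F (fst P) (fst Q) \<boxplus> \<iota> ?s) \<cdot> AddIso F (fst P \<oplus>\<^bsub>A\<^esub> fst Q) (fst S)"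
    using t by (simp add: AddIso_Assoc[symmetric])
  also have "(snd P \<boxplus> (snd Q \<boxplus> snd S)) \<cdot> Assoc B ?p ?q ?s = Assoc B ?z ?z ?z \<cdot> ((snd P \<boxplus> snd Q) \<boxplus> snd S)"
    using B.A.Assoc_nat[of "snd P" "snd Q" "snd S"] t by simp
  also have "LUnit B ?z \<cdot> (\<iota> ?z \<boxplus> LUnit B ?z) \<cdot> (Assoc B ?z ?z ?z \<cdot> ((snd P \<boxplus> snd Q) \<boxplus> snd S))
      \<cdot> (AddIso F (fst P) (fst Q) \<boxplus> \<iota> ?s) \<cdot> AddIso F (fst P \<oplus>\<^bsub>A\<^esub> fst Q) (fst S)
    = LUnit B ?z \<cdot> ((\<iota> ?z \<boxplus> LUnit B ?z) \<cdot> Assoc B ?z ?z ?z) \<cdot> ((snd P \<boxplus> snd Q) \<boxplus> snd S)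
      \<cdot> (AddIso F (fst P) (fst Q) \<boxplus> \<iota> ?s) \<cdot> AddIso F (fst P \<oplus>\<^bsub>A\<^esub> fst Q) (fst S)"
    using t by simp
  also have "\<dots> = snd (kernel_add (kernel_add P Q) S)"
    unfolding u using t by (simp add: kernel_add_def)
  finally show ?thesis using t by (simp add: kernel_hom_def, simp add: kernel_add_def)
qed

lemma fst_kernel [simp]:
  "fst (kernel_add P Q) = fst P \<oplus>\<^bsub>A\<^esub> fst Q" "fst kernel_zero = \<zero>\<^bsub>A\<^esub>" "fst (kernel_act r P) = r \<odot>\<^bsub>A\<^esub> fst P"
  by (simp_all add: kernel_add_def kernel_zero_def kernel_act_def)

lemma kernel_hom_Interchange:
  assumes o: "kernel_obj P" "kernel_obj Q" "kernel_obj S" "kernel_obj T"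
  shows "kernel_hom (kernel_add (kernel_add P Q) (kernel_add S T)) (kernel_add (kernel_add P S) (kernel_add Q T))
    (Interchange A (fst P) (fst Q) (fst S) (fst T))"
proof -
  have 1: "kernel_hom (kernel_add (kernel_add P Q) (kernel_add S T)) (kernel_add P (kernel_add Q (kernel_add S T)))
      (Assoc A (fst P) (fst Q) (fst S \<oplus>\<^bsub>A\<^esub> fst T))"
    using kernel_hom_Assoc[of P Q "kernel_add S T"] o by simp
  have 2: "kernel_hom (kernel_add P (kernel_add Q (kernel_add S T))) (kernel_add P (kernel_add (kernel_add Q S) T))
      (\<iota>\<^bsub>A\<^esub> (fst P) \<boxplus>\<^bsub>A\<^esub> Inv A (Assoc A (fst Q) (fst S) (fst T)))"
    using o by (intro kernel_hom_AddA kernel_hom_Ide kernel_hom_Inv kernel_hom_Assoc) simp_all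
  have 3: "kernel_hom (kernel_add P (kernel_add (kernel_add Q S) T)) (kernel_add P (kernel_add (kernel_add S Q) T))
      (\<iota>\<^bsub>A\<^esub> (fst P) \<boxplus>\<^bsub>A\<^esub> (Symm A (fst Q) (fst S) \<boxplus>\<^bsub>A\<^esub> \<iota>\<^bsub>A\<^esub> (fst T)))"
    using o by (intro kernel_hom_AddA kernel_hom_Ide kernel_hom_Symm) simp_all
  have 4: "kernel_hom (kernel_add P (kernel_add (kernel_add S Q) T)) (kernel_add P (kernel_add S (kernel_add Q T)))
      (\<iota>\<^bsub>A\<^esub> (fst P) \<boxplus>\<^bsub>A\<^esub> Assoc A (fst S) (fst Q) (fst T))"
    using o by (intro kernel_hom_AddA kernel_hom_Ide kernel_hom_Assoc) simp_all
  have 5: "kernel_hom (kernel_add P (kernel_add S (kernel_add Q T))) (kernel_add (kernel_add P S) (kernel_add Q T))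
      (Inv A (Assoc A (fst P) (fst S) (fst Q \<oplus>\<^bsub>A\<^esub> fst T)))"
    using kernel_hom_Inv[OF _ kernel_hom_Assoc[of P S "kernel_add Q T"]] o by simp
  show ?thesis
    unfolding Interchange_def
    using o by (intro kernel_hom_Comp[OF _ kernel_hom_Comp[OF _ kernel_hom_Comp[OF _ kernel_hom_Comp[OF _ 1 2] 3] 4] 5]) simp_all
qed

lemma kernel_hom_ActA:
  assumes Q: "kernel_obj Q" and f: "kernel_hom P Q f" and r: "r \<in> Obj R"
  shows "kernel_hom (kernel_act r P) (kernel_act r Q) (\<iota>\<^bsub>R\<^esub> r \<boxdot>\<^bsub>A\<^esub> f)"
proof -
  note t = kernel_objD[OF Q] kernel_homD(1-3,5)[OF f] r
  have "snd (kernel_act r Q) \<cdot> AMap F (\<iota>\<^bsub>R\<^esub> r \<boxdot>\<^bsub>A\<^esub> f)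
    = ActZero B r \<cdot> (\<iota>\<^bsub>R\<^esub> r \<boxdot> (snd Q \<cdot> AMap F f)) \<cdot> ActIso F r (fst P)"
    using ActIso_nat[of r f] t by (simp add: kernel_act_def)
  also have "\<dots> = snd (kernel_act r P)" unfolding kernel_homD(4)[OF f] by (simp add: kernel_act_def)
  finally show ?thesis using t by (simp add: kernel_hom_def)
qed

lemma kernel_hom_ActAdd:
  assumes P: "kernel_obj P" and Q: "kernel_obj Q" and r: "r \<in> Obj R"
  shows "kernel_hom (kernel_act r (kernel_add P Q)) (kernel_add (kernel_act r P) (kernel_act r Q)) (ActAdd A r (fst P) (fst Q))"
proof -
  note t = kernel_objD[OF P] kernel_objD[OF Q] r
  let ?p = "OMap F (fst P)" and ?q = "OMap F (fst Q)" and ?z = "\<zero>" and ?i = "\<iota>\<^bsub>R\<^esub> r" and ?Z = "ActZero B r"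
  have u: "LUnit B ?z \<cdot> (?Z \<boxplus> ?Z) \<cdot> ActAdd B r ?z ?z = ?Z \<cdot> (?i \<boxdot> LUnit B ?z)"
  proof -
    have "?Z \<cdot> (?i \<boxdot> LUnit B ?z) = (?Z \<cdot> LUnit B (r \<odot> ?z)) \<cdot> (?Z \<boxplus> \<iota> (r \<odot> ?z)) \<cdot> ActAdd B r ?z ?z"
      using r by (simp add: B.ActAdd_ActZero[symmetric])
    also have "?Z \<cdot> LUnit B (r \<odot> ?z) = LUnit B ?z \<cdot> (\<iota> ?z \<boxplus> ?Z)"
      using B.A.LUnit_nat[of ?Z] r by simp
    finally show ?thesis using r by simp
  qed
  have "snd (kernel_add (kernel_act r P) (kernel_act r Q)) \<cdot> AMap F (ActAdd A r (fst P) (fst Q))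
    = LUnit B ?z \<cdot> (?Z \<boxplus> ?Z) \<cdot> ((?i \<boxdot> snd P) \<boxplus> (?i \<boxdot> snd Q)) \<cdot>
      ((ActIso F r (fst P) \<boxplus> ActIso F r (fst Q)) \<cdot> AddIso F (r \<odot>\<^bsub>A\<^esub> fst P) (r \<odot>\<^bsub>A\<^esub> fst Q)
       \<cdot> AMap F (ActAdd A r (fst P) (fst Q)))"
    using t by (simp add: kernel_add_def kernel_act_def)
  also have "\<dots> = LUnit B ?z \<cdot> (?Z \<boxplus> ?Z) \<cdot> (((?i \<boxdot> snd P) \<boxplus> (?i \<boxdot> snd Q)) \<cdot> ActAdd B r ?p ?q)
      \<cdot> (?i \<boxdot> AddIso F (fst P) (fst Q)) \<cdot> ActIso F r (fst P \<oplus>\<^bsub>A\<^esub> fst Q)"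
    unfolding ActIso_ActAdd[OF r t(1,5)] using t by simp
  also have "((?i \<boxdot> snd P) \<boxplus> (?i \<boxdot> snd Q)) \<cdot> ActAdd B r ?p ?q = ActAdd B r ?z ?z \<cdot> (?i \<boxdot> (snd P \<boxplus> snd Q))"
    using B.ActAdd_nat[of r "snd P" "snd Q"] t by simp
  also have "LUnit B ?z \<cdot> (?Z \<boxplus> ?Z) \<cdot> (ActAdd B r ?z ?z \<cdot> (?i \<boxdot> (snd P \<boxplus> snd Q)))
      \<cdot> (?i \<boxdot> AddIso F (fst P) (fst Q)) \<cdot> ActIso F r (fst P \<oplus>\<^bsub>A\<^esub> fst Q)
    = (LUnit B ?z \<cdot> (?Z \<boxplus> ?Z) \<cdot> ActAdd B r ?z ?z) \<cdot> (?i \<boxdot> (snd P \<boxplus> snd Q))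
      \<cdot> (?i \<boxdot> AddIso F (fst P) (fst Q)) \<cdot> ActIso F r (fst P \<oplus>\<^bsub>A\<^esub> fst Q)"
    using t by simp
  also have "\<dots> = snd (kernel_act r (kernel_add P Q))"
    unfolding u using t by (simp add: kernel_add_def kernel_act_def)
  finally show ?thesis using t by (simp add: kernel_hom_def)
qed

lemma kernel_hom_ActZero:
  "r \<in> Obj R \<Longrightarrow> kernel_hom (kernel_act r kernel_zero) kernel_zero (ActZero A r)"
  by (simp add: kernel_hom_def, simp add: kernel_act_def kernel_zero_def ActIso_ActZero)

end

context null_sequence
begin

text \<open>By means of \<open>\<nu>\<close>, the homomorphism \<open>D\<close> lifts to the kernel of \<open>L\<close>. That \<open>\<nu>\<close> is a 2-morphism says that the
  constraints of \<open>D\<close> are arrows of the kernel.\<close>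

definition lift :: "'y \<Rightarrow> 'x \<times> 'm" where "lift y = (OMap D y, \<nu> y)"

lemma fst_lift [simp]: "fst (lift y) = OMap D y" by (simp add: lift_def)

lemma kernel_obj_lift [simp]: "y \<in> Obj Y \<Longrightarrow> L.kernel_obj (lift y)"
  by (simp add: L.kernel_obj_def lift_def)

lemma kernel_hom_lift_AMap: "g \<in> Arr Y \<Longrightarrow> L.kernel_hom (lift (Src Y g)) (lift (Tgt Y g)) (AMap D g)"
  by (simp add: L.kernel_hom_def lift_def null_nat)

lemma kernel_hom_lift_AddIso: "y \<in> Obj Y \<Longrightarrow> z \<in> Obj Y \<Longrightarrow>
    L.kernel_hom (lift (y \<oplus>\<^bsub>Y\<^esub> z)) (L.kernel_add (lift y) (lift z)) (AddIso D y z)"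
  by (simp add: L.kernel_hom_def lift_def L.kernel_add_def null_AddO)

lemma kernel_hom_lift_ZeroIso: "L.kernel_hom (lift \<zero>\<^bsub>Y\<^esub>) L.kernel_zero (ZeroIso D)"
  by (simp add: L.kernel_hom_def lift_def L.kernel_zero_def null_Zero)

lemma kernel_hom_lift_ActIso: "r \<in> Obj R \<Longrightarrow> y \<in> Obj Y \<Longrightarrow>
    L.kernel_hom (lift (r \<odot>\<^bsub>Y\<^esub> y)) (L.kernel_act r (lift y)) (ActIso D r y)"
  by (simp add: L.kernel_hom_def lift_def L.kernel_act_def null_ActO)

text \<open>Read in the kernel, the side condition on a representative says just that it is an arrow from \<open>P\<close> to the sum of
  \<open>lift (fst p)\<close> and \<open>Q\<close>.\<close>

definition kernel_rep :: "'y \<times> 'xx \<Rightarrow> 'x \<times> 'm \<Rightarrow> 'x \<times> 'm \<Rightarrow> bool"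
  where "kernel_rep p P Q \<longleftrightarrow> fst p \<in> Obj Y \<and> L.kernel_obj Q \<and>
    L.kernel_hom P (L.kernel_add (lift (fst p)) Q) (snd p)"

lemma kernel_rep_represents: "kernel_rep p P Q \<Longrightarrow> D.represents p (fst P) (fst Q)"
  by (auto simp: kernel_rep_def D.represents_def L.kernel_hom_def L.kernel_obj_def)

lemma kernel_rep_ind:
  assumes Q: "L.kernel_obj Q" and f: "L.kernel_hom P Q f"
  shows "kernel_rep (D.ind_rep (fst Q) f) P Q"
proof -
  have 1: "L.kernel_hom Q (L.kernel_add L.kernel_zero Q) (Inv X (LUnit X (fst Q)))"
    by (rule L.kernel_hom_Inv[OF Q L.kernel_hom_LUnit[OF Q]])
  have 2: "L.kernel_hom (L.kernel_add L.kernel_zero Q) (L.kernel_add (lift \<zero>\<^bsub>Y\<^esub>) Q)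
     (Inv X (ZeroIso D) \<boxplus>\<^bsub>X\<^esub> \<iota>\<^bsub>X\<^esub> (fst Q))"
    using Q by (intro L.kernel_hom_AddA L.kernel_hom_Inv L.kernel_hom_Ide kernel_hom_lift_ZeroIso) simp_all
  show ?thesis
    unfolding kernel_rep_def D.ind_rep_def using Q
    by (auto intro!: L.kernel_hom_Comp[OF _ L.kernel_hom_Comp[OF _ f 1] 2])
qed

lemma kernel_rep_add:
  assumes p: "kernel_rep p P Q" and q: "kernel_rep q P' Q'"
  shows "kernel_rep (D.add_rep (fst Q) (fst Q') p q) (L.kernel_add P P') (L.kernel_add Q Q')"
proof -
  have o: "fst p \<in> Obj Y" "fst q \<in> Obj Y" "L.kernel_obj Q" "L.kernel_obj Q'"
    and h: "L.kernel_hom P (L.kernel_add (lift (fst p)) Q) (snd p)" "L.kernel_hom P' (L.kernel_add (lift (fst q)) Q') (snd q)"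
    using p q by (simp_all add: kernel_rep_def)
  have 1: "L.kernel_hom (L.kernel_add P P') (L.kernel_add (L.kernel_add (lift (fst p)) Q) (L.kernel_add (lift (fst q)) Q'))
     (snd p \<boxplus>\<^bsub>X\<^esub> snd q)"
    using o h by (intro L.kernel_hom_AddA) simp_all
  have 2: "L.kernel_hom (L.kernel_add (L.kernel_add (lift (fst p)) Q) (L.kernel_add (lift (fst q)) Q'))
     (L.kernel_add (L.kernel_add (lift (fst p)) (lift (fst q))) (L.kernel_add Q Q'))
     (Interchange X (OMap D (fst p)) (fst Q) (OMap D (fst q)) (fst Q'))"
    using o L.kernel_hom_Interchange[of "lift (fst p)" Q "lift (fst q)" Q'] by simp
  have 3: "L.kernel_hom (L.kernel_add (L.kernel_add (lift (fst p)) (lift (fst q))) (L.kernel_add Q Q'))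
     (L.kernel_add (lift (fst p \<oplus>\<^bsub>Y\<^esub> fst q)) (L.kernel_add Q Q')) (Inv X (AddIso D (fst p) (fst q)) \<boxplus>\<^bsub>X\<^esub> \<iota>\<^bsub>X\<^esub> (fst Q \<oplus>\<^bsub>X\<^esub> fst Q'))"
    using o L.kernel_hom_Ide[of "L.kernel_add Q Q'"]
    by (intro L.kernel_hom_AddA L.kernel_hom_Inv kernel_hom_lift_AddIso) simp_all
  show ?thesis
    unfolding kernel_rep_def D.add_rep_def using o
    by (auto intro!: L.kernel_hom_Comp[OF _ L.kernel_hom_Comp[OF _ 1 2] 3])
qed

lemma kernel_rep_act:
  assumes p: "kernel_rep p P Q" and r: "r \<in> Obj R"
  shows "kernel_rep (D.act_rep r (fst Q) p) (L.kernel_act r P) (L.kernel_act r Q)"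
proof -
  have o: "fst p \<in> Obj Y" "L.kernel_obj Q"
    and h: "L.kernel_hom P (L.kernel_add (lift (fst p)) Q) (snd p)"
    using p by (simp_all add: kernel_rep_def)
  have 1: "L.kernel_hom (L.kernel_act r P) (L.kernel_act r (L.kernel_add (lift (fst p)) Q)) (\<iota>\<^bsub>R\<^esub> r \<boxdot>\<^bsub>X\<^esub> snd p)"
    using o h r by (intro L.kernel_hom_ActA) simp_all
  have 2: "L.kernel_hom (L.kernel_act r (L.kernel_add (lift (fst p)) Q)) (L.kernel_add (L.kernel_act r (lift (fst p))) (L.kernel_act r Q))
     (ActAdd X r (OMap D (fst p)) (fst Q))"
    using o r L.kernel_hom_ActAdd[of "lift (fst p)" Q r] by simp
  have 3: "L.kernel_hom (L.kernel_add (L.kernel_act r (lift (fst p))) (L.kernel_act r Q))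
     (L.kernel_add (lift (r \<odot>\<^bsub>Y\<^esub> fst p)) (L.kernel_act r Q)) (Inv X (ActIso D r (fst p)) \<boxplus>\<^bsub>X\<^esub> \<iota>\<^bsub>X\<^esub> (r \<odot>\<^bsub>X\<^esub> fst Q))"
    using o r L.kernel_hom_Ide[of "L.kernel_act r Q"]
    by (intro L.kernel_hom_AddA L.kernel_hom_Inv kernel_hom_lift_ActIso) simp_all
  show ?thesis
    unfolding kernel_rep_def D.act_rep_def using o r
    by (auto intro!: L.kernel_hom_Comp[OF _ L.kernel_hom_Comp[OF _ 1 2] 3])
qed

lemma kernel_rep_opposite:
  assumes p: "kernel_rep p P Q" and P: "L.kernel_obj P" and y: "y \<in> Obj Y" "\<guillemotleft>e : y \<oplus>\<^bsub>Y\<^esub> fst p \<rightarrow>\<^bsub>Y\<^esub> \<zero>\<^bsub>Y\<^esub>\<guillemotright>"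
  shows "kernel_rep (D.opposite_rep (fst Q) y e p) Q P"
proof -
  have o: "fst p \<in> Obj Y" "L.kernel_obj Q"
    and h: "L.kernel_hom P (L.kernel_add (lift (fst p)) Q) (snd p)"
    using p by (simp_all add: kernel_rep_def)
  have e: "e \<in> Arr Y" "Src Y e = y \<oplus>\<^bsub>Y\<^esub> fst p" "Tgt Y e = \<zero>\<^bsub>Y\<^esub>" using y by (auto simp: in_hom_def)
  have 1: "L.kernel_hom Q (L.kernel_add L.kernel_zero Q) (Inv X (LUnit X (fst Q)))"
    by (rule L.kernel_hom_Inv[OF o(2) L.kernel_hom_LUnit[OF o(2)]])
  have 2: "L.kernel_hom (L.kernel_add L.kernel_zero Q) (L.kernel_add (lift \<zero>\<^bsub>Y\<^esub>) Q)
     (Inv X (ZeroIso D) \<boxplus>\<^bsub>X\<^esub> \<iota>\<^bsub>X\<^esub> (fst Q))"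
    using o by (intro L.kernel_hom_AddA L.kernel_hom_Inv L.kernel_hom_Ide kernel_hom_lift_ZeroIso) simp_all
  have 3: "L.kernel_hom (L.kernel_add (lift \<zero>\<^bsub>Y\<^esub>) Q) (L.kernel_add (lift (y \<oplus>\<^bsub>Y\<^esub> fst p)) Q)
     (AMap D (Inv Y e) \<boxplus>\<^bsub>X\<^esub> \<iota>\<^bsub>X\<^esub> (fst Q))"
    using o e y kernel_hom_lift_AMap[of "Inv Y e"] by (intro L.kernel_hom_AddA L.kernel_hom_Ide) simp_all
  have 4: "L.kernel_hom (L.kernel_add (lift (y \<oplus>\<^bsub>Y\<^esub> fst p)) Q) (L.kernel_add (L.kernel_add (lift y) (lift (fst p))) Q)
     (AddIso D y (fst p) \<boxplus>\<^bsub>X\<^esub> \<iota>\<^bsub>X\<^esub> (fst Q))"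
    using o y by (intro L.kernel_hom_AddA L.kernel_hom_Ide kernel_hom_lift_AddIso) simp_all
  have 5: "L.kernel_hom (L.kernel_add (L.kernel_add (lift y) (lift (fst p))) Q) (L.kernel_add (lift y) (L.kernel_add (lift (fst p)) Q))
     (Assoc X (OMap D y) (OMap D (fst p)) (fst Q))"
    using o y L.kernel_hom_Assoc[of "lift y" "lift (fst p)" Q] by simp
  have 6: "L.kernel_hom (L.kernel_add (lift y) (L.kernel_add (lift (fst p)) Q)) (L.kernel_add (lift y) P)
     (\<iota>\<^bsub>X\<^esub> (OMap D y) \<boxplus>\<^bsub>X\<^esub> Inv X (snd p))"
    using o y P h L.kernel_hom_Ide[of "lift y"] by (intro L.kernel_hom_AddA L.kernel_hom_Inv) simp_all
  show ?thesis
    unfolding kernel_rep_def D.opposite_rep_def using o P y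
    by (auto intro!: L.kernel_hom_Comp[OF _ L.kernel_hom_Comp[OF _ L.kernel_hom_Comp[OF _
        L.kernel_hom_Comp[OF _ L.kernel_hom_Comp[OF _ 1 2] 3] 4] 5] 6])
qed

text \<open>The condition on objects of the cohomology says that the trivialisation is itself an arrow to zero in
  the next kernel. In this form, closure under the operations is a matter of composing arrows.\<close>

definition cocycle :: "'y \<times> 'xx \<Rightarrow> bool"
  where "cocycle P \<longleftrightarrow> D.kernel_obj P \<and> L.kernel_hom (lift (fst P)) L.kernel_zero (snd P)"

lemma cocycle_iff:
  "cocycle P \<longleftrightarrow> D.kernel_obj P \<and> ZeroIso L \<cdot> AMap L (snd P) = \<nu> (fst P)"
  by (auto simp: cocycle_def D.kernel_obj_def L.kernel_hom_def L.kernel_zero_def lift_def)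

lemma cocycle_zero: "cocycle D.kernel_zero"
  using kernel_hom_lift_ZeroIso by (simp add: cocycle_def, simp add: D.kernel_zero_def)

lemma cocycle_add:
  assumes P: "cocycle P" and Q: "cocycle Q" shows "cocycle (D.kernel_add P Q)"
proof -
  have o: "fst P \<in> Obj Y" "fst Q \<in> Obj Y" "D.kernel_obj P" "D.kernel_obj Q"
    using P Q by (auto simp: cocycle_def D.kernel_objD)
  have 1: "L.kernel_hom (L.kernel_add (lift (fst P)) (lift (fst Q))) (L.kernel_add L.kernel_zero L.kernel_zero) (snd P \<boxplus>\<^bsub>X\<^esub> snd Q)"
    using P Q by (intro L.kernel_hom_AddA) (auto simp: cocycle_def)
  have 2: "L.kernel_hom (L.kernel_add L.kernel_zero L.kernel_zero) L.kernel_zero (LUnit X \<zero>\<^bsub>X\<^esub>)"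
    using L.kernel_hom_LUnit[OF L.kernel_obj_zero] by simp
  have "L.kernel_hom (lift (fst P \<oplus>\<^bsub>Y\<^esub> fst Q)) L.kernel_zero
     (LUnit X \<zero>\<^bsub>X\<^esub> \<cdot>\<^bsub>X\<^esub> (snd P \<boxplus>\<^bsub>X\<^esub> snd Q) \<cdot>\<^bsub>X\<^esub> AddIso D (fst P) (fst Q))"
    using o by (intro L.kernel_hom_Comp[OF _ L.kernel_hom_Comp[OF _ kernel_hom_lift_AddIso 1] 2]) simp_all
  then show ?thesis using o by (simp add: cocycle_def, simp add: D.kernel_add_def)
qed

lemma cocycle_act:
  assumes P: "cocycle P" and r: "r \<in> Obj R" shows "cocycle (D.kernel_act r P)"
proof -
  have o: "fst P \<in> Obj Y" "D.kernel_obj P"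
    using P by (auto simp: cocycle_def D.kernel_objD)
  have 1: "L.kernel_hom (L.kernel_act r (lift (fst P))) (L.kernel_act r L.kernel_zero) (\<iota>\<^bsub>R\<^esub> r \<boxdot>\<^bsub>X\<^esub> snd P)"
    using P r by (intro L.kernel_hom_ActA) (auto simp: cocycle_def)
  have "L.kernel_hom (lift (r \<odot>\<^bsub>Y\<^esub> fst P)) L.kernel_zero
     (ActZero X r \<cdot>\<^bsub>X\<^esub> (\<iota>\<^bsub>R\<^esub> r \<boxdot>\<^bsub>X\<^esub> snd P) \<cdot>\<^bsub>X\<^esub> ActIso D r (fst P))"
    using o r by (intro L.kernel_hom_Comp[OF _ L.kernel_hom_Comp[OF _ kernel_hom_lift_ActIso 1] L.kernel_hom_ActZero]) simp_all
  then show ?thesis using o r by (simp add: cocycle_def, simp add: D.kernel_act_def)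
qed

end

section \<open>Cohomology\<close>

lemma (in cochain_complex) null_sequence_at:
  "null_sequence R (Mod C k) (Mod C (k + 1)) (Mod C (k + 2)) (Dif C k) (Dif C (k + 1)) (Nul C k)"
  using Dif_hom[of k] Dif_hom[of "k + 1"] Nul_two_morphism[of k]
  by (intro null_sequence.intro null_sequence_axioms.intro module_hom.intro) (simp_all add: add.commute)

locale complex_at_degree = cochain_complex R C
  for R :: "('r, 's) ring_data" and C :: "('r, 's, 'o, 'm) complex_data" +
  fixes n :: int
begin

lemma Dif_hom_lower: "two_module_hom R (Mod C (n - 2)) (Mod C (n - 1)) (Dif C (n - 2))"
  "two_module_hom R (Mod C (n - 1)) (Mod C n) (Dif C (n - 1))"
  using Dif_hom[of "n - 2"] Dif_hom[of "n - 1"] by simp_all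

lemma Nul_lower: "two_morphism R (Mod C (n - 2)) (Mod C n)
      (comp_hom (Mod C n) (Dif C (n - 1)) (Dif C (n - 2))) (zero_hom (Mod C n)) (Nul C (n - 2))"
  "two_morphism R (Mod C (n - 1)) (Mod C (n + 1))
      (comp_hom (Mod C (n + 1)) (Dif C n) (Dif C (n - 1))) (zero_hom (Mod C (n + 1))) (Nul C (n - 1))"
  using Nul_two_morphism[of "n - 2"] Nul_two_morphism[of "n - 1"] by (simp_all add: add.commute)

end

text \<open>Of the null sequences around degree \<open>n\<close>, the first governs the equivalence of representatives, the
  second their side condition and the third the condition on objects.\<close>

sublocale complex_at_degree \<subseteq> S: null_sequence R "Mod C (n - 2)" "Mod C (n - 1)" "Mod C n"
  "Dif C (n - 2)" "Dif C (n - 1)" "Nul C (n - 2)"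
  by (intro null_sequence.intro null_sequence_axioms.intro module_hom.intro Dif_hom_lower Nul_lower)

sublocale complex_at_degree \<subseteq> T: null_sequence R "Mod C (n - 1)" "Mod C n" "Mod C (n + 1)"
  "Dif C (n - 1)" "Dif C n" "Nul C (n - 1)"
  by (intro null_sequence.intro null_sequence_axioms.intro module_hom.intro Dif_hom Dif_hom_lower Nul_lower)

sublocale complex_at_degree \<subseteq> W: null_sequence R "Mod C n" "Mod C (n + 1)" "Mod C (n + 2)"
  "Dif C n" "Dif C (n + 1)" "Nul C n"
  by (rule null_sequence_at)

context complex_at_degree
begin

lemma coh_ops:
  "coh_addO C n = T.L.kernel_add" "coh_zero C n = T.L.kernel_zero" "coh_actO R C n = T.L.kernel_act"
  by (auto simp: fun_eq_iff coh_addO_def T.L.kernel_add_def coh_zero_def T.L.kernel_zero_def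
      coh_actO_def T.L.kernel_act_def)

lemma coh_Obj_kernel_obj: "P \<in> coh_Obj C n \<Longrightarrow> T.L.kernel_obj P"
  by (auto simp: coh_Obj_def T.L.kernel_obj_def in_hom_def)

lemma coh_Obj_cocycle: "P \<in> coh_Obj C n \<longleftrightarrow> W.cocycle P"
  by (auto simp: coh_Obj_def W.cocycle_iff T.L.kernel_obj_def in_hom_def)

lemma coh_pairs_iff:
  assumes Q: "T.L.kernel_obj Q" shows "p \<in> coh_pairs C n P Q \<longleftrightarrow> T.kernel_rep p P Q"
proof -
  note t = T.L.kernel_objD[OF Q]
  show ?thesis
    using Q
    by (cases p) (auto simp: coh_pairs_def T.kernel_rep_def T.L.kernel_hom_def in_hom_def
      T.L.kernel_add_def T.lift_def t)
qed

text \<open>The four factors in the definition of the equivalence merge into the sum of one inessential arrow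
  and an identity.\<close>

lemma coh_equiv_iff:
  assumes p: "S.L.represents p a (fst Q)" and p': "fst p' \<in> Obj (Mod C (n - 1))"
  shows "coh_equiv C n Q p p' \<longleftrightarrow> S.eqv (fst Q) p p'"
proof -
  note t = S.L.representsD[OF p] p'
  have "coh_equiv C n Q p p' \<longleftrightarrow> (\<exists>y\<in>Obj (Mod C (n - 2)). \<exists>f.
      \<guillemotleft>f : fst p \<rightarrow>\<^bsub>Mod C (n - 1)\<^esub> OMap (Dif C (n - 2)) y \<oplus>\<^bsub>Mod C (n - 1)\<^esub> fst p'\<guillemotright> \<and>
      snd p' = ((S.absorb y (fst p') \<cdot>\<^bsub>Mod C n\<^esub> AMap (Dif C (n - 1)) f) \<boxplus>\<^bsub>Mod C n\<^esub> \<iota>\<^bsub>Mod C n\<^esub> (fst Q)) \<cdot>\<^bsub>Mod C n\<^esub> snd p)"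
    unfolding coh_equiv_def Let_def
    by (intro bex_cong ex_cong1 conj_cong refl) (use t in \<open>simp add: in_hom_def S.absorb_def\<close>)
  also have "\<dots> \<longleftrightarrow> S.eqv (fst Q) p p'"
    unfolding S.eqv_def S.inessential_def in_hom_def using p' by blast
  finally show ?thesis .
qed

lemma coh_class_eq:
  assumes p: "S.L.represents p a (fst Q)" and Q: "T.L.kernel_obj Q"
  shows "coh_class C n P Q p = {p'. T.kernel_rep p' P Q \<and> S.eqv (fst Q) p p'}"
  using coh_equiv_iff[OF p] by (auto simp: coh_class_def coh_pairs_iff[OF Q] T.kernel_rep_def)

lemma coh_class_cong:
  assumes p: "S.L.represents p a (fst Q)" and Q: "T.L.kernel_obj Q" and e: "S.eqv (fst Q) p p'"
  shows "coh_class C n P Q p = coh_class C n P Q p'"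
proof -
  have p': "S.L.represents p' a (fst Q)" by (rule S.eqv_represents[OF e p])
  show ?thesis
    unfolding coh_class_eq[OF p Q] coh_class_eq[OF p' Q]
    using S.eqv_trans[OF p e] S.eqv_trans[OF p' S.eqv_sym[OF p e]] by blast
qed

lemma coh_class_memberD:
  assumes p: "S.L.represents p a (fst Q)" and Q: "T.L.kernel_obj Q" and p': "p' \<in> coh_class C n P Q p"
  shows "S.eqv (fst Q) p p'" "S.L.represents p' a (fst Q)"
  using p' S.eqv_represents[OF _ p] by (auto simp: coh_class_eq[OF p Q])

lemma coh_class_self:
  assumes p: "T.kernel_rep p P Q" shows "p \<in> coh_class C n P Q p"
  using p S.eqv_refl[OF T.kernel_rep_represents[OF p]] 
  by (auto simp: coh_class_eq[OF T.kernel_rep_represents[OF p]] T.kernel_rep_def)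

definition cls :: "'o \<times> 'm \<Rightarrow> 'o \<times> 'm \<Rightarrow> 'o \<times> 'm \<Rightarrow> ('o, 'm) coh_arr"
  where "cls P Q p = (P, coh_class C n P Q p, Q)"

lemma cls_cong:
  assumes "S.L.represents p a (fst Q)" "T.L.kernel_obj Q" "S.eqv (fst Q) p p'"
  shows "cls P Q p = cls P Q p'"
  using coh_class_cong[OF assms] by (simp add: cls_def)

lemma cls_Arr: "P \<in> coh_Obj C n \<Longrightarrow> Q \<in> coh_Obj C n \<Longrightarrow> T.kernel_rep p P Q \<Longrightarrow> cls P Q p \<in> coh_Arr C n"
  using coh_pairs_iff[OF coh_Obj_kernel_obj] unfolding coh_Arr_def cls_def by blast

lemma coh_Arr_cls:
  assumes "f \<in> coh_Arr C n"
  obtains P Q p where "P \<in> coh_Obj C n" "Q \<in> coh_Obj C n" "T.kernel_rep p P Q" "f = cls P Q p"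
  using assms coh_pairs_iff[OF coh_Obj_kernel_obj] unfolding coh_Arr_def cls_def by blast

lemma coh_ind_cls: "coh_ind C n P Q f = cls P Q (S.L.ind_rep (fst Q) f)"
  by (simp add: coh_ind_def cls_def S.L.ind_rep_def)

text \<open>Operations on classes are unions over representatives; they collapse once the result does not
  depend on the choice.\<close>

lemma UN_eq_const:
  assumes "p \<in> c" "\<And>p'. p' \<in> c \<Longrightarrow> g p' = G" shows "(\<Union>p\<in>c. g p) = G"
  using assms by auto

lemma coh_comp_cls:
  assumes p: "T.kernel_rep p P Q" and q: "T.kernel_rep q Q S"
  shows "coh_comp C n (cls Q S q) (cls P Q p) = cls P S (S.L.comp_rep (fst S) q p)"
proof -
  have o: "T.L.kernel_obj Q" "T.L.kernel_obj S" using p q by (simp_all add: T.kernel_rep_def)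
  note rp = T.kernel_rep_represents[OF p] and rq = T.kernel_rep_represents[OF q]
  have g: "coh_class C n P S (S.L.comp_rep (fst S) q' p') = coh_class C n P S (S.L.comp_rep (fst S) q p)"
    if "q' \<in> coh_class C n Q S q" "p' \<in> coh_class C n P Q p" for p' q'
    using coh_class_cong[OF S.L.represents_comp[OF rp rq] o(2)
        S.eqv_comp[OF rp rq coh_class_memberD(1)[OF rp o(1) that(2)] coh_class_memberD(1)[OF rq o(2) that(1)]]] ..
  have "coh_comp C n (cls Q S q) (cls P Q p) = (P, \<Union>q'\<in>coh_class C n Q S q. \<Union>p'\<in>coh_class C n P Q p.
      coh_class C n P S (S.L.comp_rep (fst S) q' p'), S)"
    by (simp add: cls_def Let_def S.L.comp_rep_def case_prod_beta)
  also have "(\<Union>q'\<in>coh_class C n Q S q. \<Union>p'\<in>coh_class C n P Q p. coh_class C n P S (S.L.comp_rep (fst S) q' p'))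
     = coh_class C n P S (S.L.comp_rep (fst S) q p)"
    by (intro UN_eq_const[OF coh_class_self[OF q]] UN_eq_const[OF coh_class_self[OF p]] g)
  finally show ?thesis by (simp only: cls_def)
qed

lemma coh_addA_cls:
  assumes p: "T.kernel_rep p P Q" and q: "T.kernel_rep q P' Q'"
  shows "coh_addA C n (cls P Q p) (cls P' Q' q)
    = cls (T.L.kernel_add P P') (T.L.kernel_add Q Q') (S.L.add_rep (fst Q) (fst Q') p q)"
proof -
  have o: "T.L.kernel_obj Q" "T.L.kernel_obj Q'" using p q by (simp_all add: T.kernel_rep_def)
  let ?P = "T.L.kernel_add P P'" and ?Q = "T.L.kernel_add Q Q'"
  note rp = T.kernel_rep_represents[OF p] and rq = T.kernel_rep_represents[OF q]
  have r: "S.L.represents (S.L.add_rep (fst Q) (fst Q') p q) (fst P \<oplus>\<^bsub>Mod C n\<^esub> fst P') (fst ?Q)"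
    using S.L.represents_add[OF rp rq] by simp
  have g: "coh_class C n ?P ?Q (S.L.add_rep (fst Q) (fst Q') p' q') = coh_class C n ?P ?Q (S.L.add_rep (fst Q) (fst Q') p q)"
    if "p' \<in> coh_class C n P Q p" "q' \<in> coh_class C n P' Q' q" for p' q'
    using coh_class_cong[OF r] o
        S.eqv_add[OF rp rq coh_class_memberD(1)[OF rp o(1) that(1)] coh_class_memberD(1)[OF rq o(2) that(2)]] by simp
  have "coh_addA C n (cls P Q p) (cls P' Q' q) = (?P, \<Union>p'\<in>coh_class C n P Q p. \<Union>q'\<in>coh_class C n P' Q' q.
      coh_class C n ?P ?Q (S.L.add_rep (fst Q) (fst Q') p' q'), ?Q)"
    by (simp add: cls_def coh_ops Let_def S.L.add_rep_def case_prod_beta)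
  also have "(\<Union>p'\<in>coh_class C n P Q p. \<Union>q'\<in>coh_class C n P' Q' q. coh_class C n ?P ?Q (S.L.add_rep (fst Q) (fst Q') p' q'))
     = coh_class C n ?P ?Q (S.L.add_rep (fst Q) (fst Q') p q)"
    by (intro UN_eq_const[OF coh_class_self[OF q]] UN_eq_const[OF coh_class_self[OF p]] g)
  finally show ?thesis by (simp only: cls_def)
qed

lemma coh_actA_cls:
  assumes p: "T.kernel_rep p P Q" and r: "r \<in> Obj R"
  shows "coh_actA R C n (\<iota>\<^bsub>R\<^esub> r) (cls P Q p)
    = cls (T.L.kernel_act r P) (T.L.kernel_act r Q) (S.L.act_rep r (fst Q) p)"
proof -
  have o: "T.L.kernel_obj Q" using p by (simp_all add: T.kernel_rep_def)
  let ?P = "T.L.kernel_act r P" and ?Q = "T.L.kernel_act r Q"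
  note rp = T.kernel_rep_represents[OF p]
  have r': "S.L.represents (S.L.act_rep r (fst Q) p) (r \<odot>\<^bsub>Mod C n\<^esub> fst P) (fst ?Q)"
    using S.L.represents_act[OF rp r] by simp
  have g: "coh_class C n ?P ?Q (S.L.act_rep r (fst Q) p') = coh_class C n ?P ?Q (S.L.act_rep r (fst Q) p)"
    if "p' \<in> coh_class C n P Q p" for p'
    using coh_class_cong[OF r'] o r S.eqv_act[OF rp r coh_class_memberD(1)[OF rp o(1) that(1)]] by simp
  have "coh_actA R C n (\<iota>\<^bsub>R\<^esub> r) (cls P Q p)
     = (?P, \<Union>p'\<in>coh_class C n P Q p. coh_class C n ?P ?Q (S.L.act_rep r (fst Q) p'), ?Q)"
    using r by (simp add: cls_def coh_ops Let_def S.L.act_rep_def case_prod_beta)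
  also have "(\<Union>p'\<in>coh_class C n P Q p. coh_class C n ?P ?Q (S.L.act_rep r (fst Q) p'))
     = coh_class C n ?P ?Q (S.L.act_rep r (fst Q) p)"
    by (intro UN_eq_const[OF coh_class_self[OF p]] g)
  finally show ?thesis by (simp only: cls_def)
qed

lemma cohomology_simps:
  "Obj (cohomology R C n) = coh_Obj C n" "Arr (cohomology R C n) = coh_Arr C n"
  "Src (cohomology R C n) (cls P Q p) = P" "Tgt (cohomology R C n) (cls P Q p) = Q"
  "\<iota>\<^bsub>cohomology R C n\<^esub> P = cls P P (S.L.ind_rep (fst P) (\<iota>\<^bsub>Mod C n\<^esub> (fst P)))"
  "Comp (cohomology R C n) = coh_comp C n"
  "AddO (cohomology R C n) = T.L.kernel_add" "AddA (cohomology R C n) = coh_addA C n"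
  "Zero (cohomology R C n) = T.L.kernel_zero"
  "ActO (cohomology R C n) = T.L.kernel_act" "ActA (cohomology R C n) = coh_actA R C n"
  by (simp_all add: cohomology_def Let_def coh_ops coh_ind_cls, simp_all add: cls_def)

lemma ex_inverse_arrows_cls:
  assumes P: "P \<in> coh_Obj C n" and Q: "Q \<in> coh_Obj C n" and p: "T.kernel_rep p P Q"
  shows "\<exists>g. inverse_arrows (cohomology R C n) (cls P Q p) g"
proof -
  note kP = coh_Obj_kernel_obj[OF P] and kQ = coh_Obj_kernel_obj[OF Q] and rp = T.kernel_rep_represents[OF p]
  obtain x e where x: "x \<in> Obj (Mod C (n - 1))" "\<guillemotleft>e : x \<oplus>\<^bsub>Mod C (n - 1)\<^esub> fst p \<rightarrow>\<^bsub>Mod C (n - 1)\<^esub> \<zero>\<^bsub>Mod C (n - 1)\<^esub>\<guillemotright>"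
    using S.ex_opposite_left[of "fst p"] p by (auto simp: T.kernel_rep_def)
  let ?q = "S.L.opposite_rep (fst Q) x e p"
  have q: "T.kernel_rep ?q Q P" by (rule T.kernel_rep_opposite[OF p kP x])
  note rq = T.kernel_rep_represents[OF q]
  have "inverse_arrows (cohomology R C n) (cls P Q p) (cls Q P ?q)"
    unfolding inverse_arrows_def in_hom_def cohomology_simps coh_comp_cls[OF p q] coh_comp_cls[OF q p]
    using cls_Arr[OF P Q p] cls_Arr[OF Q P q]
      cls_cong[OF S.L.represents_comp[OF rp rq] kP S.eqv_opposite_comp[OF rp x]]
      cls_cong[OF S.L.represents_comp[OF rq rp] kQ S.eqv_comp_opposite[OF rp x]] by auto
  then show ?thesis ..
qed

text \<open>Composing with an induced arrow adds the summand \<open>\<zero>\<close> to the first component, and a unit isomorphism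
  removes it again.\<close>

lemma coh_comp_ind_left:
  assumes p: "T.kernel_rep p P Q" and S: "T.L.kernel_obj S" and f: "T.L.kernel_hom Q S f"
  shows "coh_comp C n (coh_ind C n Q S f) (cls P Q p)
    = cls P S (fst p, (\<iota>\<^bsub>Mod C n\<^esub> (OMap (Dif C (n - 1)) (fst p)) \<boxplus>\<^bsub>Mod C n\<^esub> f) \<cdot>\<^bsub>Mod C n\<^esub> snd p)"
proof -
  note q = T.kernel_rep_ind[OF S f]
  note rp = T.kernel_rep_represents[OF p] and rq = T.kernel_rep_represents[OF q]
  show ?thesis
    unfolding coh_ind_cls coh_comp_cls[OF p q]
    by (intro cls_cong[OF S.L.represents_comp[OF rp rq] S] S.eqv_ind_comp[OF rp]) (use T.L.kernel_homD[OF f] in auto)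
qed

lemma coh_comp_ind_right:
  assumes p: "T.kernel_rep p Q S" and Q: "T.L.kernel_obj Q" and f: "T.L.kernel_hom P Q f"
  shows "coh_comp C n (cls Q S p) (coh_ind C n P Q f) = cls P S (fst p, snd p \<cdot>\<^bsub>Mod C n\<^esub> f)"
proof -
  note q = T.kernel_rep_ind[OF Q f]
  note rp = T.kernel_rep_represents[OF p] and rq = T.kernel_rep_represents[OF q]
  have S: "T.L.kernel_obj S" using p by (simp add: T.kernel_rep_def)
  show ?thesis
    unfolding coh_ind_cls coh_comp_cls[OF q p]
    by (intro cls_cong[OF S.L.represents_comp[OF rq rp] S] S.eqv_comp_ind[OF rp]) (use T.L.kernel_homD[OF f] in auto)
qed

end

section \<open>Morphisms of complexes\<close>

text \<open>A square of homomorphisms that commutes up to \<open>\<beta>\<close> maps the kernel of \<open>L\<close> to the kernel of \<open>L'\<close> and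
  representatives over \<open>L\<close> to representatives over \<open>L'\<close>.\<close>

locale hom_square = L: module_hom R X M L + L': module_hom R X' M' L' +
  g: module_hom R X X' g + h: module_hom R M M' h
  for R :: "('r, 's) ring_data" and X :: "('r, 's, 'x, 'xx) mod_data" and M :: "('r, 's, 'o, 'm) mod_data" and L
    and X' :: "('r, 's, 'x2, 'xx2) mod_data" and M' :: "('r, 's, 'o2, 'm2) mod_data" (structure) and L' and g and h +
  fixes \<beta> :: "'x \<Rightarrow> 'm2"
  assumes square: "two_morphism R X M' (comp_hom M' h L) (comp_hom M' L' g) \<beta>"
begin

lemma square_type [simp]:
  assumes "x \<in> Obj X"
  shows "\<beta> x \<in> Arr M'" "Src M' (\<beta> x) = OMap h (OMap L x)" "Tgt M' (\<beta> x) = OMap L' (OMap g x)"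
  using square assms by (auto simp: two_morphism_def comp_hom_def in_hom_def)

lemma square_nat: "f \<in> Arr X \<Longrightarrow> \<beta> (Tgt X f) \<cdot> AMap h (AMap L f) = AMap L' (AMap g f) \<cdot> \<beta> (Src X f)"
  using square by (auto simp: two_morphism_def comp_hom_def)

lemma square_AddO:
  assumes o: "x \<in> Obj X" "y \<in> Obj X"
  shows "AddIso L' (OMap g x) (OMap g y) \<cdot> AMap L' (AddIso g x y) \<cdot> \<beta> (x \<oplus>\<^bsub>X\<^esub> y)
    = (\<beta> x \<boxplus> \<beta> y) \<cdot> AddIso h (OMap L x) (OMap L y) \<cdot> AMap h (AddIso L x y)"
proof -
  have "(AddIso L' (OMap g x) (OMap g y) \<cdot> AMap L' (AddIso g x y)) \<cdot> \<beta> (x \<oplus>\<^bsub>X\<^esub> y)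
    = (\<beta> x \<boxplus> \<beta> y) \<cdot> AddIso h (OMap L x) (OMap L y) \<cdot> AMap h (AddIso L x y)"
    using square o by (simp add: two_morphism_def comp_hom_def del: L'.B.A.Comp_assoc_right)
  then show ?thesis using o by simp
qed

lemma square_Zero: "ZeroIso L' \<cdot> AMap L' (ZeroIso g) \<cdot> \<beta> \<zero>\<^bsub>X\<^esub> = ZeroIso h \<cdot> AMap h (ZeroIso L)"
proof -
  have "(ZeroIso L' \<cdot> AMap L' (ZeroIso g)) \<cdot> \<beta> \<zero>\<^bsub>X\<^esub> = ZeroIso h \<cdot> AMap h (ZeroIso L)"
    using square by (simp add: two_morphism_def comp_hom_def del: L'.B.A.Comp_assoc_right)
  then show ?thesis by simp
qed

lemma square_ActO:
  assumes o: "r \<in> Obj R" "x \<in> Obj X"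
  shows "ActIso L' r (OMap g x) \<cdot> AMap L' (ActIso g r x) \<cdot> \<beta> (r \<odot>\<^bsub>X\<^esub> x)
    = (\<iota>\<^bsub>R\<^esub> r \<boxdot> \<beta> x) \<cdot> ActIso h r (OMap L x) \<cdot> AMap h (ActIso L r x)"
proof -
  have "(ActIso L' r (OMap g x) \<cdot> AMap L' (ActIso g r x)) \<cdot> \<beta> (r \<odot>\<^bsub>X\<^esub> x)
    = (\<iota>\<^bsub>R\<^esub> r \<boxdot> \<beta> x) \<cdot> ActIso h r (OMap L x) \<cdot> AMap h (ActIso L r x)"
    using square o by (simp add: two_morphism_def comp_hom_def del: L'.B.A.Comp_assoc_right)
  then show ?thesis using o by simp
qed

definition kernel_map :: "'x \<times> 'm \<Rightarrow> 'x2 \<times> 'm2"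
  where "kernel_map P = (OMap g (fst P), ZeroIso h \<cdot> AMap h (snd P) \<cdot> Inv M' (\<beta> (fst P)))"

definition map_rep :: "'o \<Rightarrow> 'x \<times> 'm \<Rightarrow> 'x2 \<times> 'm2"
  where "map_rep b p = (OMap g (fst p),
    (\<beta> (fst p) \<boxplus> \<iota> (OMap h b)) \<cdot> AddIso h (OMap L (fst p)) b \<cdot> AMap h (snd p))"

lemma represents_map: "L.represents p a b \<Longrightarrow> L'.represents (map_rep b p) (OMap h a) (OMap h b)"
  by (auto simp: L.represents_def L'.represents_def map_rep_def)

lemma fst_kernel_map [simp]: "fst (kernel_map P) = OMap g (fst P)" by (simp add: kernel_map_def)

lemma kernel_obj_map [simp]: "L.kernel_obj P \<Longrightarrow> L'.kernel_obj (kernel_map P)"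
  by (simp add: L.kernel_obj_def L'.kernel_obj_def kernel_map_def)

lemma kernel_hom_map:
  assumes Q: "L.kernel_obj Q" and f: "L.kernel_hom P Q f"
  shows "L'.kernel_hom (kernel_map P) (kernel_map Q) (AMap g f)"
proof -
  note t = L.kernel_objD[OF Q] L.kernel_homD(1-3,5)[OF f]
  have n: "Inv M' (\<beta> (fst Q)) \<cdot> AMap L' (AMap g f) = AMap h (AMap L f) \<cdot> Inv M' (\<beta> (fst P))"
    by (rule L'.B.A.Comp_cancel_left[of "\<beta> (fst Q)"], rule L'.B.A.Comp_cancel_right[where f = "\<beta> (fst P)"])
      (use t square_nat[of f] in simp_all)
  have "snd (kernel_map Q) \<cdot> AMap L' (AMap g f) = ZeroIso h \<cdot> AMap h (snd Q) \<cdot> (Inv M' (\<beta> (fst Q)) \<cdot> AMap L' (AMap g f))"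
    using t by (simp add: kernel_map_def)
  also have "\<dots> = ZeroIso h \<cdot> AMap h (snd Q \<cdot>\<^bsub>M\<^esub> AMap L f) \<cdot> Inv M' (\<beta> (fst P))"
    unfolding n using t by simp
  also have "\<dots> = snd (kernel_map P)" unfolding L.kernel_homD(4)[OF f] by (simp add: kernel_map_def)
  finally show ?thesis using t by (simp add: L'.kernel_hom_def)
qed

text \<open>The constraint of \<open>g\<close> is an arrow of the kernel because \<open>\<beta>\<close> is monoidal and the constraint of \<open>h\<close> is
  natural and compatible with the units.\<close>

lemma kernel_hom_map_AddIso:
  assumes P: "L.kernel_obj P" and Q: "L.kernel_obj Q"
  shows "L'.kernel_hom (kernel_map (L.kernel_add P Q)) (L'.kernel_add (kernel_map P) (kernel_map Q)) (AddIso g (fst P) (fst Q))"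
proof -
  note t = L.kernel_objD[OF P] L.kernel_objD[OF Q]
  let ?x = "fst P" and ?y = "fst Q" and ?z = "\<zero>"
  let ?w = "AMap h (AddIso L ?x ?y) \<cdot> Inv M' (\<beta> (?x \<oplus>\<^bsub>X\<^esub> ?y))"
  have a: "AddIso L' (OMap g ?x) (OMap g ?y) \<cdot> AMap L' (AddIso g ?x ?y)
    = (\<beta> ?x \<boxplus> \<beta> ?y) \<cdot> AddIso h (OMap L ?x) (OMap L ?y) \<cdot> ?w"
    by (rule L'.B.A.Comp_cancel_right[where f = "\<beta> (?x \<oplus>\<^bsub>X\<^esub> ?y)"])
      (use t square_AddO[of ?x ?y] in simp_all)
  have "snd (L'.kernel_add (kernel_map P) (kernel_map Q)) \<cdot> AMap L' (AddIso g ?x ?y)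
    = LUnit M' ?z \<cdot> ((ZeroIso h \<cdot> AMap h (snd P) \<cdot> Inv M' (\<beta> ?x)) \<boxplus> (ZeroIso h \<cdot> AMap h (snd Q) \<cdot> Inv M' (\<beta> ?y)))
      \<cdot> (AddIso L' (OMap g ?x) (OMap g ?y) \<cdot> AMap L' (AddIso g ?x ?y))"
    using t by (simp add: L'.kernel_add_def kernel_map_def)
  also have "\<dots> = (LUnit M' ?z \<cdot> (\<iota> ?z \<boxplus> ZeroIso h)) \<cdot> (ZeroIso h \<boxplus> \<iota> (OMap h \<zero>\<^bsub>M\<^esub>))
      \<cdot> ((AMap h (snd P) \<boxplus> AMap h (snd Q)) \<cdot> AddIso h (OMap L ?x) (OMap L ?y)) \<cdot> ?w"
    unfolding a using t by simp
  also have "LUnit M' ?z \<cdot> (\<iota> ?z \<boxplus> ZeroIso h) = ZeroIso h \<cdot> LUnit M' (OMap h \<zero>\<^bsub>M\<^esub>)"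
    using L'.B.A.LUnit_nat[of "ZeroIso h"] by simp
  also have "(AMap h (snd P) \<boxplus> AMap h (snd Q)) \<cdot> AddIso h (OMap L ?x) (OMap L ?y)
     = AddIso h \<zero>\<^bsub>M\<^esub> \<zero>\<^bsub>M\<^esub> \<cdot> AMap h (snd P \<boxplus>\<^bsub>M\<^esub> snd Q)"
    using h.AddIso_nat[of "snd P" "snd Q"] t by simp
  also have "(ZeroIso h \<cdot> LUnit M' (OMap h \<zero>\<^bsub>M\<^esub>)) \<cdot> (ZeroIso h \<boxplus> \<iota> (OMap h \<zero>\<^bsub>M\<^esub>))
      \<cdot> (AddIso h \<zero>\<^bsub>M\<^esub> \<zero>\<^bsub>M\<^esub> \<cdot> AMap h (snd P \<boxplus>\<^bsub>M\<^esub> snd Q)) \<cdot> ?w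
    = snd (kernel_map (L.kernel_add P Q))"
    using t by (simp add: kernel_map_def L.kernel_add_def h.AddIso_ZeroIso[symmetric])
  finally show ?thesis using t by (simp add: L'.kernel_hom_def)
qed

lemma kernel_hom_map_ZeroIso: "L'.kernel_hom (kernel_map L.kernel_zero) L'.kernel_zero (ZeroIso g)"
proof -
  have "ZeroIso L' \<cdot> AMap L' (ZeroIso g) = ZeroIso h \<cdot> AMap h (ZeroIso L) \<cdot> Inv M' (\<beta> \<zero>\<^bsub>X\<^esub>)"
    by (rule L'.B.A.Comp_cancel_right[where f = "\<beta> \<zero>\<^bsub>X\<^esub>"]) (simp_all add: square_Zero)
  then show ?thesis by (simp add: L'.kernel_hom_def kernel_map_def L.kernel_zero_def L'.kernel_zero_def)
qed

lemma kernel_hom_map_ActIso: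
  assumes P: "L.kernel_obj P" and r: "r \<in> Obj R"
  shows "L'.kernel_hom (kernel_map (L.kernel_act r P)) (L'.kernel_act r (kernel_map P)) (ActIso g r (fst P))"
proof -
  note t = L.kernel_objD[OF P] r
  let ?x = "fst P" and ?i = "\<iota>\<^bsub>R\<^esub> r" and ?Z = "ActZero M' r"
  let ?w = "AMap h (ActIso L r ?x) \<cdot> Inv M' (\<beta> (r \<odot>\<^bsub>X\<^esub> ?x))"
  have a: "ActIso L' r (OMap g ?x) \<cdot> AMap L' (ActIso g r ?x)
    = (?i \<boxdot> \<beta> ?x) \<cdot> ActIso h r (OMap L ?x) \<cdot> ?w"
    by (rule L'.B.A.Comp_cancel_right[where f = "\<beta> (r \<odot>\<^bsub>X\<^esub> ?x)"])
      (use t square_ActO[of r ?x] in simp_all)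
  have z: "ZeroIso h \<cdot> AMap h (ActZero M r) = ?Z \<cdot> (?i \<boxdot> ZeroIso h) \<cdot> ActIso h r \<zero>\<^bsub>M\<^esub>"
    using r by (rule h.ActIso_ActZero)
  have "snd (L'.kernel_act r (kernel_map P)) \<cdot> AMap L' (ActIso g r ?x)
    = ?Z \<cdot> (?i \<boxdot> (ZeroIso h \<cdot> AMap h (snd P) \<cdot> Inv M' (\<beta> ?x)))
      \<cdot> (ActIso L' r (OMap g ?x) \<cdot> AMap L' (ActIso g r ?x))"
    using t by (simp add: L'.kernel_act_def kernel_map_def)
  also have "\<dots> = ?Z \<cdot> (?i \<boxdot> ZeroIso h) \<cdot> ((?i \<boxdot> AMap h (snd P)) \<cdot> ActIso h r (OMap L ?x)) \<cdot> ?w"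
    unfolding a using t by simp
  also have "(?i \<boxdot> AMap h (snd P)) \<cdot> ActIso h r (OMap L ?x) = ActIso h r \<zero>\<^bsub>M\<^esub> \<cdot> AMap h (?i \<boxdot>\<^bsub>M\<^esub> snd P)"
    using h.ActIso_nat[of r "snd P"] t by simp
  also have "?Z \<cdot> (?i \<boxdot> ZeroIso h) \<cdot> (ActIso h r \<zero>\<^bsub>M\<^esub> \<cdot> AMap h (?i \<boxdot>\<^bsub>M\<^esub> snd P)) \<cdot> ?w
     = (ZeroIso h \<cdot> AMap h (ActZero M r)) \<cdot> AMap h (?i \<boxdot>\<^bsub>M\<^esub> snd P) \<cdot> ?w"
    unfolding z using t by simp
  also have "\<dots> = snd (kernel_map (L.kernel_act r P))"
    using t by (simp add: kernel_map_def L.kernel_act_def)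
  finally show ?thesis using t by (simp add: L'.kernel_hom_def)
qed

end

text \<open>Two adjacent squares of a morphism of complexes.\<close>

locale null_sequence_map = A: null_sequence R Y X M D L \<nu> + B: null_sequence R Y' X' M' D' L' \<nu>' +
  P: hom_square R Y X D Y' X' D' f g \<alpha> + Q: hom_square R X M L X' M' L' g h \<beta>
  for R :: "('r, 's) ring_data" and Y :: "('r, 's, 'y, 'yy) mod_data" and X :: "('r, 's, 'x, 'xx) mod_data"
    and M :: "('r, 's, 'o, 'm) mod_data" and D L \<nu>
    and Y' :: "('r, 's, 'y2, 'yy2) mod_data" and X' :: "('r, 's, 'x2, 'xx2) mod_data"
    and M' :: "('r, 's, 'o2, 'm2) mod_data" (structure) and D' L' \<nu>' and f g h \<alpha> \<beta> +
  assumes null_map: "y \<in> Obj Y \<Longrightarrow> ZeroIso h \<cdot> AMap h (\<nu> y)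
    = \<nu>' (OMap f y) \<cdot> AMap L' (\<alpha> y) \<cdot> \<beta> (OMap D y)"
begin

text \<open>Discarding a summand along \<open>\<nu>\<close> and applying \<open>h\<close> is the same as applying \<open>h\<close> and discarding along \<open>\<nu>'\<close>,
  because the morphism respects the trivialisations.\<close>

lemma absorb_map:
  assumes o: "y \<in> Obj Y" "x \<in> Obj X"
  shows "\<beta> x \<cdot> AMap h (A.absorb y x) = B.absorb (OMap f y) (OMap g x)
    \<cdot> AMap L' ((\<alpha> y \<boxplus>\<^bsub>X'\<^esub> \<iota>\<^bsub>X'\<^esub> (OMap g x)) \<cdot>\<^bsub>X'\<^esub> AddIso g (OMap D y) x) \<cdot> \<beta> (OMap D y \<oplus>\<^bsub>X\<^esub> x)"
    (is "?l = ?r")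
proof -
  let ?d = "OMap D y" and ?gx = "OMap g x" and ?hl = "OMap h (OMap L x)" and ?lg = "OMap L' (OMap g x)"
  let ?w = "AddIso h (OMap L ?d) (OMap L x) \<cdot> AMap h (AddIso L ?d x)"
  have "?r = LUnit M' ?lg \<cdot> (\<nu>' (OMap f y) \<boxplus> \<iota> ?lg)
      \<cdot> (AddIso L' (OMap D' (OMap f y)) ?gx \<cdot> AMap L' (\<alpha> y \<boxplus>\<^bsub>X'\<^esub> \<iota>\<^bsub>X'\<^esub> ?gx))
      \<cdot> AMap L' (AddIso g ?d x) \<cdot> \<beta> (?d \<oplus>\<^bsub>X\<^esub> x)"
    using o by (simp add: B.absorb_def)
  also have "AddIso L' (OMap D' (OMap f y)) ?gx \<cdot> AMap L' (\<alpha> y \<boxplus>\<^bsub>X'\<^esub> \<iota>\<^bsub>X'\<^esub> ?gx)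
     = (AMap L' (\<alpha> y) \<boxplus> \<iota> ?lg) \<cdot> AddIso L' (OMap g ?d) ?gx"
    using B.L.AddIso_nat[of "\<alpha> y" "\<iota>\<^bsub>X'\<^esub> ?gx"] o by simp
  also have "LUnit M' ?lg \<cdot> (\<nu>' (OMap f y) \<boxplus> \<iota> ?lg)
      \<cdot> ((AMap L' (\<alpha> y) \<boxplus> \<iota> ?lg) \<cdot> AddIso L' (OMap g ?d) ?gx)
      \<cdot> AMap L' (AddIso g ?d x) \<cdot> \<beta> (?d \<oplus>\<^bsub>X\<^esub> x)
    = LUnit M' ?lg \<cdot> ((\<nu>' (OMap f y) \<cdot> AMap L' (\<alpha> y)) \<boxplus> \<iota> ?lg)
      \<cdot> (AddIso L' (OMap g ?d) ?gx \<cdot> AMap L' (AddIso g ?d x) \<cdot> \<beta> (?d \<oplus>\<^bsub>X\<^esub> x))"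
    using o by simp
  also have "\<dots> = LUnit M' ?lg \<cdot> ((\<nu>' (OMap f y) \<cdot> AMap L' (\<alpha> y) \<cdot> \<beta> ?d) \<boxplus> \<beta> x) \<cdot> ?w"
    using o by (simp add: Q.square_AddO)
  also have "\<dots> = (LUnit M' ?lg \<cdot> (\<iota> \<zero> \<boxplus> \<beta> x)) \<cdot> ((ZeroIso h \<cdot> AMap h (\<nu> y)) \<boxplus> \<iota> ?hl) \<cdot> ?w"
    unfolding null_map[OF o(1)] using o by simp
  also have "LUnit M' ?lg \<cdot> (\<iota> \<zero> \<boxplus> \<beta> x) = \<beta> x \<cdot> LUnit M' ?hl"
    using B.L.B.A.LUnit_nat[of "\<beta> x"] o by simp
  also have "(\<beta> x \<cdot> LUnit M' ?hl) \<cdot> ((ZeroIso h \<cdot> AMap h (\<nu> y)) \<boxplus> \<iota> ?hl) \<cdot> ?w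
    = \<beta> x \<cdot> LUnit M' ?hl \<cdot> (ZeroIso h \<boxplus> \<iota> ?hl) \<cdot> ((AMap h (\<nu> y) \<boxplus> \<iota> ?hl)
      \<cdot> AddIso h (OMap L ?d) (OMap L x)) \<cdot> AMap h (AddIso L ?d x)"
    using o by simp
  also have "(AMap h (\<nu> y) \<boxplus> \<iota> ?hl) \<cdot> AddIso h (OMap L ?d) (OMap L x)
     = AddIso h \<zero>\<^bsub>M\<^esub> (OMap L x) \<cdot> AMap h (\<nu> y \<boxplus>\<^bsub>M\<^esub> \<iota>\<^bsub>M\<^esub> (OMap L x))"
    using Q.h.AddIso_nat[of "\<nu> y" "\<iota>\<^bsub>M\<^esub> (OMap L x)"] o by simp
  also have "\<beta> x \<cdot> LUnit M' ?hl \<cdot> (ZeroIso h \<boxplus> \<iota> ?hl) \<cdot> (AddIso h \<zero>\<^bsub>M\<^esub> (OMap L x) \<cdot> AMap h (\<nu> y \<boxplus>\<^bsub>M\<^esub> \<iota>\<^bsub>M\<^esub> (OMap L x)))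
     \<cdot> AMap h (AddIso L ?d x) = ?l"
    using o by (simp add: A.absorb_def Q.h.AddIso_ZeroIso[symmetric])
  finally show ?thesis ..
qed

lemma inessential_map:
  assumes u: "A.inessential u x x'"
  shows "B.inessential (\<beta> x' \<cdot> AMap h u \<cdot> Inv M' (\<beta> x)) (OMap g x) (OMap g x')"
proof -
  obtain y k where k: "y \<in> Obj Y" "k \<in> Arr X" "Src X k = x" "Tgt X k = OMap D y \<oplus>\<^bsub>X\<^esub> x'" "u = A.absorb y x' \<cdot>\<^bsub>M\<^esub> AMap L k"
    using u by (auto simp: A.inessential_def)
  note o = A.inessentialD[OF u]
  let ?k = "((\<alpha> y \<boxplus>\<^bsub>X'\<^esub> \<iota>\<^bsub>X'\<^esub> (OMap g x')) \<cdot>\<^bsub>X'\<^esub> AddIso g (OMap D y) x')"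
  have "\<beta> x' \<cdot> AMap h u \<cdot> Inv M' (\<beta> x) = (\<beta> x' \<cdot> AMap h (A.absorb y x')) \<cdot> AMap h (AMap L k) \<cdot> Inv M' (\<beta> x)"
    using k o by simp
  also have "\<dots> = B.absorb (OMap f y) (OMap g x') \<cdot> AMap L' ?k \<cdot> (\<beta> (OMap D y \<oplus>\<^bsub>X\<^esub> x') \<cdot> AMap h (AMap L k)) \<cdot> Inv M' (\<beta> x)"
    unfolding absorb_map[OF k(1) o(2)] using k o by simp
  also have "\<beta> (OMap D y \<oplus>\<^bsub>X\<^esub> x') \<cdot> AMap h (AMap L k) = AMap L' (AMap g k) \<cdot> \<beta> x"
    using Q.square_nat[of k] k by simp
  finally have "\<beta> x' \<cdot> AMap h u \<cdot> Inv M' (\<beta> x) = B.absorb (OMap f y) (OMap g x') \<cdot> AMap L' (?k \<cdot>\<^bsub>X'\<^esub> AMap g k)"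
    using k o by simp
  then show ?thesis
    unfolding B.inessential_def using k o
    by (intro conjI bexI[of _ "OMap f y"] bexI[of _ "?k \<cdot>\<^bsub>X'\<^esub> AMap g k"]) auto
qed

lemma eqv_map:
  assumes p: "A.L.represents p a b" and e: "A.eqv b p p'"
  shows "B.eqv (OMap h b) (Q.map_rep b p) (Q.map_rep b p')"
proof -
  obtain u where u: "A.inessential u (fst p) (fst p')" "snd p' = (u \<boxplus>\<^bsub>M\<^esub> \<iota>\<^bsub>M\<^esub> b) \<cdot>\<^bsub>M\<^esub> snd p"
    using e by (auto simp: A.eqv_def)
  note t = A.L.representsD[OF p] A.inessentialD[OF u(1)]
  let ?v = "\<beta> (fst p') \<cdot> AMap h u \<cdot> Inv M' (\<beta> (fst p))" and ?hb = "OMap h b"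
  have n: "AddIso h (OMap L (fst p')) b \<cdot> AMap h (u \<boxplus>\<^bsub>M\<^esub> \<iota>\<^bsub>M\<^esub> b) = (AMap h u \<boxplus> \<iota> ?hb) \<cdot> AddIso h (OMap L (fst p)) b"
    using Q.h.AddIso_nat[of u "\<iota>\<^bsub>M\<^esub> b"] t by simp
  have "snd (Q.map_rep b p') = (\<beta> (fst p') \<boxplus> \<iota> ?hb) \<cdot> (AddIso h (OMap L (fst p')) b \<cdot> AMap h (u \<boxplus>\<^bsub>M\<^esub> \<iota>\<^bsub>M\<^esub> b)) \<cdot> AMap h (snd p)"
    unfolding Q.map_rep_def u(2) using t by simp
  also have "\<dots> = (?v \<boxplus> \<iota> ?hb) \<cdot> snd (Q.map_rep b p)"
    unfolding n Q.map_rep_def using t by simp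
  finally show ?thesis
    by (rule B.eqvI[rotated]) (use inessential_map[OF u(1)] in \<open>simp add: Q.map_rep_def\<close>)
qed

lemma kernel_hom_map_lift:
  assumes y: "y \<in> Obj Y"
  shows "B.L.kernel_hom (Q.kernel_map (A.lift y)) (B.lift (OMap f y)) (\<alpha> y)"
proof -
  have "\<nu>' (OMap f y) \<cdot> AMap L' (\<alpha> y) = (ZeroIso h \<cdot> AMap h (\<nu> y)) \<cdot> Inv M' (\<beta> (OMap D y))"
    unfolding null_map[OF y] using y by simp
  then show ?thesis
    using y by (simp add: B.L.kernel_hom_def Q.kernel_map_def A.lift_def B.lift_def)
qed

lemma kernel_rep_map:
  assumes p: "A.kernel_rep p S T"
  shows "B.kernel_rep (P.map_rep (fst T) p) (Q.kernel_map S) (Q.kernel_map T)"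
proof -
  have o: "fst p \<in> Obj Y" "A.L.kernel_obj T"
    and k: "A.L.kernel_hom S (A.L.kernel_add (A.lift (fst p)) T) (snd p)"
    using p by (simp_all add: A.kernel_rep_def)
  have 1: "B.L.kernel_hom (Q.kernel_map S) (Q.kernel_map (A.L.kernel_add (A.lift (fst p)) T)) (AMap g (snd p))"
    using o k by (intro Q.kernel_hom_map) simp_all
  have 2: "B.L.kernel_hom (Q.kernel_map (A.L.kernel_add (A.lift (fst p)) T))
     (B.L.kernel_add (Q.kernel_map (A.lift (fst p))) (Q.kernel_map T)) (AddIso g (OMap D (fst p)) (fst T))"
    using Q.kernel_hom_map_AddIso[of "A.lift (fst p)" T] o by simp
  have 3: "B.L.kernel_hom (B.L.kernel_add (Q.kernel_map (A.lift (fst p))) (Q.kernel_map T))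
     (B.L.kernel_add (B.lift (OMap f (fst p))) (Q.kernel_map T)) (\<alpha> (fst p) \<boxplus>\<^bsub>X'\<^esub> \<iota>\<^bsub>X'\<^esub> (OMap g (fst T)))"
    using o B.L.kernel_hom_Ide[of "Q.kernel_map T"] by (intro B.L.kernel_hom_AddA kernel_hom_map_lift) simp_all
  show ?thesis
    unfolding B.kernel_rep_def P.map_rep_def using o
    by (auto intro!: B.L.kernel_hom_Comp[OF _ B.L.kernel_hom_Comp[OF _ 1 2] 3])
qed

lemma cocycle_map:
  assumes S: "A.D.kernel_obj S" and c: "ZeroIso L \<cdot>\<^bsub>M\<^esub> AMap L (snd S) = \<nu> (fst S)"
  shows "ZeroIso L' \<cdot> AMap L' (snd (P.kernel_map S)) = \<nu>' (OMap f (fst S))"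
proof -
  note t = A.D.kernel_objD[OF S]
  let ?x = "fst S" and ?a = "snd S"
  have z: "ZeroIso L' \<cdot> AMap L' (ZeroIso g) = ZeroIso h \<cdot> AMap h (ZeroIso L) \<cdot> Inv M' (\<beta> \<zero>\<^bsub>X\<^esub>)"
    by (rule B.L.B.A.Comp_cancel_right[where f = "\<beta> \<zero>\<^bsub>X\<^esub>"]) (simp_all add: Q.square_Zero)
  have n: "Inv M' (\<beta> \<zero>\<^bsub>X\<^esub>) \<cdot> AMap L' (AMap g ?a) = AMap h (AMap L ?a) \<cdot> Inv M' (\<beta> (OMap D ?x))"
    by (rule B.L.B.A.Comp_cancel_left[of "\<beta> \<zero>\<^bsub>X\<^esub>"], rule B.L.B.A.Comp_cancel_right[where f = "\<beta> (OMap D ?x)"])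
      (use t Q.square_nat[of ?a] in simp_all)
  have "ZeroIso L' \<cdot> AMap L' (snd (P.kernel_map S))
    = (ZeroIso L' \<cdot> AMap L' (ZeroIso g)) \<cdot> AMap L' (AMap g ?a) \<cdot> Inv M' (AMap L' (\<alpha> ?x))"
    using t by (simp add: P.kernel_map_def)
  also have "\<dots> = ZeroIso h \<cdot> AMap h (ZeroIso L) \<cdot> (Inv M' (\<beta> \<zero>\<^bsub>X\<^esub>) \<cdot> AMap L' (AMap g ?a)) \<cdot> Inv M' (AMap L' (\<alpha> ?x))"
    unfolding z using t by simp
  also have "\<dots> = (ZeroIso h \<cdot> AMap h (ZeroIso L \<cdot>\<^bsub>M\<^esub> AMap L ?a)) \<cdot> Inv M' (\<beta> (OMap D ?x)) \<cdot> Inv M' (AMap L' (\<alpha> ?x))"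
    unfolding n using t by simp
  also have "\<dots> = \<nu>' (OMap f ?x)"
    unfolding c null_map[OF t(1)] using t by simp
  finally show ?thesis .
qed

lemma cocycle_kernel_map: "A.cocycle S \<Longrightarrow> B.cocycle (P.kernel_map S)"
  using cocycle_map by (simp add: A.cocycle_iff B.cocycle_iff)

end

lemma (in complex_morphism) hom_square_at:
  "hom_square R (Mod A k) (Mod A (k + 1)) (Dif A k) (Mod B k) (Mod B (k + 1)) (Dif B k) (Map F k) (Map F (k + 1)) (Sqr F k)"
  using A.Dif_hom B.Dif_hom Map_hom Sqr_two_morphism by (intro hom_square.intro hom_square_axioms.intro module_hom.intro)

lemma (in complex_morphism) null_sequence_map_at:
  "null_sequence_map R (Mod A k) (Mod A (k + 1)) (Mod A (k + 2)) (Dif A k) (Dif A (k + 1)) (Nul A k)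
    (Mod B k) (Mod B (k + 1)) (Mod B (k + 2)) (Dif B k) (Dif B (k + 1)) (Nul B k)
    (Map F k) (Map F (k + 1)) (Map F (k + 2)) (Sqr F k) (Sqr F (k + 1))"
  using A.null_sequence_at[of k] B.null_sequence_at[of k] hom_square_at[of k] hom_square_at[of "k + 1"] Map_Nul[of _ k]
  by (intro null_sequence_map.intro null_sequence_map_axioms.intro) (simp_all add: add.commute)

locale complex_morphism_at_degree = complex_morphism R A B F
  for R :: "('r, 's) ring_data"
    and A :: "('r, 's, 'o, 'm) complex_data" and B :: "('r, 's, 'p, 'q) complex_data" and F +
  fixes n :: int

sublocale complex_morphism_at_degree \<subseteq> CA: complex_at_degree R A n
  by (intro complex_at_degree.intro A.cochain_complex_axioms)

sublocale complex_morphism_at_degree \<subseteq> CB: complex_at_degree R B n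
  by (intro complex_at_degree.intro B.cochain_complex_axioms)

sublocale complex_morphism_at_degree \<subseteq> S: null_sequence_map R "Mod A (n - 2)" "Mod A (n - 1)" "Mod A n"
  "Dif A (n - 2)" "Dif A (n - 1)" "Nul A (n - 2)" "Mod B (n - 2)" "Mod B (n - 1)" "Mod B n"
  "Dif B (n - 2)" "Dif B (n - 1)" "Nul B (n - 2)" "Map F (n - 2)" "Map F (n - 1)" "Map F n"
  "Sqr F (n - 2)" "Sqr F (n - 1)"
  using null_sequence_map_at[of "n - 2"] by simp

sublocale complex_morphism_at_degree \<subseteq> T: null_sequence_map R "Mod A (n - 1)" "Mod A n" "Mod A (n + 1)"
  "Dif A (n - 1)" "Dif A n" "Nul A (n - 1)" "Mod B (n - 1)" "Mod B n" "Mod B (n + 1)"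
  "Dif B (n - 1)" "Dif B n" "Nul B (n - 1)" "Map F (n - 1)" "Map F n" "Map F (n + 1)"
  "Sqr F (n - 1)" "Sqr F n"
  using null_sequence_map_at[of "n - 1"] by (simp add: add.commute)

sublocale complex_morphism_at_degree \<subseteq> W: null_sequence_map R "Mod A n" "Mod A (n + 1)" "Mod A (n + 2)"
  "Dif A n" "Dif A (n + 1)" "Nul A n" "Mod B n" "Mod B (n + 1)" "Mod B (n + 2)"
  "Dif B n" "Dif B (n + 1)" "Nul B n" "Map F n" "Map F (n + 1)" "Map F (n + 2)"
  "Sqr F n" "Sqr F (n + 1)"
  by (rule null_sequence_map_at)

context complex_morphism_at_degree
begin

lemma coh_mapO_eq: "coh_mapO B F n = T.Q.kernel_map"
  by (simp add: fun_eq_iff coh_mapO_def T.Q.kernel_map_def)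

lemma coh_Obj_map: "P \<in> coh_Obj A n \<Longrightarrow> T.Q.kernel_map P \<in> coh_Obj B n"
  unfolding CA.coh_Obj_cocycle CB.coh_Obj_cocycle by (rule W.cocycle_kernel_map)

lemma coh_mapA_cls:
  assumes p: "CA.T.kernel_rep p P Q"
  shows "coh_mapA A B F n (CA.cls P Q p) = CB.cls (T.Q.kernel_map P) (T.Q.kernel_map Q) (S.Q.map_rep (fst Q) p)"
proof -
  let ?P = "T.Q.kernel_map P" and ?Q = "T.Q.kernel_map Q"
  have o: "CA.T.L.kernel_obj Q" using p by (simp_all add: CA.T.kernel_rep_def)
  note rp = CA.T.kernel_rep_represents[OF p]
  have r': "CB.S.L.represents (S.Q.map_rep (fst Q) p) (OMap (Map F n) (fst P)) (fst ?Q)"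
    using S.Q.represents_map[OF rp] by simp
  have g: "coh_class B n ?P ?Q (S.Q.map_rep (fst Q) p') = coh_class B n ?P ?Q (S.Q.map_rep (fst Q) p)"
    if "p' \<in> coh_class A n P Q p" for p'
    using CB.coh_class_cong[OF r'] o S.eqv_map[OF rp CA.coh_class_memberD(1)[OF rp o that]] by simp
  have "coh_mapA A B F n (CA.cls P Q p)
     = (?P, \<Union>p'\<in>coh_class A n P Q p. coh_class B n ?P ?Q (S.Q.map_rep (fst Q) p'), ?Q)"
    by (simp add: CA.cls_def coh_mapO_eq S.Q.map_rep_def case_prod_beta)
  also have "(\<Union>p'\<in>coh_class A n P Q p. coh_class B n ?P ?Q (S.Q.map_rep (fst Q) p'))
     = coh_class B n ?P ?Q (S.Q.map_rep (fst Q) p)"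
    by (intro CA.UN_eq_const[OF CA.coh_class_self[OF p]] g)
  finally show ?thesis by (simp only: CB.cls_def)
qed

lemma cohomology_map_simps:
  "OMap (cohomology_map R A B F n) = T.Q.kernel_map"
  "AMap (cohomology_map R A B F n) = coh_mapA A B F n"
  "AddIso (cohomology_map R A B F n) P Q = coh_ind B n (T.Q.kernel_map (CA.T.L.kernel_add P Q))
     (CB.T.L.kernel_add (T.Q.kernel_map P) (T.Q.kernel_map Q)) (AddIso (Map F n) (fst P) (fst Q))"
  "ZeroIso (cohomology_map R A B F n) = coh_ind B n (T.Q.kernel_map CA.T.L.kernel_zero) CB.T.L.kernel_zero (ZeroIso (Map F n))"
  "ActIso (cohomology_map R A B F n) r P = coh_ind B n (T.Q.kernel_map (CA.T.L.kernel_act r P))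
     (CB.T.L.kernel_act r (T.Q.kernel_map P)) (ActIso (Map F n) r (fst P))"
  by (simp_all add: cohomology_map_def Let_def coh_mapO_eq CA.coh_ops CB.coh_ops)

end

section \<open>Homotopies\<close>

text \<open>A homotopy in a single degree: \<open>H\<close> and \<open>H'\<close> are its components on \<open>A\<close> and on the next module \<open>A'\<close>.\<close>

locale homotopy_step = L: module_hom R A A' L + L': module_hom R B' B L' +
  F: module_hom R A B F + G: module_hom R A B G +
  H: module_hom R A B' H + H': module_hom R A' B H'
  for R :: "('r, 's) ring_data" and A :: "('r, 's, 'a, 'aa) mod_data" and A' :: "('r, 's, 'a2, 'aa2) mod_data" and L
    and B' :: "('r, 's, 'b2, 'bb2) mod_data" and B :: "('r, 's, 'b, 'bb) mod_data" (structure) and L' and F G H H' +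
  fixes \<tau> :: "'a \<Rightarrow> 'bb"
  assumes homotopy: "two_morphism R A B F
    (sum_hom B (sum_hom B (comp_hom B L' H) (comp_hom B H' L)) G) \<tau>"
begin

lemma homotopy_type [simp]:
  assumes "x \<in> Obj A"
  shows "\<tau> x \<in> Arr B" "Src B (\<tau> x) = OMap F x"
    "Tgt B (\<tau> x) = (OMap L' (OMap H x) \<oplus> OMap H' (OMap L x)) \<oplus> OMap G x"
  using homotopy assms by (auto simp: two_morphism_def comp_hom_def sum_hom_def in_hom_def)

lemma homotopy_nat:
  "f \<in> Arr A \<Longrightarrow> \<tau> (Tgt A f) \<cdot> AMap F f
    = ((AMap L' (AMap H f) \<boxplus> AMap H' (AMap L f)) \<boxplus> AMap G f) \<cdot> \<tau> (Src A f)"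
  using homotopy by (auto simp: two_morphism_def comp_hom_def sum_hom_def)

text \<open>If \<open>L x\<close> is trivialised, the summand \<open>H' (L x)\<close> in the target of \<open>\<tau> x\<close> can be discarded. This leaves an
  arrow from \<open>F x\<close> to \<open>L' (H x) \<oplus> G x\<close>.\<close>

definition reduced :: "'a \<times> 'aa2 \<Rightarrow> 'bb"
  where "reduced P = ((RUnit B (OMap L' (OMap H (fst P))) \<cdot>
      (\<iota> (OMap L' (OMap H (fst P))) \<boxplus> (ZeroIso H' \<cdot> AMap H' (snd P)))) \<boxplus> \<iota> (OMap G (fst P)))
    \<cdot> \<tau> (fst P)"

lemma reduced_type [simp]:
  assumes "L.kernel_obj P"
  shows "reduced P \<in> Arr B" "Src B (reduced P) = OMap F (fst P)"
    "Tgt B (reduced P) = OMap L' (OMap H (fst P)) \<oplus> OMap G (fst P)"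
  using L.kernel_objD[OF assms] by (simp_all add: reduced_def)

text \<open>On the kernel of \<open>L\<close>, the reduced arrows inherit from \<open>\<tau>\<close> the properties of a 2-morphism from \<open>F\<close> to the
  sum of \<open>L' H\<close> and \<open>G\<close>, because the trivialisations of the discarded summands are natural, additive and
  compatible with the action.\<close>

lemma reduced_nat:
  assumes Q: "L.kernel_obj Q" and f: "L.kernel_hom P Q f"
  shows "reduced Q \<cdot> AMap F f = (AMap L' (AMap H f) \<boxplus> AMap G f) \<cdot> reduced P"
proof -
  note t = L.kernel_objD[OF Q] L.kernel_homD(1-3,5)[OF f]
  let ?m = "OMap L' (OMap H (fst P))" and ?m' = "OMap L' (OMap H (fst Q))" and ?g = "AMap L' (AMap H f)"
  have p: "snd P \<in> Arr A'" "Src A' (snd P) = OMap L (fst P)" "Tgt A' (snd P) = \<zero>\<^bsub>A'\<^esub>"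
    unfolding L.kernel_homD(4)[OF f, symmetric] using t by simp_all
  have "reduced Q \<cdot> AMap F f = ((RUnit B ?m' \<cdot> (\<iota> ?m' \<boxplus> (ZeroIso H' \<cdot> AMap H' (snd Q)))) \<boxplus> \<iota> (OMap G (fst Q)))
    \<cdot> (\<tau> (fst Q) \<cdot> AMap F f)"
    using t by (simp add: reduced_def)
  also have "\<tau> (fst Q) \<cdot> AMap F f = ((?g \<boxplus> AMap H' (AMap L f)) \<boxplus> AMap G f) \<cdot> \<tau> (fst P)"
    using homotopy_nat[of f] t by simp
  also have "((RUnit B ?m' \<cdot> (\<iota> ?m' \<boxplus> (ZeroIso H' \<cdot> AMap H' (snd Q)))) \<boxplus> \<iota> (OMap G (fst Q)))
      \<cdot> ((?g \<boxplus> AMap H' (AMap L f)) \<boxplus> AMap G f) \<cdot> \<tau> (fst P)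
     = (((RUnit B ?m' \<cdot> (?g \<boxplus> \<iota> \<zero>)) \<cdot> (\<iota> ?m \<boxplus> (ZeroIso H' \<cdot> AMap H' (snd Q \<cdot>\<^bsub>A'\<^esub> AMap L f)))) \<boxplus> AMap G f) \<cdot> \<tau> (fst P)"
    using t by simp
  also have "RUnit B ?m' \<cdot> (?g \<boxplus> \<iota> \<zero>) = ?g \<cdot> RUnit B ?m"
    using L'.B.A.RUnit_nat[of ?g] t by simp
  finally show ?thesis
    unfolding L.kernel_homD(4)[OF f] using t p by (simp add: reduced_def)
qed

lemma reduced_AddO:
  assumes P: "L.kernel_obj P" and Q: "L.kernel_obj Q"
  shows "((AddIso L' (OMap H (fst P)) (OMap H (fst Q)) \<cdot> AMap L' (AddIso H (fst P) (fst Q))) \<boxplus> AddIso G (fst P) (fst Q))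
      \<cdot> reduced (L.kernel_add P Q)
    = Interchange B (OMap L' (OMap H (fst P))) (OMap G (fst P)) (OMap L' (OMap H (fst Q))) (OMap G (fst Q))
      \<cdot> (reduced P \<boxplus> reduced Q) \<cdot> AddIso F (fst P) (fst Q)"
    (is "(?c \<boxplus> ?ag) \<cdot> _ = ?r")
proof -
  let ?x = "fst P" and ?y = "fst Q" and ?z = "\<zero>"
  let ?mx = "OMap L' (OMap H ?x)" and ?my = "OMap L' (OMap H ?y)" and ?mxy = "OMap L' (OMap H (?x \<oplus>\<^bsub>A\<^esub> ?y))"
  let ?hx = "OMap H' (OMap L ?x)" and ?hy = "OMap H' (OMap L ?y)"
  let ?tx = "ZeroIso H' \<cdot> AMap H' (snd P)" and ?ty = "ZeroIso H' \<cdot> AMap H' (snd Q)"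
    and ?txy = "ZeroIso H' \<cdot> AMap H' (snd (L.kernel_add P Q))"
  let ?e = "AddIso H' (OMap L ?x) (OMap L ?y) \<cdot> AMap H' (AddIso L ?x ?y)"
  let ?gx = "OMap G ?x" and ?gy = "OMap G ?y"
  note t = L.kernel_objD[OF P] L.kernel_objD[OF Q] L.kernel_objD[OF L.kernel_obj_add[OF P Q], unfolded L.fst_kernel]
  \<comment> \<open>The trivialisation of the discarded summand is additive in \<open>P\<close> and \<open>Q\<close>.\<close>
  have tt: "?txy = LUnit B ?z \<cdot> (?tx \<boxplus> ?ty) \<cdot> ?e"
  proof -
    have "?txy = (ZeroIso H' \<cdot> LUnit B (OMap H' \<zero>\<^bsub>A'\<^esub>)) \<cdot> (ZeroIso H' \<boxplus> \<iota> (OMap H' \<zero>\<^bsub>A'\<^esub>))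
      \<cdot> (AddIso H' \<zero>\<^bsub>A'\<^esub> \<zero>\<^bsub>A'\<^esub> \<cdot> AMap H' (snd P \<boxplus>\<^bsub>A'\<^esub> snd Q)) \<cdot> AMap H' (AddIso L ?x ?y)"
      using t by (simp add: L.kernel_add_def H'.AddIso_ZeroIso[symmetric])
    also have "ZeroIso H' \<cdot> LUnit B (OMap H' \<zero>\<^bsub>A'\<^esub>) = LUnit B ?z \<cdot> (\<iota> ?z \<boxplus> ZeroIso H')"
      using L'.B.A.LUnit_nat[of "ZeroIso H'"] by simp
    also have "AddIso H' \<zero>\<^bsub>A'\<^esub> \<zero>\<^bsub>A'\<^esub> \<cdot> AMap H' (snd P \<boxplus>\<^bsub>A'\<^esub> snd Q)
       = (AMap H' (snd P) \<boxplus> AMap H' (snd Q)) \<cdot> AddIso H' (OMap L ?x) (OMap L ?y)"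
      using H'.AddIso_nat[of "snd P" "snd Q"] t by simp
    finally show ?thesis using t by simp
  qed
  have hom: "(\<tau> ?x \<boxplus> \<tau> ?y) \<cdot> AddIso F ?x ?y
    = (Interchange B (?mx \<oplus> ?hx) (?my \<oplus> ?hy) ?gx ?gy
       \<cdot> ((Interchange B ?mx ?my ?hx ?hy \<cdot> (?c \<boxplus> ?e)) \<boxplus> ?ag)) \<cdot> \<tau> (?x \<oplus>\<^bsub>A\<^esub> ?y)"
    using homotopy t by (simp add: two_morphism_def comp_hom_def sum_hom_def
          del: L'.B.A.Comp_assoc_right L'.B.A.AddA_merge L'.B.A.AddA_merge_pre)
  let ?sx = "RUnit B ?mx \<cdot> (\<iota> ?mx \<boxplus> ?tx)" and ?sy = "RUnit B ?my \<cdot> (\<iota> ?my \<boxplus> ?ty)"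
    and ?sxy = "RUnit B ?mxy \<cdot> (\<iota> ?mxy \<boxplus> ?txy)"
  have n1: "Interchange B ?mx ?my ?z ?z \<cdot> (\<iota> (?mx \<oplus> ?my) \<boxplus> (?tx \<boxplus> ?ty))
      = ((\<iota> ?mx \<boxplus> ?tx) \<boxplus> (\<iota> ?my \<boxplus> ?ty)) \<cdot> Interchange B ?mx ?my ?hx ?hy"
    using L'.B.A.Interchange_nat[of "\<iota> ?mx" "\<iota> ?my" ?tx ?ty] t by simp
  have s: "(?sx \<boxplus> ?sy) \<cdot> Interchange B ?mx ?my ?hx ?hy \<cdot> (?c \<boxplus> ?e) = ?c \<cdot> ?sxy"
  proof -
    have "(?sx \<boxplus> ?sy) \<cdot> Interchange B ?mx ?my ?hx ?hy \<cdot> (?c \<boxplus> ?e)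
      = (RUnit B ?mx \<boxplus> RUnit B ?my) \<cdot> (((\<iota> ?mx \<boxplus> ?tx) \<boxplus> (\<iota> ?my \<boxplus> ?ty)) \<cdot> Interchange B ?mx ?my ?hx ?hy)
        \<cdot> (?c \<boxplus> ?e)"
      using t by simp
    also have "\<dots> = ((RUnit B ?mx \<boxplus> RUnit B ?my) \<cdot> Interchange B ?mx ?my ?z ?z)
       \<cdot> (?c \<boxplus> ((?tx \<boxplus> ?ty) \<cdot> ?e))"
      unfolding n1[symmetric] using t by simp
    also have "(RUnit B ?mx \<boxplus> RUnit B ?my) \<cdot> Interchange B ?mx ?my ?z ?z
       = RUnit B (?mx \<oplus> ?my) \<cdot> (\<iota> (?mx \<oplus> ?my) \<boxplus> LUnit B ?z)"
      using t by (intro L'.B.A.Interchange_RUnit) simp_all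
    also have "(RUnit B (?mx \<oplus> ?my) \<cdot> (\<iota> (?mx \<oplus> ?my) \<boxplus> LUnit B ?z)) \<cdot> (?c \<boxplus> ((?tx \<boxplus> ?ty) \<cdot> ?e))
       = RUnit B (?mx \<oplus> ?my) \<cdot> (?c \<boxplus> ?txy)"
      unfolding tt using t by simp
    also have "\<dots> = (RUnit B (?mx \<oplus> ?my) \<cdot> (?c \<boxplus> \<iota> ?z)) \<cdot> (\<iota> ?mxy \<boxplus> ?txy)"
      using t by simp
    also have "RUnit B (?mx \<oplus> ?my) \<cdot> (?c \<boxplus> \<iota> ?z) = ?c \<cdot> RUnit B ?mxy"
      using L'.B.A.RUnit_nat[of ?c] t by simp
    finally show ?thesis using t by simp
  qed
  have n2: "Interchange B ?mx ?my ?gx ?gy \<cdot> ((?sx \<boxplus> ?sy) \<boxplus> \<iota> (?gx \<oplus> ?gy))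
      = ((?sx \<boxplus> \<iota> ?gx) \<boxplus> (?sy \<boxplus> \<iota> ?gy)) \<cdot> Interchange B (?mx \<oplus> ?hx) (?my \<oplus> ?hy) ?gx ?gy"
    using L'.B.A.Interchange_nat[of ?sx ?sy "\<iota> ?gx" "\<iota> ?gy"] t by simp
  have "(reduced P \<boxplus> reduced Q) \<cdot> AddIso F ?x ?y
    = ((?sx \<boxplus> \<iota> ?gx) \<boxplus> (?sy \<boxplus> \<iota> ?gy)) \<cdot> ((\<tau> ?x \<boxplus> \<tau> ?y) \<cdot> AddIso F ?x ?y)"
    using t by (simp add: reduced_def)
  also have "\<dots> = (((?sx \<boxplus> \<iota> ?gx) \<boxplus> (?sy \<boxplus> \<iota> ?gy)) \<cdot> Interchange B (?mx \<oplus> ?hx) (?my \<oplus> ?hy) ?gx ?gy)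
     \<cdot> ((Interchange B ?mx ?my ?hx ?hy \<cdot> (?c \<boxplus> ?e)) \<boxplus> ?ag) \<cdot> \<tau> (?x \<oplus>\<^bsub>A\<^esub> ?y)"
    unfolding hom using t by simp
  also have "\<dots> = Interchange B ?mx ?my ?gx ?gy
     \<cdot> (((?sx \<boxplus> ?sy) \<cdot> Interchange B ?mx ?my ?hx ?hy \<cdot> (?c \<boxplus> ?e)) \<boxplus> ?ag) \<cdot> \<tau> (?x \<oplus>\<^bsub>A\<^esub> ?y)"
    unfolding n2[symmetric] using t by simp
  also have "\<dots> = Interchange B ?mx ?my ?gx ?gy \<cdot> (?c \<boxplus> ?ag) \<cdot> reduced (L.kernel_add P Q)"
    unfolding s reduced_def using t by simp
  finally have m: "(reduced P \<boxplus> reduced Q) \<cdot> AddIso F ?x ?y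
     = Interchange B ?mx ?my ?gx ?gy \<cdot> (?c \<boxplus> ?ag) \<cdot> reduced (L.kernel_add P Q)" .
  have "?r = (Interchange B ?mx ?gx ?my ?gy \<cdot> Interchange B ?mx ?my ?gx ?gy) \<cdot> (?c \<boxplus> ?ag) \<cdot> reduced (L.kernel_add P Q)"
    unfolding m using P Q t by simp
  also have "\<dots> = (?c \<boxplus> ?ag) \<cdot> reduced (L.kernel_add P Q)"
    using P Q t by (subst L'.B.A.Interchange_Interchange) simp_all
  finally show ?thesis ..
qed

lemma reduced_Zero:
  "LUnit B \<zero> \<cdot> ((ZeroIso L' \<cdot> AMap L' (ZeroIso H)) \<boxplus> ZeroIso G) \<cdot> reduced L.kernel_zero = ZeroIso F"
proof -
  let ?z = "\<zero>" and ?m = "OMap L' (OMap H \<zero>\<^bsub>A\<^esub>)"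
  let ?c = "ZeroIso L' \<cdot> AMap L' (ZeroIso H)" and ?t = "ZeroIso H' \<cdot> AMap H' (ZeroIso L)"
  have n: "RUnit B ?z \<cdot> (?c \<boxplus> \<iota> ?z) = ?c \<cdot> RUnit B ?m"
    using L'.B.A.RUnit_nat[of ?c] by simp
  have "LUnit B ?z \<cdot> (?c \<boxplus> ZeroIso G) \<cdot> reduced L.kernel_zero
    = LUnit B ?z \<cdot> (((?c \<cdot> RUnit B ?m) \<cdot> (\<iota> ?m \<boxplus> ?t)) \<boxplus> ZeroIso G) \<cdot> \<tau> \<zero>\<^bsub>A\<^esub>"
    by (simp add: reduced_def L.kernel_zero_def)
  also have "\<dots> = (LUnit B ?z \<cdot> ((LUnit B ?z \<cdot> (?c \<boxplus> ?t)) \<boxplus> ZeroIso G)) \<cdot> \<tau> \<zero>\<^bsub>A\<^esub>"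
    unfolding n[symmetric] L'.B.A.LUnit_Zero by simp
  also have "\<dots> = ZeroIso F"
    using homotopy by (simp add: two_morphism_def comp_hom_def sum_hom_def
          del: L'.B.A.Comp_assoc_right L'.B.A.AddA_merge L'.B.A.AddA_merge_pre)
  finally show ?thesis .
qed

lemma reduced_ActO:
  assumes P: "L.kernel_obj P" and r: "r \<in> Obj R"
  shows "((ActIso L' r (OMap H (fst P)) \<cdot> AMap L' (ActIso H r (fst P))) \<boxplus> ActIso G r (fst P))
      \<cdot> reduced (L.kernel_act r P)
    = ActAdd B r (OMap L' (OMap H (fst P))) (OMap G (fst P)) \<cdot> (\<iota>\<^bsub>R\<^esub> r \<boxdot> reduced P) \<cdot> ActIso F r (fst P)"
    (is "(?c \<boxplus> ?ag) \<cdot> _ = ?r")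
proof -
  let ?x = "fst P" and ?z = "\<zero>" and ?i = "\<iota>\<^bsub>R\<^esub> r"
  let ?rx = "r \<odot>\<^bsub>A\<^esub> ?x"
  let ?m = "OMap L' (OMap H ?x)" and ?h = "OMap H' (OMap L ?x)" and ?gx = "OMap G ?x"
  let ?mr = "OMap L' (OMap H ?rx)" and ?rm = "r \<odot> ?m"
  let ?t = "ZeroIso H' \<cdot> AMap H' (snd P)" and ?tr = "ZeroIso H' \<cdot> AMap H' (snd (L.kernel_act r P))"
  let ?e = "ActIso H' r (OMap L ?x) \<cdot> AMap H' (ActIso L r ?x)"
  note t = L.kernel_objD[OF P] L.kernel_objD[OF L.kernel_obj_act[OF P r], unfolded L.fst_kernel] r
  have tt: "?tr = ActZero B r \<cdot> (?i \<boxdot> ?t) \<cdot> ?e"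
  proof -
    have "?tr = (ZeroIso H' \<cdot> AMap H' (ActZero A' r)) \<cdot> AMap H' (?i \<boxdot>\<^bsub>A'\<^esub> snd P) \<cdot> AMap H' (ActIso L r ?x)"
      using t by (simp add: L.kernel_act_def)
    also have "\<dots> = ActZero B r \<cdot> (?i \<boxdot> ZeroIso H') \<cdot> (ActIso H' r \<zero>\<^bsub>A'\<^esub> \<cdot> AMap H' (?i \<boxdot>\<^bsub>A'\<^esub> snd P))
       \<cdot> AMap H' (ActIso L r ?x)"
      unfolding H'.ActIso_ActZero[OF r] using t by simp
    also have "ActIso H' r \<zero>\<^bsub>A'\<^esub> \<cdot> AMap H' (?i \<boxdot>\<^bsub>A'\<^esub> snd P) = (?i \<boxdot> AMap H' (snd P)) \<cdot> ActIso H' r (OMap L ?x)"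
      using H'.ActIso_nat[of r "snd P"] t by simp
    finally show ?thesis using t by simp
  qed
  have hom: "(?i \<boxdot> \<tau> ?x) \<cdot> ActIso F r ?x = (Inv B (ActAdd B r (?m \<oplus> ?h) ?gx)
      \<cdot> ((Inv B (ActAdd B r ?m ?h) \<cdot> (?c \<boxplus> ?e)) \<boxplus> ?ag)) \<cdot> \<tau> ?rx"
    using homotopy t by (simp add: two_morphism_def comp_hom_def sum_hom_def
          del: L'.B.A.Comp_assoc_right L'.B.A.AddA_merge L'.B.A.AddA_merge_pre)
  let ?s = "RUnit B ?m \<cdot> (\<iota> ?m \<boxplus> ?t)" and ?sr = "RUnit B ?mr \<cdot> (\<iota> ?mr \<boxplus> ?tr)"
  have n1: "ActAdd B r ?m ?gx \<cdot> (?i \<boxdot> (?s \<boxplus> \<iota> ?gx))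
     = ((?i \<boxdot> ?s) \<boxplus> \<iota> (r \<odot> ?gx)) \<cdot> ActAdd B r (?m \<oplus> ?h) ?gx"
    using L'.B.ActAdd_nat[of r ?s "\<iota> ?gx"] t by simp
  have n2: "ActAdd B r ?m ?z \<cdot> (?i \<boxdot> (\<iota> ?m \<boxplus> ?t)) = (\<iota> ?rm \<boxplus> (?i \<boxdot> ?t)) \<cdot> ActAdd B r ?m ?h"
    using L'.B.ActAdd_nat[of r "\<iota> ?m" ?t] t by simp
  have s: "(?i \<boxdot> ?s) \<cdot> Inv B (ActAdd B r ?m ?h) \<cdot> (?c \<boxplus> ?e) = ?c \<cdot> ?sr"
  proof -
    have "(?i \<boxdot> ?s) \<cdot> Inv B (ActAdd B r ?m ?h) \<cdot> (?c \<boxplus> ?e)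
      = (?i \<boxdot> RUnit B ?m) \<cdot> (?i \<boxdot> (\<iota> ?m \<boxplus> ?t)) \<cdot> Inv B (ActAdd B r ?m ?h) \<cdot> (?c \<boxplus> ?e)"
      using t by simp
    also have "?i \<boxdot> RUnit B ?m = RUnit B ?rm \<cdot> (\<iota> ?rm \<boxplus> ActZero B r) \<cdot> ActAdd B r ?m ?z"
      using t by (simp add: L'.B.ActAdd_ActZero_right)
    also have "(RUnit B ?rm \<cdot> (\<iota> ?rm \<boxplus> ActZero B r) \<cdot> ActAdd B r ?m ?z)
       \<cdot> (?i \<boxdot> (\<iota> ?m \<boxplus> ?t)) \<cdot> Inv B (ActAdd B r ?m ?h) \<cdot> (?c \<boxplus> ?e)
      = RUnit B ?rm \<cdot> (\<iota> ?rm \<boxplus> ActZero B r) \<cdot> (ActAdd B r ?m ?z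
       \<cdot> (?i \<boxdot> (\<iota> ?m \<boxplus> ?t))) \<cdot> Inv B (ActAdd B r ?m ?h) \<cdot> (?c \<boxplus> ?e)"
      using t by simp
    also have "\<dots> = (RUnit B ?rm \<cdot> (?c \<boxplus> \<iota> ?z)) \<cdot> (\<iota> ?mr \<boxplus> ?tr)"
      unfolding n2 tt using t by simp
    also have "RUnit B ?rm \<cdot> (?c \<boxplus> \<iota> ?z) = ?c \<cdot> RUnit B ?mr"
      using L'.B.A.RUnit_nat[of ?c] t by simp
    finally show ?thesis using t by simp
  qed
  have "?r = (ActAdd B r ?m ?gx \<cdot> (?i \<boxdot> (?s \<boxplus> \<iota> ?gx))) \<cdot> ((?i \<boxdot> \<tau> ?x) \<cdot> ActIso F r ?x)"
    using t by (simp add: reduced_def)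
  also have "\<dots> = (((?i \<boxdot> ?s) \<cdot> Inv B (ActAdd B r ?m ?h) \<cdot> (?c \<boxplus> ?e)) \<boxplus> ?ag) \<cdot> \<tau> ?rx"
    unfolding hom n1 using t by simp
  also have "\<dots> = (?c \<boxplus> ?ag) \<cdot> reduced (L.kernel_act r P)"
    unfolding s reduced_def using t by simp
  finally show ?thesis ..
qed

end

text \<open>Two adjacent degrees of a homotopy, linked by the compatibility condition.\<close>

locale homotopy_square = A: null_sequence R A0 A1 A2 a0 a1 \<nu>a + B: null_sequence R Bm B0 B1 bm b0 \<nu>b +
  F: hom_square R A0 A1 a0 B0 B1 b0 F0 F1 \<kappa> + G: hom_square R A0 A1 a0 B0 B1 b0 G0 G1 \<mu> +
  U: homotopy_step R A0 A1 a0 Bm B0 bm F0 G0 Hm H0 \<tau>0 + V: homotopy_step R A1 A2 a1 B0 B1 b0 F1 G1 H0 H1 \<tau>1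
  for R :: "('r, 's) ring_data" and A0 :: "('r, 's, 'a0, 'aa0) mod_data"
    and A1 :: "('r, 's, 'a1, 'aa1) mod_data" and A2 :: "('r, 's, 'a2, 'aa2) mod_data" and a0 a1 \<nu>a
    and Bm :: "('r, 's, 'bm, 'bbm) mod_data" and B0 :: "('r, 's, 'b0, 'bb0) mod_data"
    and B1 :: "('r, 's, 'b1, 'bb1) mod_data" (structure) and bm b0 \<nu>b and F0 F1 \<kappa> and G0 G1 \<mu> and Hm H0 H1 \<tau>0 \<tau>1 +
  assumes compatible: "x \<in> Obj A0 \<Longrightarrow>
    (RUnit B1 (OMap b0 (OMap H0 (OMap a0 x))) \<boxplus> \<iota> (OMap b0 (OMap G0 x)))
      \<cdot> ((\<iota> (OMap b0 (OMap H0 (OMap a0 x))) \<boxplus> (ZeroIso H1 \<cdot> AMap H1 (\<nu>a x))) \<boxplus> \<mu> x)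
      \<cdot> \<tau>1 (OMap a0 x)
    = (LUnit B1 (OMap b0 (OMap H0 (OMap a0 x))) \<boxplus> \<iota> (OMap b0 (OMap G0 x)))
      \<cdot> ((\<nu>b (OMap Hm x) \<boxplus> \<iota> (OMap b0 (OMap H0 (OMap a0 x)))) \<boxplus> \<iota> (OMap b0 (OMap G0 x)))
      \<cdot> (AddIso b0 (OMap bm (OMap Hm x)) (OMap H0 (OMap a0 x)) \<boxplus> \<iota> (OMap b0 (OMap G0 x)))
      \<cdot> AddIso b0 (OMap bm (OMap Hm x) \<oplus>\<^bsub>B0\<^esub> OMap H0 (OMap a0 x)) (OMap G0 x)
      \<cdot> AMap b0 (\<tau>0 x) \<cdot> \<kappa> x"
begin

text \<open>The compatibility condition computes the reduced arrows of lifted objects: up to \<open>\<mu>\<close>, they are the images of the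
  lower homotopy with the summand \<open>b0 (bm (Hm x))\<close> absorbed.\<close>

lemma reduced_lift:
  assumes x: "x \<in> Obj A0"
  shows "(\<iota> (OMap b0 (OMap H0 (OMap a0 x))) \<boxplus> \<mu> x) \<cdot> V.reduced (A.lift x)
    = (B.absorb (OMap Hm x) (OMap H0 (OMap a0 x)) \<boxplus> \<iota> (OMap b0 (OMap G0 x)))
      \<cdot> AddIso b0 (OMap bm (OMap Hm x) \<oplus>\<^bsub>B0\<^esub> OMap H0 (OMap a0 x)) (OMap G0 x)
      \<cdot> AMap b0 (\<tau>0 x) \<cdot> \<kappa> x"
  using compatible[OF x] x by (simp add: V.reduced_def B.absorb_def, simp add: A.lift_def)

text \<open>The reduced arrow satisfies the side condition. By \<open>reduced_lift\<close>, its image under \<open>b0\<close> is expressed by the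
  reduced arrow of \<open>lift (fst P)\<close> in the next degree. The cocycle condition makes \<open>snd P\<close> an arrow
  of the kernel from \<open>lift (fst P)\<close> to zero, so by naturality the latter is determined by the reduced arrow
  at zero, which is canonical by \<open>reduced_Zero\<close>.\<close>

lemma kernel_hom_reduced:
  assumes P: "A.D.kernel_obj P" and c: "ZeroIso a1 \<cdot>\<^bsub>A2\<^esub> AMap a1 (snd P) = \<nu>a (fst P)"
  shows "B.L.kernel_hom (F.kernel_map P) (B.L.kernel_add (B.lift (OMap Hm (fst P))) (G.kernel_map P)) (U.reduced P)"
proof -
  note t = A.D.kernel_objD[OF P]
  let ?x = "fst P" and ?a = "snd P" and ?z = "\<zero>"
  let ?h = "OMap Hm ?x" and ?k = "OMap H0 (OMap a0 ?x)" and ?gx = "OMap G0 ?x"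
  let ?mh = "OMap bm ?h" and ?mgx = "OMap b0 ?gx"
  let ?t = "ZeroIso H0 \<cdot>\<^bsub>B0\<^esub> AMap H0 ?a"
  let ?s = "ZeroIso b0 \<cdot> AMap b0 ?t" and ?b = "ZeroIso G1 \<cdot> AMap G1 ?a"
  let ?T = "AddIso b0 (?mh \<oplus>\<^bsub>B0\<^esub> ?k) ?gx \<cdot> AMap b0 (\<tau>0 ?x)"
  have n1: "AddIso b0 ?mh ?gx \<cdot> AMap b0 ((RUnit B0 ?mh \<cdot>\<^bsub>B0\<^esub> (\<iota>\<^bsub>B0\<^esub> ?mh \<boxplus>\<^bsub>B0\<^esub> ?t)) \<boxplus>\<^bsub>B0\<^esub> \<iota>\<^bsub>B0\<^esub> ?gx)
    = ((AMap b0 (RUnit B0 ?mh) \<cdot> AMap b0 (\<iota>\<^bsub>B0\<^esub> ?mh \<boxplus>\<^bsub>B0\<^esub> ?t)) \<boxplus> \<iota> ?mgx) \<cdot> AddIso b0 (?mh \<oplus>\<^bsub>B0\<^esub> ?k) ?gx"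
    using B.L.AddIso_nat[of "RUnit B0 ?mh \<cdot>\<^bsub>B0\<^esub> (\<iota>\<^bsub>B0\<^esub> ?mh \<boxplus>\<^bsub>B0\<^esub> ?t)" "\<iota>\<^bsub>B0\<^esub> ?gx"] t by simp
  have n2: "\<nu>b ?h \<cdot> AMap b0 (RUnit B0 ?mh) \<cdot> AMap b0 (\<iota>\<^bsub>B0\<^esub> ?mh \<boxplus>\<^bsub>B0\<^esub> ?t) = ?s \<cdot> B.absorb ?h ?k"
  proof -
    have "\<nu>b ?h \<cdot> AMap b0 (RUnit B0 ?mh) \<cdot> AMap b0 (\<iota>\<^bsub>B0\<^esub> ?mh \<boxplus>\<^bsub>B0\<^esub> ?t)
      = (\<nu>b ?h \<cdot> RUnit B1 (OMap b0 ?mh)) \<cdot> (\<iota> (OMap b0 ?mh) \<boxplus> ZeroIso b0)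
        \<cdot> (AddIso b0 ?mh \<zero>\<^bsub>B0\<^esub> \<cdot> AMap b0 (\<iota>\<^bsub>B0\<^esub> ?mh \<boxplus>\<^bsub>B0\<^esub> ?t))"
      using t by (simp add: B.L.AddIso_ZeroIso_right[symmetric])
    also have "\<nu>b ?h \<cdot> RUnit B1 (OMap b0 ?mh) = RUnit B1 ?z \<cdot> (\<nu>b ?h \<boxplus> \<iota> ?z)"
      using B.L.B.A.RUnit_nat[of "\<nu>b ?h"] t by simp
    also have "AddIso b0 ?mh \<zero>\<^bsub>B0\<^esub> \<cdot> AMap b0 (\<iota>\<^bsub>B0\<^esub> ?mh \<boxplus>\<^bsub>B0\<^esub> ?t) = (\<iota> (OMap b0 ?mh) \<boxplus> AMap b0 ?t) \<cdot> AddIso b0 ?mh ?k"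
      using B.L.AddIso_nat[of "\<iota>\<^bsub>B0\<^esub> ?mh" ?t] t by simp
    also have "(RUnit B1 ?z \<cdot> (\<nu>b ?h \<boxplus> \<iota> ?z)) \<cdot> (\<iota> (OMap b0 ?mh) \<boxplus> ZeroIso b0)
       \<cdot> ((\<iota> (OMap b0 ?mh) \<boxplus> AMap b0 ?t) \<cdot> AddIso b0 ?mh ?k)
      = (LUnit B1 ?z \<cdot> (\<iota> ?z \<boxplus> ?s)) \<cdot> (\<nu>b ?h \<boxplus> \<iota> (OMap b0 ?k)) \<cdot> AddIso b0 ?mh ?k"
      using t by (simp add: B.L.B.A.LUnit_Zero)
    also have "LUnit B1 ?z \<cdot> (\<iota> ?z \<boxplus> ?s) = ?s \<cdot> LUnit B1 (OMap b0 ?k)"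
      using B.L.B.A.LUnit_nat[of ?s] t by simp
    finally show ?thesis using t by (simp add: B.absorb_def)
  qed
  have cond: "(B.absorb ?h ?k \<boxplus> \<iota> ?mgx) \<cdot> ?T
    = (\<iota> (OMap b0 ?k) \<boxplus> \<mu> ?x) \<cdot> V.reduced (A.lift ?x) \<cdot> Inv B1 (\<kappa> ?x)"
  proof (rule B.L.B.A.Comp_cancel_right[where f = "\<kappa> ?x"])
    show "((B.absorb ?h ?k \<boxplus> \<iota> ?mgx) \<cdot> ?T) \<cdot> \<kappa> ?x
      = ((\<iota> (OMap b0 ?k) \<boxplus> \<mu> ?x) \<cdot> V.reduced (A.lift ?x) \<cdot> Inv B1 (\<kappa> ?x)) \<cdot> \<kappa> ?x"
      using t reduced_lift[OF t(1)] by simp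
  qed (use t in simp_all)
  have ka: "A.L.kernel_hom (A.lift ?x) A.L.kernel_zero ?a"
    using t c by (simp add: A.L.kernel_hom_def A.lift_def A.L.kernel_zero_def)
  have nat: "V.reduced A.L.kernel_zero \<cdot> AMap F1 ?a = (AMap b0 (AMap H0 ?a) \<boxplus> AMap G1 ?a) \<cdot> V.reduced (A.lift ?x)"
    by (rule V.reduced_nat[OF A.L.kernel_obj_zero ka])
  have "snd (B.L.kernel_add (B.lift ?h) (G.kernel_map P)) \<cdot> AMap b0 (U.reduced P)
    = LUnit B1 ?z \<cdot> (\<nu>b ?h \<boxplus> (?b \<cdot> Inv B1 (\<mu> ?x))) \<cdot>
      (AddIso b0 ?mh ?gx \<cdot> AMap b0 ((RUnit B0 ?mh \<cdot>\<^bsub>B0\<^esub> (\<iota>\<^bsub>B0\<^esub> ?mh \<boxplus>\<^bsub>B0\<^esub> ?t)) \<boxplus>\<^bsub>B0\<^esub> \<iota>\<^bsub>B0\<^esub> ?gx)) \<cdot> AMap b0 (\<tau>0 ?x)"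
    using t by (simp add: B.L.kernel_add_def B.lift_def G.kernel_map_def U.reduced_def)
  also have "\<dots> = LUnit B1 ?z \<cdot> ((\<nu>b ?h \<cdot> AMap b0 (RUnit B0 ?mh) \<cdot> AMap b0 (\<iota>\<^bsub>B0\<^esub> ?mh \<boxplus>\<^bsub>B0\<^esub> ?t)) \<boxplus> (?b \<cdot> Inv B1 (\<mu> ?x))) \<cdot> ?T"
    unfolding n1 using t by simp
  also have "\<dots> = LUnit B1 ?z \<cdot> (?s \<boxplus> (?b \<cdot> Inv B1 (\<mu> ?x))) \<cdot> ((B.absorb ?h ?k \<boxplus> \<iota> ?mgx) \<cdot> ?T)"
    unfolding n2 using t by simp
  also have "\<dots> = LUnit B1 ?z \<cdot> ((ZeroIso b0 \<cdot> AMap b0 (ZeroIso H0)) \<boxplus> ZeroIso G1)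
      \<cdot> ((AMap b0 (AMap H0 ?a) \<boxplus> AMap G1 ?a) \<cdot> V.reduced (A.lift ?x)) \<cdot> Inv B1 (\<kappa> ?x)"
    unfolding cond using t by simp
  also have "\<dots> = (LUnit B1 ?z \<cdot> ((ZeroIso b0 \<cdot> AMap b0 (ZeroIso H0)) \<boxplus> ZeroIso G1) \<cdot> V.reduced A.L.kernel_zero)
      \<cdot> AMap F1 ?a \<cdot> Inv B1 (\<kappa> ?x)"
    unfolding nat[symmetric] using t by simp
  also have "\<dots> = snd (F.kernel_map P)"
    unfolding V.reduced_Zero by (simp add: F.kernel_map_def)
  finally show ?thesis using P t by (simp add: B.L.kernel_hom_def)
qed

text \<open>Both composites are equivalent to a third representative with first component
  \<open>(H0 (a0 X) \<oplus> H0 q) \<oplus> G0 X\<close>, where \<open>X\<close> and \<open>q\<close> are the first components of \<open>p\<close> and \<open>Q\<close>. The second composite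
  reaches it by applying \<open>H0\<close> to \<open>snd p\<close>. The first one reaches it along the inessential arrow \<open>u\<close>, which splits \<open>F0 X\<close>
  by \<open>\<tau>0\<close>, absorbs the summand \<open>bm (Hm X)\<close> and shuffles the others. The second components agree because
  reduced arrows are additive and by \<open>reduced_lift\<close>.\<close>

lemma reduced_natural:
  assumes p: "A.kernel_rep p P Q" and P: "A.L.kernel_obj P"
  shows "B.eqv (OMap G1 (fst Q))
    (B.L.comp_rep (OMap G1 (fst Q)) (OMap H0 (fst Q), V.reduced Q) (F.map_rep (fst Q) p))
    (B.L.comp_rep (OMap G1 (fst Q)) (G.map_rep (fst Q) p) (OMap H0 (fst P), V.reduced P))"
    (is "B.eqv ?gq ?first ?second")
proof -
  have p1: "fst p \<in> Obj A0" and Q: "A.L.kernel_obj Q" 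
    and k: "A.L.kernel_hom P (A.L.kernel_add (A.lift (fst p)) Q) (snd p)"
    using p by (simp_all add: A.kernel_rep_def)
  note t = p1 A.L.kernel_objD[OF P] A.L.kernel_objD[OF Q] A.L.kernel_homD(1-3)[OF k, simplified]
  let ?X = "fst p" and ?x = "snd p" and ?q = "fst Q" and ?l = "OMap a0 (fst p)"
  let ?ha = "OMap H0 (fst P)" and ?hl = "OMap H0 ?l" and ?hq = "OMap H0 ?q"
  let ?f = "OMap F0 ?X" and ?g = "OMap G0 ?X"
  let ?mf = "OMap b0 ?f" and ?mg = "OMap b0 ?g" and ?ml = "OMap b0 ?hl" and ?mq = "OMap b0 ?hq" and ?ma = "OMap b0 ?ha"
  let ?gl = "OMap G1 ?l"
  let ?lift = "A.lift ?X"
  let ?rl = "V.reduced ?lift" and ?rq = "V.reduced Q" and ?rp = "V.reduced P"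
  let ?w = "AddIso F1 ?l ?q \<cdot> AMap F1 ?x"
  let ?d = "OMap bm (OMap Hm ?X)"
  let ?v = "(B.absorb (OMap Hm ?X) ?hl \<boxplus> \<iota> ?mg) \<cdot> AddIso b0 (?d \<oplus>\<^bsub>B0\<^esub> ?hl) ?g \<cdot> AMap b0 (\<tau>0 ?X)"
  let ?j = "AddIso H0 ?l ?q \<cdot>\<^bsub>B0\<^esub> AMap H0 ?x"
  let ?lq = "?hl \<oplus>\<^bsub>B0\<^esub> ?hq"
  have tl: "A.L.kernel_obj ?lift" using t by simp
  have rl: "?rl \<in> Arr B1" "Src B1 ?rl = OMap F1 ?l" "Tgt B1 ?rl = ?ml \<oplus> ?gl"
    using V.reduced_type[OF tl] by simp_all
  note t = t tl rl V.reduced_type[OF P] V.reduced_type[OF Q]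
  \<comment> \<open>Naturality of the reduced arrows at \<open>snd p\<close> and their additivity, combined.\<close>
  have rsum: "((AddIso b0 ?hl ?hq \<cdot> AMap b0 ?j) \<boxplus> (AddIso G1 ?l ?q \<cdot> AMap G1 ?x)) \<cdot> ?rp
    = Interchange B1 ?ml ?gl ?mq ?gq \<cdot> (?rl \<boxplus> ?rq) \<cdot> ?w"
  proof -
    have r: "V.reduced (A.L.kernel_add ?lift Q) \<in> Arr B1" "Src B1 (V.reduced (A.L.kernel_add ?lift Q)) = OMap F1 (?l \<oplus>\<^bsub>A1\<^esub> ?q)"
      "Tgt B1 (V.reduced (A.L.kernel_add ?lift Q)) = OMap b0 (OMap H0 (?l \<oplus>\<^bsub>A1\<^esub> ?q)) \<oplus> OMap G1 (?l \<oplus>\<^bsub>A1\<^esub> ?q)"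
      using V.reduced_type[OF A.L.kernel_obj_add[OF tl Q]] by simp_all
    have "((AddIso b0 ?hl ?hq \<cdot> AMap b0 ?j) \<boxplus> (AddIso G1 ?l ?q \<cdot> AMap G1 ?x)) \<cdot> ?rp
      = ((AddIso b0 ?hl ?hq \<cdot> AMap b0 (AddIso H0 ?l ?q)) \<boxplus> AddIso G1 ?l ?q)
        \<cdot> ((AMap b0 (AMap H0 ?x) \<boxplus> AMap G1 ?x) \<cdot> ?rp)"
      using t by simp
    also have "(AMap b0 (AMap H0 ?x) \<boxplus> AMap G1 ?x) \<cdot> ?rp = V.reduced (A.L.kernel_add ?lift Q) \<cdot> AMap F1 ?x"
      by (rule V.reduced_nat[OF A.L.kernel_obj_add[OF tl Q] k, symmetric])
    also have "((AddIso b0 ?hl ?hq \<cdot> AMap b0 (AddIso H0 ?l ?q)) \<boxplus> AddIso G1 ?l ?q)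
        \<cdot> V.reduced (A.L.kernel_add ?lift Q) \<cdot> AMap F1 ?x
      = (((AddIso b0 ?hl ?hq \<cdot> AMap b0 (AddIso H0 ?l ?q)) \<boxplus> AddIso G1 ?l ?q)
        \<cdot> V.reduced (A.L.kernel_add ?lift Q)) \<cdot> AMap F1 ?x"
      using t r by simp
    also have "\<dots> = (Interchange B1 ?ml ?gl ?mq ?gq \<cdot> (?rl \<boxplus> ?rq) \<cdot> AddIso F1 ?l ?q) \<cdot> AMap F1 ?x"
      using V.reduced_AddO[OF tl Q] by simp
    finally show ?thesis using t by simp
  qed
  have v: "(\<iota> ?ml \<boxplus> \<mu> ?X) \<cdot> ?rl = ?v \<cdot> \<kappa> ?X"
    using reduced_lift[OF p1] t by simp
  have tv: "?v \<in> Arr B1" "Src B1 ?v = ?mf" "Tgt B1 ?v = ?ml \<oplus> ?mg" using t by simp_all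
  define u where "u = Inv B1 (AddIso b0 ?lq ?g) \<cdot> (Inv B1 (AddIso b0 ?hl ?hq) \<boxplus> \<iota> ?mg)
     \<cdot> B.L.B.A.Shuffle ?ml ?mg ?mq \<cdot> (?v \<boxplus> \<iota> ?mq) \<cdot> AddIso b0 ?f ?hq"
  have u: "B.inessential u (?f \<oplus>\<^bsub>B0\<^esub> ?hq) (?lq \<oplus>\<^bsub>B0\<^esub> ?g)"
  proof -
    have i1: "B.inessential (B.absorb (OMap Hm ?X) ?hl) (?d \<oplus>\<^bsub>B0\<^esub> ?hl) ?hl"
      using t by (intro B.inessential_absorb) simp_all
    have i2: "B.inessential (AMap b0 (\<tau>0 ?X)) ?f ((?d \<oplus>\<^bsub>B0\<^esub> ?hl) \<oplus>\<^bsub>B0\<^esub> ?g)"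
      using B.inessential_AMap[of "\<tau>0 ?X"] t by simp
    have i3: "B.inessential (AMap b0 (B.D.B.A.Shuffle ?hl ?g ?hq)) ((?hl \<oplus>\<^bsub>B0\<^esub> ?g) \<oplus>\<^bsub>B0\<^esub> ?hq) (?lq \<oplus>\<^bsub>B0\<^esub> ?g)"
      using B.inessential_AMap[of "B.D.B.A.Shuffle ?hl ?g ?hq"] t by simp
    let ?u0 = "(Inv B1 (AddIso b0 ?hl ?g) \<cdot> (B.absorb (OMap Hm ?X) ?hl \<boxplus> \<iota> ?mg) \<cdot> AddIso b0 (?d \<oplus>\<^bsub>B0\<^esub> ?hl) ?g)
       \<cdot> AMap b0 (\<tau>0 ?X)"
    have i4: "B.inessential ?u0 ?f (?hl \<oplus>\<^bsub>B0\<^esub> ?g)"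
      using t by (intro B.inessential_Comp[OF i2] B.inessential_AddA_left[OF i1]) simp_all
    have u0: "?u0 = Inv B1 (AddIso b0 ?hl ?g) \<cdot> ?v" using t by simp
    have i5: "B.inessential (AMap b0 (B.D.B.A.Shuffle ?hl ?g ?hq) \<cdot> Inv B1 (AddIso b0 (?hl \<oplus>\<^bsub>B0\<^esub> ?g) ?hq)
      \<cdot> ((Inv B1 (AddIso b0 ?hl ?g) \<cdot> ?v) \<boxplus> \<iota> ?mq) \<cdot> AddIso b0 ?f ?hq) (?f \<oplus>\<^bsub>B0\<^esub> ?hq) (?lq \<oplus>\<^bsub>B0\<^esub> ?g)"
      using t by (intro B.inessential_Comp[OF _ i3] B.inessential_AddA_left i4[unfolded u0]) simp_all
    have s: "AMap b0 (B.D.B.A.Shuffle ?hl ?g ?hq) \<cdot> Inv B1 (AddIso b0 (?hl \<oplus>\<^bsub>B0\<^esub> ?g) ?hq) \<cdot> (Inv B1 (AddIso b0 ?hl ?g) \<boxplus> \<iota> ?mq)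
      = Inv B1 (AddIso b0 ?lq ?g) \<cdot> (Inv B1 (AddIso b0 ?hl ?hq) \<boxplus> \<iota> ?mg) \<cdot> B.L.B.A.Shuffle ?ml ?mg ?mq"
      (is "?s1 = ?s2")
    proof (rule B.L.B.A.Comp_cancel_left[of "(AddIso b0 ?hl ?hq \<boxplus> \<iota> ?mg) \<cdot> AddIso b0 ?lq ?g"])
      have "((AddIso b0 ?hl ?hq \<boxplus> \<iota> ?mg) \<cdot> AddIso b0 ?lq ?g) \<cdot> ?s1
        = ((AddIso b0 ?hl ?hq \<boxplus> \<iota> ?mg) \<cdot> AddIso b0 ?lq ?g \<cdot> AMap b0 (B.D.B.A.Shuffle ?hl ?g ?hq))
         \<cdot> Inv B1 (AddIso b0 (?hl \<oplus>\<^bsub>B0\<^esub> ?g) ?hq) \<cdot> (Inv B1 (AddIso b0 ?hl ?g) \<boxplus> \<iota> ?mq)"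
        using t by simp
      also have "(AddIso b0 ?hl ?hq \<boxplus> \<iota> ?mg) \<cdot> AddIso b0 ?lq ?g \<cdot> AMap b0 (B.D.B.A.Shuffle ?hl ?g ?hq)
        = B.L.B.A.Shuffle ?ml ?mg ?mq \<cdot> (AddIso b0 ?hl ?g \<boxplus> \<iota> ?mq) \<cdot> AddIso b0 (?hl \<oplus>\<^bsub>B0\<^esub> ?g) ?hq"
        using t by (intro B.L.AddIso_Shuffle) simp_all
      finally show "((AddIso b0 ?hl ?hq \<boxplus> \<iota> ?mg) \<cdot> AddIso b0 ?lq ?g) \<cdot> ?s1
        = ((AddIso b0 ?hl ?hq \<boxplus> \<iota> ?mg) \<cdot> AddIso b0 ?lq ?g) \<cdot> ?s2"
        using t by simp
    qed (use t in simp_all)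
    have "u = ?s2 \<cdot> (?v \<boxplus> \<iota> ?mq) \<cdot> AddIso b0 ?f ?hq"
      unfolding u_def using t by simp
    also have "\<dots> = AMap b0 (B.D.B.A.Shuffle ?hl ?g ?hq) \<cdot> Inv B1 (AddIso b0 (?hl \<oplus>\<^bsub>B0\<^esub> ?g) ?hq)
      \<cdot> ((Inv B1 (AddIso b0 ?hl ?g) \<cdot> ?v) \<boxplus> \<iota> ?mq) \<cdot> AddIso b0 ?f ?hq"
      unfolding s[symmetric] using t by simp
    finally show ?thesis using i5 by simp
  qed
  define third where "third = (?lq \<oplus>\<^bsub>B0\<^esub> ?g, (u \<boxplus> \<iota> ?gq) \<cdot> snd ?first)"
  have r1: "B.L.represents ?first (OMap F1 (fst P)) ?gq"
    using t by (intro B.L.represents_comp[where b = "OMap F1 ?q"] F.represents_map)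
      (auto simp: B.L.represents_def A.D.represents_def)
  have r2: "B.L.represents ?second (OMap F1 (fst P)) ?gq"
    using t by (intro B.L.represents_comp[where b = "OMap G1 (fst P)"] G.represents_map)
      (auto simp: B.L.represents_def A.D.represents_def)
  have e1: "B.eqv ?gq ?first third"
    by (rule B.eqvI[of u]) (use u in \<open>simp_all add: third_def B.L.comp_rep_def F.map_rep_def\<close>)
  have f1: "snd ?first = (Inv B1 (AddIso b0 ?f ?hq) \<boxplus> \<iota> ?gq) \<cdot> Inv B1 (Assoc B1 ?mf ?mq ?gq)
      \<cdot> (\<kappa> ?X \<boxplus> ?rq) \<cdot> ?w"
    using t by (simp add: B.L.comp_rep_def F.map_rep_def)
  have a1: "Inv B1 (Assoc B1 (?ml \<oplus> ?mg) ?mq ?gq) \<cdot> (?v \<boxplus> (\<iota> ?mq \<boxplus> \<iota> ?gq))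
     = ((?v \<boxplus> \<iota> ?mq) \<boxplus> \<iota> ?gq) \<cdot> Inv B1 (Assoc B1 ?mf ?mq ?gq)"
    using B.L.B.A.Inv_Assoc_nat[of ?v "\<iota> ?mq" "\<iota> ?gq"] t by simp
  have a2: "(B.L.B.A.Shuffle ?ml ?mg ?mq \<boxplus> \<iota> ?gq) \<cdot> Inv B1 (Assoc B1 (?ml \<oplus> ?mg) ?mq ?gq)
     = Inv B1 (Assoc B1 (?ml \<oplus> ?mq) ?mg ?gq) \<cdot> Interchange B1 ?ml ?mg ?mq ?gq"
    by (rule B.L.B.A.Comp_cancel_right[where f = "Assoc B1 (?ml \<oplus> ?mg) ?mq ?gq"])
      (use t in \<open>simp_all add: B.L.B.A.Interchange_Shuffle\<close>)
  let ?c = "Inv B1 (AddIso b0 ?lq ?g) \<cdot> (Inv B1 (AddIso b0 ?hl ?hq) \<boxplus> \<iota> ?mg)"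
  have common: "snd third = (?c \<boxplus> \<iota> ?gq) \<cdot> Inv B1 (Assoc B1 (?ml \<oplus> ?mq) ?mg ?gq) \<cdot> Interchange B1 ?ml ?mg ?mq ?gq
      \<cdot> ((?v \<cdot> \<kappa> ?X) \<boxplus> ?rq) \<cdot> ?w"
  proof -
    have "snd third = (?c \<boxplus> \<iota> ?gq) \<cdot> (B.L.B.A.Shuffle ?ml ?mg ?mq \<boxplus> \<iota> ?gq)
      \<cdot> (((?v \<boxplus> \<iota> ?mq) \<boxplus> \<iota> ?gq) \<cdot> Inv B1 (Assoc B1 ?mf ?mq ?gq)) \<cdot> (\<kappa> ?X \<boxplus> ?rq) \<cdot> ?w"
      unfolding third_def snd_conv f1 u_def using t by simp
    also have "\<dots> = (?c \<boxplus> \<iota> ?gq) \<cdot> ((B.L.B.A.Shuffle ?ml ?mg ?mq \<boxplus> \<iota> ?gq)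
       \<cdot> Inv B1 (Assoc B1 (?ml \<oplus> ?mg) ?mq ?gq)) \<cdot> ((?v \<cdot> \<kappa> ?X) \<boxplus> ?rq) \<cdot> ?w"
      unfolding a1[symmetric] using t by simp
    finally show ?thesis unfolding a2 using t by simp
  qed
  have e2: "B.eqv ?gq ?second third"
  proof (rule B.eqv_AMapI[of "?j \<boxplus>\<^bsub>B0\<^esub> \<iota>\<^bsub>B0\<^esub> ?g"])
    have b1: "AMap b0 (?j \<boxplus>\<^bsub>B0\<^esub> \<iota>\<^bsub>B0\<^esub> ?g) \<cdot> Inv B1 (AddIso b0 ?ha ?g) = Inv B1 (AddIso b0 ?lq ?g) \<cdot> (AMap b0 ?j \<boxplus> \<iota> ?mg)"
      using t by (simp add: B.L.AMap_AddA)
    have b2: "((AMap b0 ?j \<boxplus> \<iota> ?mg) \<boxplus> \<iota> ?gq) \<cdot> Inv B1 (Assoc B1 ?ma ?mg ?gq)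
      = Inv B1 (Assoc B1 (OMap b0 ?lq) ?mg ?gq) \<cdot> (AMap b0 ?j \<boxplus> (\<iota> ?mg \<boxplus> \<iota> ?gq))"
      using B.L.B.A.Inv_Assoc_nat[of "AMap b0 ?j" "\<iota> ?mg" "\<iota> ?gq"] t by simp
    have b3: "Inv B1 (Assoc B1 (OMap b0 ?lq) ?mg ?gq) \<cdot> (Inv B1 (AddIso b0 ?hl ?hq) \<boxplus> (\<iota> ?mg \<boxplus> \<iota> ?gq))
      = ((Inv B1 (AddIso b0 ?hl ?hq) \<boxplus> \<iota> ?mg) \<boxplus> \<iota> ?gq) \<cdot> Inv B1 (Assoc B1 (?ml \<oplus> ?mq) ?mg ?gq)"
      using B.L.B.A.Inv_Assoc_nat[of "Inv B1 (AddIso b0 ?hl ?hq)" "\<iota> ?mg" "\<iota> ?gq"] t by simp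
    have b4: "((\<iota> ?ml \<boxplus> \<iota> ?mq) \<boxplus> (\<mu> ?X \<boxplus> \<iota> ?gq)) \<cdot> Interchange B1 ?ml ?gl ?mq ?gq
      = Interchange B1 ?ml ?mg ?mq ?gq \<cdot> ((\<iota> ?ml \<boxplus> \<mu> ?X) \<boxplus> (\<iota> ?mq \<boxplus> \<iota> ?gq))"
      using B.L.B.A.Interchange_nat[of "\<iota> ?ml" "\<mu> ?X" "\<iota> ?mq" "\<iota> ?gq"] t by simp
    let ?y = "AddIso G1 ?l ?q \<cdot> AMap G1 ?x"
    have "(AMap b0 (?j \<boxplus>\<^bsub>B0\<^esub> \<iota>\<^bsub>B0\<^esub> ?g) \<boxplus> \<iota> ?gq) \<cdot> snd ?second
      = ((AMap b0 (?j \<boxplus>\<^bsub>B0\<^esub> \<iota>\<^bsub>B0\<^esub> ?g) \<cdot> Inv B1 (AddIso b0 ?ha ?g)) \<boxplus> \<iota> ?gq) \<cdot> Inv B1 (Assoc B1 ?ma ?mg ?gq)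
        \<cdot> (\<iota> ?ma \<boxplus> ((\<mu> ?X \<boxplus> \<iota> ?gq) \<cdot> ?y)) \<cdot> ?rp"
      using t by (simp add: B.L.comp_rep_def G.map_rep_def)
    also have "\<dots> = (Inv B1 (AddIso b0 ?lq ?g) \<boxplus> \<iota> ?gq) \<cdot> (((AMap b0 ?j \<boxplus> \<iota> ?mg) \<boxplus> \<iota> ?gq) \<cdot> Inv B1 (Assoc B1 ?ma ?mg ?gq))
        \<cdot> (\<iota> ?ma \<boxplus> ((\<mu> ?X \<boxplus> \<iota> ?gq) \<cdot> ?y)) \<cdot> ?rp"
      unfolding b1 using t by simp
    also have "\<dots> = (Inv B1 (AddIso b0 ?lq ?g) \<boxplus> \<iota> ?gq)
        \<cdot> (Inv B1 (Assoc B1 (OMap b0 ?lq) ?mg ?gq) \<cdot> (Inv B1 (AddIso b0 ?hl ?hq) \<boxplus> (\<iota> ?mg \<boxplus> \<iota> ?gq)))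
        \<cdot> ((\<iota> ?ml \<boxplus> \<iota> ?mq) \<boxplus> (\<mu> ?X \<boxplus> \<iota> ?gq)) \<cdot> (((AddIso b0 ?hl ?hq \<cdot> AMap b0 ?j) \<boxplus> ?y) \<cdot> ?rp)"
      unfolding b2 using t by simp
    also have "\<dots> = (?c \<boxplus> \<iota> ?gq) \<cdot> Inv B1 (Assoc B1 (?ml \<oplus> ?mq) ?mg ?gq)
        \<cdot> (((\<iota> ?ml \<boxplus> \<iota> ?mq) \<boxplus> (\<mu> ?X \<boxplus> \<iota> ?gq)) \<cdot> Interchange B1 ?ml ?gl ?mq ?gq)
        \<cdot> (?rl \<boxplus> ?rq) \<cdot> ?w"
      unfolding rsum b3 using t by simp
    also have "\<dots> = (?c \<boxplus> \<iota> ?gq) \<cdot> Inv B1 (Assoc B1 (?ml \<oplus> ?mq) ?mg ?gq) \<cdot> Interchange B1 ?ml ?mg ?mq ?gq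
        \<cdot> (((\<iota> ?ml \<boxplus> \<mu> ?X) \<cdot> ?rl) \<boxplus> ?rq) \<cdot> ?w"
      unfolding b4 using t by simp
    also have "\<dots> = snd third" unfolding v common ..
    finally show "snd third = (AMap b0 (?j \<boxplus>\<^bsub>B0\<^esub> \<iota>\<^bsub>B0\<^esub> ?g) \<boxplus> \<iota> ?gq) \<cdot> snd ?second" ..
  qed (use t in \<open>simp_all add: third_def B.L.comp_rep_def G.map_rep_def\<close>)
  show ?thesis
    by (rule B.eqv_trans[OF r1 e1 B.eqv_sym[OF r2 e2]])
qed

end

section \<open>Homotopic morphisms agree in cohomology\<close>

locale homotopic_morphisms = F: complex_morphism R A B F + G: complex_morphism R A B G
  for R :: "('r, 's) ring_data"
    and A :: "('r, 's, 'o, 'm) complex_data" and B :: "('r, 's, 'p, 'q) complex_data" and F G +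
  fixes H \<tau>
  assumes homotopy: "cochain_homotopy R A B F G H \<tau>"
begin

lemma homotopy_step_at:
  "homotopy_step R (Mod A k) (Mod A (k + 1)) (Dif A k) (Mod B (k - 1)) (Mod B k) (Dif B (k - 1))
     (Map F k) (Map G k) (H (k - 1)) (H k) (\<tau> k)"
proof -
  have H: "two_module_hom R (Mod A m) (Mod B (m - 1)) (H (m - 1))" for m
    using homotopy by (simp add: cochain_homotopy_def)
  have "two_morphism R (Mod A k) (Mod B k) (Map F k)
      (sum_hom (Mod B k) (sum_hom (Mod B k) (comp_hom (Mod B k) (Dif B (k - 1)) (H (k - 1)))
          (comp_hom (Mod B k) (H k) (Dif A k))) (Map G k)) (\<tau> k)"
    using homotopy by (simp add: cochain_homotopy_def)
  then show ?thesis
    using F.A.Dif_hom[of k] F.B.Dif_hom[of "k - 1"] F.Map_hom[of k] G.Map_hom[of k] H[of k] H[of "k + 1"]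
    by (intro homotopy_step.intro homotopy_step_axioms.intro module_hom.intro) simp_all
qed

lemma homotopy_square_at:
  "homotopy_square R (Mod A k) (Mod A (k + 1)) (Mod A (k + 2)) (Dif A k) (Dif A (k + 1)) (Nul A k)
     (Mod B (k - 1)) (Mod B k) (Mod B (k + 1)) (Dif B (k - 1)) (Dif B k) (Nul B (k - 1))
     (Map F k) (Map F (k + 1)) (Sqr F k) (Map G k) (Map G (k + 1)) (Sqr G k) (H (k - 1)) (H k) (H (k + 1)) (\<tau> k) (\<tau> (k + 1))"
proof -
  have b: "null_sequence R (Mod B (k - 1)) (Mod B k) (Mod B (k + 1)) (Dif B (k - 1)) (Dif B k) (Nul B (k - 1))"
    using F.B.null_sequence_at[of "k - 1"] by (simp add: add.commute)
  have v: "homotopy_step R (Mod A (k + 1)) (Mod A (k + 2)) (Dif A (k + 1)) (Mod B k) (Mod B (k + 1)) (Dif B k)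
     (Map F (k + 1)) (Map G (k + 1)) (H k) (H (k + 1)) (\<tau> (k + 1))"
    using homotopy_step_at[of "k + 1"] by (simp add: add.commute)
  note c = homotopy[unfolded cochain_homotopy_def Let_def, THEN conjunct2, THEN conjunct2, THEN spec[of _ k], THEN bspec]
  show ?thesis
    using F.A.null_sequence_at[of k] b F.hom_square_at[of k] G.hom_square_at[of k] homotopy_step_at[of k] v
    by (intro homotopy_square.intro homotopy_square_axioms.intro c)
qed

end

theorem proposition1:
  fixes R :: "('r, 's) ring_data"
    and A :: "('r, 's, 'o, 'm) complex_data" and B :: "('r, 's, 'p, 'q) complex_data"
    and F G :: "('r, 'o, 'm, 'p, 'q) complex_mor_data"
    and n :: int
  assumes "two_ring R"
    and "cochain_complex R A" and "cochain_complex R B"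
    and "complex_morphism R A B F" and "complex_morphism R A B G"
    and "cochain_homotopic R A B F G"
  shows "equivalent_homs R (cohomology R A n) (cohomology R B n)
    (cohomology_map R A B F n) (cohomology_map R A B G n)"
proof -
  obtain H \<tau> where h: "cochain_homotopy R A B F G H \<tau>"
    using assms(6) by (auto simp: cochain_homotopic_def)
  interpret F: complex_morphism_at_degree R A B F n
    by (intro complex_morphism_at_degree.intro assms)
  interpret G: complex_morphism_at_degree R A B G n
    by (intro complex_morphism_at_degree.intro assms)
  interpret homotopic_morphisms R A B F G H \<tau>
    by (intro homotopic_morphisms.intro homotopic_morphisms_axioms.intro assms h)
  \<comment> \<open>Degree \<open>n - 1\<close> is needed for naturality, degree \<open>n\<close> for the side condition.\<close>
  interpret Lo: homotopy_square R "Mod A (n - 1)" "Mod A n" "Mod A (n + 1)" "Dif A (n - 1)" "Dif A n" "Nul A (n - 1)"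
     "Mod B (n - 2)" "Mod B (n - 1)" "Mod B n" "Dif B (n - 2)" "Dif B (n - 1)" "Nul B (n - 2)"
     "Map F (n - 1)" "Map F n" "Sqr F (n - 1)" "Map G (n - 1)" "Map G n" "Sqr G (n - 1)"
     "H (n - 2)" "H (n - 1)" "H n" "\<tau> (n - 1)" "\<tau> n"
    using homotopy_square_at[of "n - 1"] by (simp add: add.commute)
  interpret Up: homotopy_square R "Mod A n" "Mod A (n + 1)" "Mod A (n + 2)" "Dif A n" "Dif A (n + 1)" "Nul A n"
     "Mod B (n - 1)" "Mod B n" "Mod B (n + 1)" "Dif B (n - 1)" "Dif B n" "Nul B (n - 1)"
     "Map F n" "Map F (n + 1)" "Sqr F n" "Map G n" "Map G (n + 1)" "Sqr G n"
     "H (n - 1)" "H n" "H (n + 1)" "\<tau> n" "\<tau> (n + 1)"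
    by (rule homotopy_square_at)
  let ?kF = "F.T.Q.kernel_map" and ?kG = "G.T.Q.kernel_map"
  define r where "r P = (OMap (H (n - 1)) (fst P), Lo.V.reduced P)" for P
  define \<rho> where "\<rho> P = F.CB.cls (?kF P) (?kG P) (r P)" for P
  have ko: "F.CA.T.L.kernel_obj P" if "P \<in> coh_Obj A n" for P
    by (rule F.CA.coh_Obj_kernel_obj[OF that])
  have r: "F.CB.T.kernel_rep (r P) (?kF P) (?kG P)" if P: "P \<in> coh_Obj A n" for P
  proof -
    have "F.CB.T.L.kernel_hom (?kF P) (F.CB.T.L.kernel_add (F.CB.T.lift (OMap (H (n - 1)) (fst P))) (?kG P)) (Lo.V.reduced P)"
      using P by (intro Up.kernel_hom_reduced) (auto simp: F.CA.coh_Obj_cocycle F.CA.W.cocycle_iff)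
    then show ?thesis
      using ko[OF P] F.CA.T.L.kernel_objD[OF ko[OF P]] by (simp add: F.CB.T.kernel_rep_def r_def)
  qed
  note rr = F.CB.T.kernel_rep_represents[OF r]
  have invertible: "\<exists>g. inverse_arrows (cohomology R B n) (\<rho> P) g" if P: "P \<in> coh_Obj A n" for P
    unfolding \<rho>_def by (intro F.CB.ex_inverse_arrows_cls F.coh_Obj_map G.coh_Obj_map P r)
  have arrow: "\<rho> P \<in> coh_Arr B n" if P: "P \<in> coh_Obj A n" for P
    unfolding \<rho>_def by (intro F.CB.cls_Arr F.coh_Obj_map G.coh_Obj_map P r)
  have nat: "coh_comp B n (\<rho> (Tgt (cohomology R A n) f)) (coh_mapA A B F n f)
     = coh_comp B n (coh_mapA A B G n f) (\<rho> (Src (cohomology R A n) f))" if fa: "f \<in> coh_Arr A n" for f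
  proof -
    obtain P Q p where f: "P \<in> coh_Obj A n" "Q \<in> coh_Obj A n" "F.CA.T.kernel_rep p P Q" "f = F.CA.cls P Q p"
      using F.CA.coh_Arr_cls[OF fa] by blast
    note pF = F.T.kernel_rep_map[OF f(3)] and pG = G.T.kernel_rep_map[OF f(3)]
    have "F.CB.cls (?kF P) (?kG Q) (F.CB.S.L.comp_rep (fst (?kG Q)) (r Q) (F.S.Q.map_rep (fst Q) p))
      = F.CB.cls (?kF P) (?kG Q) (F.CB.S.L.comp_rep (fst (?kG Q)) (G.S.Q.map_rep (fst Q) p) (r P))"
      using Lo.reduced_natural[OF f(3) ko[OF f(1)]] ko[OF f(2)]
        F.CB.S.L.represents_comp[OF F.CB.T.kernel_rep_represents[OF pF] rr[OF f(2)]]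
      by (intro F.CB.cls_cong) (simp_all add: r_def)
    then show ?thesis
      unfolding f(4) F.CA.cohomology_simps F.coh_mapA_cls[OF f(3)] G.coh_mapA_cls[OF f(3)] \<rho>_def
        F.CB.coh_comp_cls[OF pF r[OF f(2)]] F.CB.coh_comp_cls[OF r[OF f(1)] pG] .
  qed
  have add: "coh_comp B n (AddIso (cohomology_map R A B G n) P Q) (\<rho> (F.CA.T.L.kernel_add P Q))
     = coh_comp B n (coh_addA B n (\<rho> P) (\<rho> Q)) (AddIso (cohomology_map R A B F n) P Q)"
    if P: "P \<in> coh_Obj A n" and Q: "Q \<in> coh_Obj A n" for P Q
  proof -
    let ?PQ = "F.CA.T.L.kernel_add P Q"
    have PQ: "?PQ \<in> coh_Obj A n" using P Q by (simp add: F.CA.coh_Obj_cocycle F.CA.W.cocycle_add)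
    note k = ko[OF P] ko[OF Q]
    note t = F.CA.T.L.kernel_objD[OF k(1)] F.CA.T.L.kernel_objD[OF k(2)]
    have 1: "coh_comp B n (AddIso (cohomology_map R A B G n) P Q) (\<rho> ?PQ) = F.CB.cls (?kF ?PQ) (F.CB.T.L.kernel_add (?kG P) (?kG Q))
       (fst (r ?PQ), (\<iota>\<^bsub>Mod B n\<^esub> (OMap (Dif B (n - 1)) (fst (r ?PQ))) \<boxplus>\<^bsub>Mod B n\<^esub> AddIso (Map G n) (fst P) (fst Q)) \<cdot>\<^bsub>Mod B n\<^esub> snd (r ?PQ))"
      (is "_ = F.CB.cls _ _ ?l") unfolding G.cohomology_map_simps \<rho>_def using k
      by (intro F.CB.coh_comp_ind_left[OF r[OF PQ]] G.T.Q.kernel_hom_map_AddIso) simp_all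
    have 2: "coh_comp B n (coh_addA B n (\<rho> P) (\<rho> Q)) (AddIso (cohomology_map R A B F n) P Q)
      = F.CB.cls (?kF ?PQ) (F.CB.T.L.kernel_add (?kG P) (?kG Q))
       (fst (F.CB.S.L.add_rep (fst (?kG P)) (fst (?kG Q)) (r P) (r Q)),
        snd (F.CB.S.L.add_rep (fst (?kG P)) (fst (?kG Q)) (r P) (r Q)) \<cdot>\<^bsub>Mod B n\<^esub> AddIso (Map F n) (fst P) (fst Q))"
      (is "_ = F.CB.cls _ _ ?l'") unfolding F.cohomology_map_simps \<rho>_def F.CB.coh_addA_cls[OF r[OF P] r[OF Q]] using k
      by (intro F.CB.coh_comp_ind_right[OF F.CB.T.kernel_rep_add[OF r[OF P] r[OF Q]]] F.T.Q.kernel_hom_map_AddIso) simp_all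
    show ?thesis
      unfolding 1 2
    proof (rule F.CB.cls_cong[OF _ _ F.CB.S.eqv_AMapI[of "AddIso (H (n - 1)) (fst P) (fst Q)"]])
      show "snd ?l' = (AMap (Dif B (n - 1)) (AddIso (H (n - 1)) (fst P) (fst Q)) \<boxplus>\<^bsub>Mod B n\<^esub> \<iota>\<^bsub>Mod B n\<^esub> (fst (F.CB.T.L.kernel_add (?kG P) (?kG Q)))) \<cdot>\<^bsub>Mod B n\<^esub> snd ?l"
        using t k Lo.V.reduced_AddO[OF k, symmetric]
        by (simp add: F.CB.S.L.add_rep_def r_def)
    qed (use t k rr[OF PQ] in \<open>auto simp: r_def F.CB.S.L.add_rep_def F.CB.S.L.represents_def\<close>)
  qed
  have zero: "coh_comp B n (ZeroIso (cohomology_map R A B G n)) (\<rho> F.CA.T.L.kernel_zero) = ZeroIso (cohomology_map R A B F n)"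
  proof -
    let ?Z = "F.CA.T.L.kernel_zero"
    have Z: "?Z \<in> coh_Obj A n" by (simp add: F.CA.coh_Obj_cocycle F.CA.W.cocycle_zero)
    have 1: "coh_comp B n (ZeroIso (cohomology_map R A B G n)) (\<rho> ?Z) = F.CB.cls (?kF ?Z) F.CB.T.L.kernel_zero
       (fst (r ?Z), (\<iota>\<^bsub>Mod B n\<^esub> (OMap (Dif B (n - 1)) (fst (r ?Z))) \<boxplus>\<^bsub>Mod B n\<^esub> ZeroIso (Map G n)) \<cdot>\<^bsub>Mod B n\<^esub> snd (r ?Z))"
      (is "_ = F.CB.cls _ _ ?l") unfolding G.cohomology_map_simps \<rho>_def
      by (intro F.CB.coh_comp_ind_left[OF r[OF Z]] G.T.Q.kernel_hom_map_ZeroIso) simp_all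
    have z: "Lo.V.reduced ?Z \<in> Arr (Mod B n)" "Src (Mod B n) (Lo.V.reduced ?Z) = OMap (Map F n) \<zero>\<^bsub>Mod A n\<^esub>"
      "Tgt (Mod B n) (Lo.V.reduced ?Z) = OMap (Dif B (n - 1)) (OMap (H (n - 1)) \<zero>\<^bsub>Mod A n\<^esub>) \<oplus>\<^bsub>Mod B n\<^esub> OMap (Map G n) \<zero>\<^bsub>Mod A n\<^esub>"
      using Lo.V.reduced_type[of ?Z] by simp_all
    show ?thesis
      unfolding 1 F.cohomology_map_simps F.CB.coh_ind_cls
    proof (rule F.CB.cls_cong[OF _ _ F.CB.S.eqv_AMapI[of "ZeroIso (H (n - 1))"]])
      show "snd (F.CB.S.L.ind_rep (fst F.CB.T.L.kernel_zero) (ZeroIso (Map F n)))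
       = (AMap (Dif B (n - 1)) (ZeroIso (H (n - 1))) \<boxplus>\<^bsub>Mod B n\<^esub> \<iota>\<^bsub>Mod B n\<^esub> (fst F.CB.T.L.kernel_zero)) \<cdot>\<^bsub>Mod B n\<^esub> snd ?l"
        using z by (simp add: F.CB.S.L.ind_rep_def r_def Lo.V.reduced_Zero[symmetric])
    qed (use z in \<open>auto simp: r_def F.CB.S.L.ind_rep_def F.CB.S.L.represents_def\<close>)
  qed
  have act: "coh_comp B n (ActIso (cohomology_map R A B G n) s P) (\<rho> (F.CA.T.L.kernel_act s P))
     = coh_comp B n (coh_actA R B n (\<iota>\<^bsub>R\<^esub> s) (\<rho> P)) (ActIso (cohomology_map R A B F n) s P)"
    if P: "P \<in> coh_Obj A n" and s: "s \<in> Obj R" for P s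
  proof -
    let ?sP = "F.CA.T.L.kernel_act s P"
    have sP: "?sP \<in> coh_Obj A n" using P s by (simp add: F.CA.coh_Obj_cocycle F.CA.W.cocycle_act)
    note k = ko[OF P]
    note t = F.CA.T.L.kernel_objD[OF k] s
    have 1: "coh_comp B n (ActIso (cohomology_map R A B G n) s P) (\<rho> ?sP) = F.CB.cls (?kF ?sP) (F.CB.T.L.kernel_act s (?kG P))
       (fst (r ?sP), (\<iota>\<^bsub>Mod B n\<^esub> (OMap (Dif B (n - 1)) (fst (r ?sP))) \<boxplus>\<^bsub>Mod B n\<^esub> ActIso (Map G n) s (fst P)) \<cdot>\<^bsub>Mod B n\<^esub> snd (r ?sP))"
      (is "_ = F.CB.cls _ _ ?l") unfolding G.cohomology_map_simps \<rho>_def using k s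
      by (intro F.CB.coh_comp_ind_left[OF r[OF sP]] G.T.Q.kernel_hom_map_ActIso) simp_all
    have 2: "coh_comp B n (coh_actA R B n (\<iota>\<^bsub>R\<^esub> s) (\<rho> P)) (ActIso (cohomology_map R A B F n) s P)
      = F.CB.cls (?kF ?sP) (F.CB.T.L.kernel_act s (?kG P))
       (fst (F.CB.S.L.act_rep s (fst (?kG P)) (r P)), snd (F.CB.S.L.act_rep s (fst (?kG P)) (r P)) \<cdot>\<^bsub>Mod B n\<^esub> ActIso (Map F n) s (fst P))"
      (is "_ = F.CB.cls _ _ ?l'") unfolding F.cohomology_map_simps \<rho>_def F.CB.coh_actA_cls[OF r[OF P] s] using k s
      by (intro F.CB.coh_comp_ind_right[OF F.CB.T.kernel_rep_act[OF r[OF P] s]] F.T.Q.kernel_hom_map_ActIso) simp_all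
    show ?thesis
      unfolding 1 2
    proof (rule F.CB.cls_cong[OF _ _ F.CB.S.eqv_AMapI[of "ActIso (H (n - 1)) s (fst P)"]])
      show "snd ?l' = (AMap (Dif B (n - 1)) (ActIso (H (n - 1)) s (fst P)) \<boxplus>\<^bsub>Mod B n\<^esub> \<iota>\<^bsub>Mod B n\<^esub> (fst (F.CB.T.L.kernel_act s (?kG P)))) \<cdot>\<^bsub>Mod B n\<^esub> snd ?l"
        using t k Lo.V.reduced_ActO[OF k s, symmetric] by (simp add: F.CB.S.L.act_rep_def r_def)
    qed (use t k rr[OF sP] in \<open>auto simp: r_def F.CB.S.L.act_rep_def F.CB.S.L.represents_def\<close>)
  qed
  have "two_morphism R (cohomology R A n) (cohomology R B n) (cohomology_map R A B F n) (cohomology_map R A B G n) \<rho>"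
    unfolding two_morphism_def F.CA.cohomology_simps(1,2,5-) F.CB.cohomology_simps(1,2,5-)
    using nat add zero act arrow
    by (simp add: in_hom_def F.cohomology_map_simps(1,2) G.cohomology_map_simps(1,2) F.CB.cohomology_simps \<rho>_def)
  then show ?thesis
    unfolding equivalent_homs_def F.CA.cohomology_simps using invertible by blast
qed

end
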